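(* Let $V$ be a $2n$-dimensional complex symplectic vector space, $G=\mathrm{Sp}(V)$, and let $\boldsymbol\mu\colon V_{\mathbf F}\times T^*\mathrm{Gr}_G\to\mathfrak g_{\mathbf O}^*$ be the moment map of the $G_{\mathbf O}$-action. Any irreducible component of $\boldsymbol\mu^{-1}(0)$ is of the form $\Lambda^{(\boldsymbol\theta,\boldsymbol\zeta)}$ for a pair of length $n$ partitions $\boldsymbol\theta=(\theta_1\ge\dots\ge\theta_n\ge0)$, $\boldsymbol\zeta=(\zeta_1\ge\dots\ge\zeta_n\ge0)$.
   Context: Ground field $\mathbb C$; $\mathbf F=\mathbb C((t))$, $\mathbf O=\mathbb C[[t]]$; $\mathfrak g=\mathfrak{sp}(V)$; $\mathrm{Gr}_G=G_{\mathbf F}/G_{\mathbf O}$; $V_{\mathbf F}=V\otimes\mathbf F$ carries the symplectic form $\mathrm{Res}\langle f,g\rangle_{\mathbf F}dt$. $\mathrm{Gr}_G$ is identified with the moduli space of parahoric subalgebras of $\mathfrak g_{\mathbf F}$ conjugate to $\mathfrak g_{\mathbf O}$, and $T^*\mathrm{Gr}_G$ with the space of pairs $(\mathfrak p,x)$, where $\mathfrak p$ is such a parahoric subalgebra and $x$ lies in its nilpotent radical. Identify $\mathfrak g_{\mathbf O}^*$ with $\mathfrak g_{\mathbf F}/t\mathfrak g_{\mathbf O}$ and $\mathfrak g_{\mathbf F}$ with $\mathrm{Sym}^2V_{\mathbf F}$. Then $\boldsymbol\mu(v,\mathfrak p,x)=S^2v+x \pmod{t\mathfrak g_{\mathbf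 O}}$, where $S^2v\in\mathrm{Sym}^2V_{\mathbf F}$ is the square of $v$; so $\boldsymbol\mu^{-1}(0)$ is the space of triples $(v,\mathfrak p,x)$ with $S^2v+x\in t\mathfrak g_{\mathbf O}$. **The general linear analogue.** Consider $V_{\mathbf F}\times\mathrm{Gr}_{\mathrm{GL}(2n)}$, its cotangent bundle $T^*V_{\mathbf F}\times T^*\mathrm{Gr}_{\mathrm{GL}(2n)}\cong V_{\mathbf F}\times V_{\mathbf F}\times T^*\mathrm{Gr}_{\mathrm{GL}(2n)}$ (using the symplectic form), and the moment map $\boldsymbol\mu_{\mathrm{GL}(2n)}$ of the $\mathrm{GL}(2n,\mathbf O)$-action to $\mathfrak{gl}(2n,\mathbf O)^*$. The irreducible components of $\boldsymbol\mu_{\mathrm{GL}(2n)}^{-1}(0)$ are numbered by bisignatures $(\boldsymbol\lambda,\boldsymbol\nu)=(\lambda_1\ge\dots\ge\lambda_{2n},\ \nu_1\ge\dots\ge\nu_{2n})$ (integers): $\Lambda^{(\boldsymbol\lambda,\boldsymbol\nu)}_{\mathrm{GL}(2n)}$ is the closure of the conormal bundle $\overset{\circ}{\Lambda}{}^{(\boldsymbol\lambda,\boldsymbol\nu)}_{\mathrm{GL}(2n)}$ to the $\mathrm{GL}(2n,\mathbf O)$-orbit $\mathbb O_{(\boldsymbol\lambda,\boldsymbol\nu)}\subset V_{\mathbf F}\times\mathrm{Gr}_{\mathrm{GL}(2n)}$ of the pair consisting of the vector $\sum_i t^{-\lambda_i}e_i$ and the lattice $\bigoplus_i\mathbf O\,t^{-\lambda_i-\nu_i}e_i$,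 where $e_1,\dots,e_{2n}$ is a basis of $V$. **The involution.** Let $\sigma$ be the involution of $\mathrm{GL}(2n)=\mathrm{GL}(V)$ with fixed subgroup $\mathrm{Sp}(V)$ (inverse of the symplectic adjoint). It induces involutions of $\mathrm{Gr}_{\mathrm{GL}(2n)}$ and $T^*\mathrm{Gr}_{\mathrm{GL}(2n)}$, extended to $V_{\mathbf F}\times V_{\mathbf F}\times T^*\mathrm{Gr}_{\mathrm{GL}(2n)}$ by swapping the two factors $V_{\mathbf F}$. The map $\boldsymbol\mu_{\mathrm{GL}(2n)}$ is $\sigma$-equivariant, and its restriction to $\sigma$-fixed points is $\boldsymbol\mu$. **The components.** For partitions $\boldsymbol\theta,\boldsymbol\zeta$ as in the claim, let $(\boldsymbol\lambda,\boldsymbol\nu)$ be the self-dual bisignature $\boldsymbol\lambda=(\theta_1,\dots,\theta_n,-\theta_n,\dots,-\theta_1)$, $\boldsymbol\nu=(\zeta_1,\dots,\zeta_n,-\zeta_n,\dots,-\zeta_1)$. Then $\Lambda^{(\boldsymbol\theta,\boldsymbol\zeta)}\subset\boldsymbol\mu^{-1}(0)$ is the closure of the fixed point set $\big(\overset{\circ}{\Lambda}{}^{(\boldsymbol\lambda,\boldsymbol\nu)}_{\mathrm{GL}(2n)}\big)^\sigma$ (which is irreducible). *)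

theory Defs
  imports
    "HOL-Analysis.Analysis"
    "HOL-Computational_Algebra.Formal_Laurent_Series"
begin

unbundle no fps_syntax

section \<open>Vectors and matrices over the field of Laurent series\<close>

text \<open>
  The field \<open>F = C((t))\<close> is the type \<open>complex fls\<close>, with \<open>t = fls_X\<close>.  We take \<open>V = complex ^ 'm\<close>
  with an arbitrary symplectic form, given by its Gram matrix \<open>J\<close>.
\<close>

type_synonym 'm Fvec = "complex fls ^ 'm"
type_synonym 'm Fmat = "complex fls ^ 'm ^ 'm"

definition tO :: "int \<Rightarrow> complex fls set" where
  "tO k = {f. \<forall>j<k. fls_nth f j = 0}"  \<comment> \<open>the fractional ideal \<open>t\<^sup>k O\<close>\<close>

definition V_O :: "('m::finite) Fvec set" where
  "V_O = {v. \<forall>i. v $ i \<in> tO 0}"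

definition gl_O :: "('m::finite) Fmat set" where
  "gl_O = {X. \<forall>i j. X $ i $ j \<in> tO 0}"

definition GL_O :: "('m::finite) Fmat set" where
  "GL_O = {g \<in> gl_O. \<exists>h \<in> gl_O. g ** h = mat 1 \<and> h ** g = mat 1}"

definition base_change :: "complex ^ 'm \<Rightarrow> ('m::finite) Fvec" where
  "base_change v = (\<chi> i. fls_const (v $ i))"

definition scal :: "complex fls \<Rightarrow> ('m::finite) Fmat \<Rightarrow> 'm Fmat" where
  "scal c X = map_matrix ((*) c) X"

definition Ad :: "('m::finite) Fmat \<Rightarrow> 'm Fmat \<Rightarrow> 'm Fmat" where
  "Ad g X = g ** X ** matrix_inv g"

definition is_basis :: "(complex ^ ('m::finite)) list \<Rightarrow> bool" where
  "is_basis e \<longleftrightarrow> distinct e \<and> vec.independent (set e) \<and> vec.span (set e) = UNIV"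


section \<open>The symplectic form and the symplectic group\<close>

definition symplectic_gram :: "complex ^ 'm ^ ('m::finite) \<Rightarrow> bool" where
  "symplectic_gram J \<longleftrightarrow> transpose J = - J \<and> invertible J"

definition gram_F :: "complex ^ 'm ^ 'm \<Rightarrow> ('m::finite) Fmat" where
  "gram_F J = map_matrix fls_const J"

text \<open>
  The \<open>F\<close>-valued form on \<open>V_F\<close>; the \<open>C\<close>-valued symplectic form on \<open>V_F\<close> is
  \<open>fls_residue (form_F J f h)\<close>, i.e. the residue of \<open>\<langle>f, h\<rangle> dt\<close>.
\<close>
definition form_F :: "complex ^ 'm ^ 'm \<Rightarrow> ('m::finite) Fvec \<Rightarrow> 'm Fvec \<Rightarrow> complex fls" where
  "form_F J f h = (\<Sum>i\<in>UNIV. f $ i * (gram_F J *v h) $ i)"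

definition Sp_F :: "complex ^ 'm ^ 'm \<Rightarrow> ('m::finite) Fmat set" where
  "Sp_F J = {g. \<forall>f h. form_F J (g *v f) (g *v h) = form_F J f h}"

definition sp_F :: "complex ^ 'm ^ 'm \<Rightarrow> ('m::finite) Fmat set" where
  "sp_F J = {X. \<forall>f h. form_F J (X *v f) h + form_F J f (X *v h) = 0}"

definition sp_O :: "complex ^ 'm ^ 'm \<Rightarrow> ('m::finite) Fmat set" where
  "sp_O J = sp_F J \<inter> gl_O"

definition adjoint_F :: "complex ^ 'm ^ 'm \<Rightarrow> ('m::finite) Fmat \<Rightarrow> 'm Fmat" where
  "adjoint_F J X = matrix_inv (gram_F J) ** transpose X ** gram_F J"

lemma form_F_matrix_right:
  "form_F J u (X *v w) = (\<Sum>i\<in>UNIV. u $ i * ((gram_F J ** X) *v w) $ i)"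
  by (simp add: form_F_def matrix_vector_mul_assoc)

lemma form_F_matrix_left:
  "form_F J (X *v u) w = (\<Sum>i\<in>UNIV. u $ i * ((transpose X ** gram_F J) *v w) $ i)"
proof -
  let ?z = "gram_F J *v w"
  have "form_F J (X *v u) w = (\<Sum>i\<in>UNIV. \<Sum>j\<in>UNIV. X $ i $ j * u $ j * ?z $ i)"
    by (simp add: form_F_def matrix_vector_mult_def sum_distrib_right)
  also have "\<dots> = (\<Sum>j\<in>UNIV. \<Sum>i\<in>UNIV. X $ i $ j * u $ j * ?z $ i)"
    by (rule sum.swap)
  also have "\<dots> = (\<Sum>j\<in>UNIV. u $ j * (transpose X *v ?z) $ j)"
  proof (rule sum.cong)
    fix j
    have "(transpose X *v ?z) $ j = (\<Sum>i\<in>UNIV. X $ i $ j * ?z $ i)"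
      unfolding matrix_vector_mult_def[of "transpose X"] by (simp add: transpose_def)
    then show "(\<Sum>i\<in>UNIV. X $ i $ j * u $ j * ?z $ i) = u $ j * (transpose X *v ?z) $ j"
      by (simp add: sum_distrib_left mult_ac)
  qed simp
  finally show ?thesis
    by (simp add: matrix_vector_mul_assoc)
qed

lemma gram_F_right_inverse:
  assumes "symplectic_gram J"
  shows "\<exists>K. gram_F J ** gram_F K = mat 1"
proof -
  obtain K where K: "J ** K = mat 1"
    using assms by (auto simp: symplectic_gram_def invertible_def)
  have fls_const_sum: "fls_const (\<Sum>i\<in>S. h i) = (\<Sum>i\<in>S. fls_const (h i))"
    if "finite S" for S :: "'m set" and h :: "'m \<Rightarrow> complex"
    using that by (induction S) (simp_all add: fls_plus_const[symmetric])
  have "gram_F J ** gram_F K = gram_F (J ** K)"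
    by (simp add: vec_eq_iff gram_F_def matrix_matrix_mult_def fls_const_sum fls_const_mult_const)
  also have "\<dots> = mat 1"
    by (simp add: K vec_eq_iff gram_F_def mat_def)
  finally show ?thesis by blast
qed

lemma matrix_inv_cancel:
  fixes A :: "('m::finite) Fmat"
  assumes "invertible A"
  shows "A ** matrix_inv A = mat 1" "matrix_inv A ** A = mat 1"
  using someI_ex[OF assms[unfolded invertible_def]] by (simp_all add: matrix_inv_def)

lemma gram_F_inverse:
  assumes "symplectic_gram J"
  shows "gram_F J ** matrix_inv (gram_F J) = mat 1"
proof -
  have "invertible (gram_F J)"
    using gram_F_right_inverse[OF assms] by (metis invertible_right_inverse)
  then show ?thesis
    by (rule matrix_inv_cancel)
qed

lemma form_F_adjoint:
  assumes "symplectic_gram J"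
  shows "form_F J (X *v u) w = form_F J u (adjoint_F J X *v w)"
  unfolding form_F_matrix_left form_F_matrix_right adjoint_F_def
  by (simp add: matrix_mul_assoc gram_F_inverse[OF assms])


section \<open>Affine Grassmannians and their cotangent bundles\<close>

text \<open>
  Points of the symplectic affine Grassmannian are the conjugates \<open>p = Ad g (g_O)\<close> of the standard
  parahoric subalgebra.  The nilpotent radical of \<open>g_O = g[[t]]\<close> is the kernel \<open>t g_O\<close> of the
  evaluation at \<open>t = 0\<close>, hence that of \<open>p\<close> is \<open>Ad g (t g_O) = t p\<close>.  Under the pairing
  \<open>Res tr(x X) dt/t\<close> it is the space of covectors at \<open>p\<close>.
\<close>

definition Gr_Sp :: "complex ^ 'm ^ 'm \<Rightarrow> ('m::finite) Fmat set set" where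
  "Gr_Sp J = {Ad g ` sp_O J | g. g \<in> Sp_F J}"

definition nil_radical :: "('m::finite) Fmat set \<Rightarrow> 'm Fmat set" where
  "nil_radical p = scal fls_X ` p"

lemma scal_mult: "scal c A ** B = scal c (A ** B)" "A ** scal c B = scal c (A ** B)"
  by (simp_all add: scal_def vec_eq_iff matrix_matrix_mult_def sum_distrib_left mult_ac)

lemma nil_radical_Ad: "nil_radical (Ad g ` p) = Ad g ` nil_radical p"
  by (simp add: nil_radical_def image_image Ad_def scal_mult)

definition cotangent_Sp :: "complex ^ 'm ^ 'm \<Rightarrow> ('m Fvec \<times> 'm Fmat set \<times> ('m::finite) Fmat) set"
  where "cotangent_Sp J = {(v, p, x). p \<in> Gr_Sp J \<and> x \<in> nil_radical p}"

text \<open>For the general linear group, \<open>g GL(O)\<close> is encoded as the lattice \<open>g V_O\<close>.\<close>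

definition Gr_GL :: "('m::finite) Fvec set set" where
  "Gr_GL = {(*v) g ` V_O | g :: 'm Fmat. invertible g}"

definition End_lattice :: "('m::finite) Fvec set \<Rightarrow> 'm Fmat set" where
  "End_lattice L = {X. \<forall>u\<in>L. X *v u \<in> L}"


section \<open>The moment map\<close>

text \<open>
  The identification of \<open>Sym\<^sup>2 V_F\<close> with \<open>sp_F\<close> sends \<open>S\<^sup>2 v\<close> to \<open>u \<mapsto> t \<langle>v, u\<rangle> v\<close>.  The factor \<open>t\<close>
  compensates for the fact that the symplectic form of \<open>V_F\<close> uses \<open>dt\<close>, whereas the identification of
  the dual of \<open>g_O\<close> with \<open>g_F / t g_O\<close> uses \<open>dt/t\<close>: it is what makes \<open>S\<^sup>2 v + x\<close> represent the
  functional \<open>X \<mapsto> Res \<langle>v, X v\<rangle> dt + Res tr(x X) dt/t\<close>.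
\<close>

definition S2 :: "complex ^ 'm ^ 'm \<Rightarrow> ('m::finite) Fvec \<Rightarrow> 'm Fmat" where
  "S2 J v = matrix (\<lambda>u. (fls_X * form_F J v u) *s v)"

definition trace_pairing :: "('m::finite) Fmat \<Rightarrow> 'm Fmat \<Rightarrow> complex" where
  "trace_pairing x X = fls_residue (fls_X_inv * trace (x ** X))"

definition moment_map ::
    "complex ^ 'm ^ 'm \<Rightarrow> 'm Fvec \<times> 'm Fmat set \<times> 'm Fmat \<Rightarrow> ('m::finite) Fmat set" where
  "moment_map J = (\<lambda>(v, p, x). {S2 J v + x + Z | Z. Z \<in> scal fls_X ` sp_O J})"
  \<comment> \<open>a coset of \<open>t g_O\<close>, i.e. an element of \<open>g_F / t g_O\<close>\<close>

definition mu_zero :: "complex ^ 'm ^ 'm \<Rightarrow> ('m Fvec \<times> 'm Fmat set \<times> ('m::finite) Fmat) set" where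
  "mu_zero J = {q \<in> cotangent_Sp J. moment_map J q = scal fls_X ` sp_O J}"

lemma form_F_add: "form_F J v (u + w) = form_F J v u + form_F J v w"
  by (simp add: form_F_def matrix_vector_right_distrib algebra_simps sum.distrib)

lemma form_F_scale: "form_F J v (c *s u) = c * form_F J v u"
  by (simp add: form_F_def matrix_vector_mult_def sum_distrib_left mult_ac)

lemma form_F_zero [simp]: "form_F J v 0 = 0"
  by (simp add: form_F_def)

lemma S2_apply: "S2 J v *v u = (fls_X * form_F J v u) *s v"
proof -
  have "Vector_Spaces.linear (*s) (*s) (\<lambda>u. (fls_X * form_F J v u) *s v)"
    by unfold_locales
      (simp_all add: form_F_add form_F_scale vec_eq_iff algebra_simps)
  then show ?thesis
    unfolding S2_def by (rule matrix_works)
qed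

lemma form_F_axis: "(\<Sum>i\<in>UNIV. w $ i * form_F J v (axis i 1)) = form_F J v w"
proof -
  have "form_F J v w = form_F J v (\<Sum>i\<in>UNIV. w $ i *s axis i 1)"
    by (simp add: basis_expansion)
  also have "\<dots> = (\<Sum>i\<in>UNIV. form_F J v (w $ i *s axis i 1))"
  proof -
    have "form_F J v (\<Sum>i\<in>S. w $ i *s axis i 1) = (\<Sum>i\<in>S. form_F J v (w $ i *s axis i 1))"
      if "finite S" for S :: "'a set"
      using that by (induction S) (simp_all add: form_F_add)
    then show ?thesis by simp
  qed
  finally show ?thesis by (simp add: form_F_scale)
qed

lemma moment_map_pairing:
  "trace_pairing (S2 J v + x) X = fls_residue (form_F J v (X *v v)) + trace_pairing x X"
proof -
  have "trace (S2 J v ** X) = trace (X ** S2 J v)"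
    by (rule trace_mul_sym)
  also have "\<dots> = (\<Sum>i\<in>UNIV. (X *v (S2 J v *v axis i 1)) $ i)"
    by (simp add: trace_def matrix_vector_mul_assoc matrix_vector_mult_def[of "X ** S2 J v"] axis_def
        if_distrib cong: if_cong)
  also have "\<dots> = (\<Sum>i\<in>UNIV. fls_X * ((X *v v) $ i * form_F J v (axis i 1)))"
    by (simp only: S2_apply) (simp add: matrix_vector_mult_def sum_distrib_left mult_ac)
  also have "\<dots> = fls_X * form_F J v (X *v v)"
    by (simp add: sum_distrib_left[symmetric] form_F_axis)
  finally have tr: "trace (S2 J v ** X) = fls_X * form_F J v (X *v v)" .
  have "fls_X_inv * (fls_X * f) = f" for f :: "complex fls"
    by (simp only: fls_X_times_conv_shift fls_X_inv_times_conv_shift) simp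
  moreover have "(S2 J v + x) ** X = S2 J v ** X + x ** X"
    by (simp add: matrix_matrix_mult_def vec_eq_iff distrib_right sum.distrib)
  ultimately show ?thesis
    by (simp only: trace_pairing_def trace_add tr distrib_left fls_residue_add)
qed


section \<open>Zariski topology and irreducible components\<close>

text \<open>
  A space with \<open>F\<close>-valued coordinates \<open>C\<close> is the increasing union of the pieces on which all the
  coordinates lie in \<open>t\<^sup>-\<^sup>k O\<close>; such a piece is the set of closed points of an affine space with
  countably many coordinates, the Laurent coefficients.  A set is closed if its intersection with every
  piece is the zero locus of a set of polynomials in these coefficients.
\<close>

inductive_set polynomial_functions :: "('a \<Rightarrow> complex fls) set \<Rightarrow> ('a \<Rightarrow> complex) set"
  for C :: "('a \<Rightarrow> complex fls) set" where
  const: "(\<lambda>_. c) \<in> polynomial_functions C"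
| coeff: "f \<in> C \<Longrightarrow> (\<lambda>a. fls_nth (f a) j) \<in> polynomial_functions C"
| add: "p \<in> polynomial_functions C \<Longrightarrow> q \<in> polynomial_functions C \<Longrightarrow>
    (\<lambda>a. p a + q a) \<in> polynomial_functions C"
| mult: "p \<in> polynomial_functions C \<Longrightarrow> q \<in> polynomial_functions C \<Longrightarrow>
    (\<lambda>a. p a * q a) \<in> polynomial_functions C"

definition bounded_piece :: "('a \<Rightarrow> complex fls) set \<Rightarrow> nat \<Rightarrow> 'a set" where
  "bounded_piece C k = {a. \<forall>f\<in>C. f a \<in> tO (- int k)}"

definition zariski_closed :: "('a \<Rightarrow> complex fls) set \<Rightarrow> 'a set \<Rightarrow> bool" where
  "zariski_closed C S \<longleftrightarrow> (\<forall>k. \<exists>P \<subseteq> polynomial_functions C.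
     S \<inter> bounded_piece C k = {a \<in> bounded_piece C k. \<forall>p\<in>P. p a = 0})"

definition ind_zariski :: "('a \<Rightarrow> complex fls) set \<Rightarrow> 'a topology" where
  "ind_zariski C = topology (\<lambda>U. zariski_closed C (- U))"

lemma zariski_closed_Un:
  assumes "zariski_closed C S" "zariski_closed C T"
  shows "zariski_closed C (S \<union> T)"
  unfolding zariski_closed_def
proof
  fix k
  let ?B = "bounded_piece C k"
  obtain P where P: "P \<subseteq> polynomial_functions C" "S \<inter> ?B = {a \<in> ?B. \<forall>p\<in>P. p a = 0}"
    using assms(1) unfolding zariski_closed_def by blast
  obtain Q where Q: "Q \<subseteq> polynomial_functions C" "T \<inter> ?B = {a \<in> ?B. \<forall>q\<in>Q. q a = 0}"
    using assms(2) unfolding zariski_closed_def by blast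
  define R where "R = (\<lambda>(p, q) a. p a * q a) ` (P \<times> Q)"
  have R: "R \<subseteq> polynomial_functions C"
    using P(1) Q(1) by (auto simp: R_def intro!: polynomial_functions.mult)
  have iff: "(\<forall>r\<in>R. r a = 0) \<longleftrightarrow> (\<forall>p\<in>P. p a = 0) \<or> (\<forall>q\<in>Q. q a = 0)" for a
    by (auto simp: R_def)
  have "(S \<union> T) \<inter> ?B = {a \<in> ?B. \<forall>r\<in>R. r a = 0}"
    unfolding Int_Un_distrib2 P(2) Q(2) iff by auto
  from conjI[OF R this]
  show "\<exists>P \<subseteq> polynomial_functions C. (S \<union> T) \<inter> ?B = {a \<in> ?B. \<forall>p\<in>P. p a = 0}"
    by (rule exI[of _ R])
qed

lemma zariski_closed_INT:
  assumes "\<And>S. S \<in> \<S> \<Longrightarrow> zariski_closed C S"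
  shows "zariski_closed C (\<Inter>\<S>)"
  unfolding zariski_closed_def
proof
  fix k
  let ?B = "bounded_piece C k"
  have "\<forall>S\<in>\<S>. \<exists>P. P \<subseteq> polynomial_functions C \<and> S \<inter> ?B = {a \<in> ?B. \<forall>p\<in>P. p a = 0}"
    using assms unfolding zariski_closed_def by simp
  from bchoice[OF this] obtain P where P: "\<forall>S\<in>\<S>. P S \<subseteq> polynomial_functions C \<and>
      S \<inter> ?B = {a \<in> ?B. \<forall>p\<in>P S. p a = 0}"
    by (rule exE)
  have iff: "a \<in> S \<longleftrightarrow> (\<forall>p\<in>P S. p a = 0)" if "a \<in> ?B" "S \<in> \<S>" for a S
    using arg_cong[OF conjunct2[OF bspec[OF P that(2)]], of "\<lambda>A. a \<in> A"] that(1) by simp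
  have "(\<Union>S\<in>\<S>. P S) \<subseteq> polynomial_functions C"
    by (rule UN_least) (rule conjunct1[OF bspec[OF P]])
  moreover have "\<Inter>\<S> \<inter> ?B = {a \<in> ?B. \<forall>p\<in>(\<Union>S\<in>\<S>. P S). p a = 0}"
    using iff by auto
  ultimately show "\<exists>P \<subseteq> polynomial_functions C. \<Inter>\<S> \<inter> ?B = {a \<in> ?B. \<forall>p\<in>P. p a = 0}"
    by (rule_tac exI[of _ "\<Union>S\<in>\<S>. P S"]) (rule conjI)
qed

lemma openin_ind_zariski: "openin (ind_zariski C) U \<longleftrightarrow> zariski_closed C (- U)"
proof -
  have "istopology (\<lambda>U. zariski_closed C (- U))"
    unfolding istopology_def
  proof (intro conjI allI impI)
    fix S T assume "zariski_closed C (- S)" "zariski_closed C (- T)"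
    then show "zariski_closed C (- (S \<inter> T))"
      by (simp add: Compl_Int zariski_closed_Un)
  next
    fix \<K> assume "\<forall>K\<in>\<K>. zariski_closed C (- K)"
    then have "zariski_closed C (\<Inter>(uminus ` \<K>))"
      by (intro zariski_closed_INT) auto
    then show "zariski_closed C (- \<Union>\<K>)"
      by (simp add: uminus_Sup)
  qed
  then show ?thesis
    by (simp add: ind_zariski_def)
qed

text \<open>
  \<open>V_F \<times> T\<^sup>*Gr_Sp\<close> carries the quotient topology with respect to the \<open>Sp(O)\<close>-torsor that replaces the
  point \<open>p\<close> of \<open>Gr_Sp\<close> by an element \<open>g\<close> of \<open>Sp(F)\<close> with \<open>p = Ad g (g_O)\<close>.
\<close>

definition entries :: "('m Fvec \<times> 'm Fmat \<times> ('m::finite) Fmat \<Rightarrow> complex fls) set" where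
  "entries = {\<lambda>(v, g, x). v $ i | i. True} \<union> {\<lambda>(v, g, x). g $ i $ j | i j. True}
     \<union> {\<lambda>(v, g, x). x $ i $ j | i j. True}"

definition cover :: "complex ^ 'm ^ 'm \<Rightarrow> ('m Fvec \<times> 'm Fmat \<times> ('m::finite) Fmat) set" where
  "cover J = {(v, g, x). g \<in> Sp_F J \<and> x \<in> nil_radical (Ad g ` sp_O J)}"

definition cover_proj ::
    "complex ^ 'm ^ 'm \<Rightarrow> 'm Fvec \<times> 'm Fmat \<times> 'm Fmat \<Rightarrow> 'm Fvec \<times> 'm Fmat set \<times> ('m::finite) Fmat"
  where "cover_proj J = (\<lambda>(v, g, x). (v, Ad g ` sp_O J, x))"

definition cotangent_topology ::
    "complex ^ 'm ^ 'm \<Rightarrow> ('m Fvec \<times> 'm Fmat set \<times> ('m::finite) Fmat) topology" where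
  "cotangent_topology J = topology (\<lambda>U. U \<subseteq> cotangent_Sp J \<and>
     openin (subtopology (ind_zariski entries) (cover J)) {a \<in> cover J. cover_proj J a \<in> U})"

lemma openin_cotangent_topology:
  "openin (cotangent_topology J) U \<longleftrightarrow> U \<subseteq> cotangent_Sp J \<and>
     openin (subtopology (ind_zariski entries) (cover J)) {a \<in> cover J. cover_proj J a \<in> U}"
proof -
  let ?X = "subtopology (ind_zariski entries) (cover J)"
  let ?pre = "\<lambda>U. {a \<in> cover J. cover_proj J a \<in> U}"
  have "istopology (\<lambda>U. U \<subseteq> cotangent_Sp J \<and> openin ?X (?pre U))"
    unfolding istopology_def
  proof (intro conjI allI impI; (elim conjE)?)
    fix S T assume "openin ?X (?pre S)" "openin ?X (?pre T)"
    then have "openin ?X (?pre S \<inter> ?pre T)" by (rule openin_Int)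
    moreover have "?pre S \<inter> ?pre T = ?pre (S \<inter> T)" by auto
    ultimately show "openin ?X (?pre (S \<inter> T))" by simp
  next
    fix \<K> assume *: "\<forall>K\<in>\<K>. K \<subseteq> cotangent_Sp J \<and> openin ?X (?pre K)"
    then have "openin ?X (\<Union>K\<in>\<K>. ?pre K)" by blast
    moreover have "(\<Union>K\<in>\<K>. ?pre K) = ?pre (\<Union>\<K>)" by auto
    ultimately show "openin ?X (?pre (\<Union>\<K>))" by simp
  qed auto
  then show ?thesis
    by (simp add: cotangent_topology_def)
qed

lemma topspace_ind_zariski [simp]: "topspace (ind_zariski C) = UNIV"
proof -
  have "zariski_closed C {}"
    unfolding zariski_closed_def
    by (intro allI exI[of _ "{\<lambda>_. 1}"]) (auto intro: polynomial_functions.const)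
  then have "openin (ind_zariski C) UNIV"
    by (simp add: openin_ind_zariski)
  then show ?thesis
    using openin_subset by fastforce
qed

lemma cover_proj_image: "cover_proj J ` cover J = cotangent_Sp J"
  by (force simp: cover_proj_def cover_def cotangent_Sp_def Gr_Sp_def image_iff)

lemma quotient_map_cover_proj:
  "quotient_map (subtopology (ind_zariski entries) (cover J)) (cotangent_topology J) (cover_proj J)"
proof -
  have "{a \<in> cover J. cover_proj J a \<in> cotangent_Sp J} = cover J"
    using cover_proj_image[of J] by auto
  moreover have "openin (subtopology (ind_zariski entries) (cover J)) (cover J)"
    by (metis inf.idem openin_subtopology_self openin_topspace topspace_subtopology
        topspace_ind_zariski inf_top_left)
  ultimately have "openin (cotangent_topology J) (cotangent_Sp J)"
    by (simp add: openin_cotangent_topology)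
  then have "topspace (cotangent_topology J) = cotangent_Sp J"
    by (meson openin_cotangent_topology openin_subset openin_topspace subset_antisym)
  then show ?thesis
    by (auto simp: quotient_map_def cover_proj_image openin_cotangent_topology)
qed

definition mu_zero_topology ::
    "complex ^ 'm ^ 'm \<Rightarrow> ('m Fvec \<times> 'm Fmat set \<times> ('m::finite) Fmat) topology" where
  "mu_zero_topology J = subtopology (cotangent_topology J) (mu_zero J)"

definition irreducible_set :: "'a topology \<Rightarrow> 'a set \<Rightarrow> bool" where
  "irreducible_set T Z \<longleftrightarrow> Z \<noteq> {} \<and> Z \<subseteq> topspace T \<and>
     (\<forall>A B. closedin T A \<longrightarrow> closedin T B \<longrightarrow> Z \<subseteq> A \<union> B \<longrightarrow> Z \<subseteq> A \<or> Z \<subseteq> B)"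

text \<open>
  The zero fibre is an ind-scheme, so its irreducible components are the maximal irreducible closed
  subschemes; a subscheme lies in one of the schemes whose union is the ind-scheme.
  Without this restriction one would also have to consider irreducible closed subsets that are not
  subschemes, such as the whole zero section \<open>{0} \<times> Gr_Sp\<close>.
\<close>

definition stage ::
    "complex ^ 'm ^ 'm \<Rightarrow> nat \<Rightarrow> ('m Fvec \<times> 'm Fmat set \<times> ('m::finite) Fmat) set" where
  "stage J k = cover_proj J ` (cover J \<inter> bounded_piece entries k)"

definition irreducible_closed_sub ::
    "complex ^ 'm ^ 'm \<Rightarrow> ('m Fvec \<times> 'm Fmat set \<times> ('m::finite) Fmat) set \<Rightarrow> bool" where
  "irreducible_closed_sub J Z \<longleftrightarrow> closedin (mu_zero_topology J) Z \<and>
     irreducible_set (mu_zero_topology J) Z \<and> (\<exists>k. Z \<subseteq> stage J k)"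

definition irreducible_component ::
    "complex ^ 'm ^ 'm \<Rightarrow> ('m Fvec \<times> 'm Fmat set \<times> ('m::finite) Fmat) set \<Rightarrow> bool" where
  "irreducible_component J Z \<longleftrightarrow> irreducible_closed_sub J Z \<and>
     (\<forall>Z'. irreducible_closed_sub J Z' \<longrightarrow> Z \<subseteq> Z' \<longrightarrow> Z' = Z)"


section \<open>Conormal bundles for the general linear group and their fixed points\<close>

text \<open>
  The bisignature \<open>(l, m)\<close> corresponds to \<open>(\<lambda>, \<nu>)\<close>; lists are indexed from \<open>0\<close>.
  The orbit does not depend on the basis \<open>e\<close> of \<open>V\<close>, because \<open>GL(V)\<close> is contained in \<open>GL(O)\<close>.
\<close>

definition base_vector :: "(complex ^ ('m::finite)) list \<Rightarrow> int list \<Rightarrow> 'm Fvec" where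
  "base_vector e l = (\<Sum>i<length e. fls_X_intpow (- (l ! i)) *s base_change (e ! i))"

definition base_lattice ::
    "(complex ^ ('m::finite)) list \<Rightarrow> int list \<Rightarrow> int list \<Rightarrow> 'm Fvec set" where
  "base_lattice e l m =
     {\<Sum>i<length e. (a i * fls_X_intpow (- (l ! i) - m ! i)) *s base_change (e ! i) | a.
       \<forall>i<length e. a i \<in> tO 0}"

definition GL_orbit ::
    "(complex ^ ('m::finite)) list \<Rightarrow> int list \<Rightarrow> int list \<Rightarrow> ('m Fvec \<times> 'm Fvec set) set" where
  "GL_orbit e l m = {(g *v base_vector e l, (*v) g ` base_lattice e l m) | g. g \<in> GL_O}"

text \<open>
  The tangent space of \<open>V_F \<times> Gr_GL\<close> at \<open>(v, L)\<close> is \<open>V_F \<times> gl_F / End L\<close>, and the tangent space of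
  the orbit consists of the \<open>(X v, X mod End L)\<close> with \<open>X\<close> in \<open>gl_O\<close>.  A covector is a pair \<open>(w, x)\<close>,
  with \<open>w\<close> in \<open>V_F\<close> by means of the symplectic form and \<open>x\<close> in the nilpotent radical of \<open>End L\<close>.
\<close>

definition covector_pairing ::
    "complex ^ 'm ^ 'm \<Rightarrow> 'm Fvec \<times> 'm Fmat \<Rightarrow> 'm Fvec \<times> ('m::finite) Fmat \<Rightarrow> complex" where
  "covector_pairing J = (\<lambda>(w, x) (u, Y). fls_residue (form_F J w u) + trace_pairing x Y)"

definition conormal_bundle ::
    "complex ^ 'm ^ 'm \<Rightarrow> (complex ^ 'm) list \<Rightarrow> int list \<Rightarrow> int list \<Rightarrow>
     ('m Fvec \<times> 'm Fvec \<times> 'm Fvec set \<times> ('m::finite) Fmat) set" where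
  "conormal_bundle J e l m =
     {(v, w, L, x). (v, L) \<in> GL_orbit e l m \<and> L \<in> Gr_GL \<and> x \<in> nil_radical (End_lattice L) \<and>
        (\<forall>X\<in>gl_O. covector_pairing J (w, x) (X *v v, X) = 0)}"

text \<open>
  The involution of \<open>GL(V)\<close> is \<open>g \<mapsto> (g\<^sup>*)\<^sup>-\<^sup>1\<close>; its differential is \<open>X \<mapsto> - X\<^sup>*\<close> and on lattices it
  induces \<open>L \<mapsto> L\<^sup>\<bottom>\<close>.  The two factors \<open>V_F\<close> are swapped.
\<close>

definition dual_lattice :: "complex ^ 'm ^ 'm \<Rightarrow> 'm Fvec set \<Rightarrow> ('m::finite) Fvec set" where
  "dual_lattice J L = {u. \<forall>w\<in>L. form_F J u w \<in> tO 0}"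

lemma tO_add: "f \<in> tO k \<Longrightarrow> h \<in> tO k \<Longrightarrow> f + h \<in> tO k"
  by (simp add: tO_def)

lemma tO_sum: "(\<And>i. i \<in> S \<Longrightarrow> f i \<in> tO k) \<Longrightarrow> sum f S \<in> tO k"
  by (induction S rule: infinite_finite_induct) (simp_all add: tO_add, simp_all add: tO_def)

lemma tO_mult: "f \<in> tO 0 \<Longrightarrow> h \<in> tO 0 \<Longrightarrow> f * h \<in> tO 0"
proof -
  have sub: "f \<in> tO 0 \<longleftrightarrow> 0 \<le> fls_subdegree f" for f :: "complex fls"
    by (auto simp: tO_def intro: fls_subdegree_ge0I)
  show "f \<in> tO 0 \<Longrightarrow> h \<in> tO 0 \<Longrightarrow> f * h \<in> tO 0"
    by (simp add: sub fls_mult_subdegree_ge_0)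
qed

lemma V_O_mult: "X \<in> gl_O \<Longrightarrow> u \<in> V_O \<Longrightarrow> X *v u \<in> V_O"
  by (auto simp: gl_O_def V_O_def matrix_vector_mult_def intro!: tO_sum tO_mult)

lemma dual_V_O:
  fixes J :: "complex ^ 'm ^ ('m::finite)"
  assumes "symplectic_gram J"
  shows "dual_lattice J V_O = V_O"
proof
  have const: "gram_F A \<in> gl_O" for A :: "complex ^ 'm ^ 'm"
    by (simp add: gram_F_def gl_O_def tO_def)
  show "V_O \<subseteq> dual_lattice J V_O"
  proof
    fix u :: "'m Fvec" assume u: "u \<in> V_O"
    have "form_F J u w \<in> tO 0" if "w \<in> V_O" for w
      using u V_O_mult[OF const[of J] that]
      by (auto simp: form_F_def V_O_def intro!: tO_sum tO_mult)
    then show "u \<in> dual_lattice J V_O" by (simp add: dual_lattice_def)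
  qed
  show "dual_lattice J V_O \<subseteq> V_O"
  proof
    fix u :: "'m Fvec" assume u: "u \<in> dual_lattice J V_O"
    obtain K where K: "gram_F J ** gram_F K = mat 1"
      using gram_F_right_inverse[OF assms] by blast
    have "u $ j \<in> tO 0" for j
    proof -
      have "axis j 1 \<in> (V_O :: 'm Fvec set)"
        by (simp add: V_O_def axis_def tO_def)
      then have "gram_F K *v axis j 1 \<in> V_O"
        by (rule V_O_mult[OF const])
      then have "form_F J u (gram_F K *v axis j 1) \<in> tO 0"
        using u by (simp add: dual_lattice_def)
      moreover have "form_F J u (gram_F K *v axis j 1) = u $ j"
        unfolding form_F_matrix_right K
        by (simp add: axis_def if_distrib cong: if_cong)
      ultimately show ?thesis by simp
    qed
    then show "u \<in> V_O" by (simp add: V_O_def)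
  qed
qed

lemma dual_lattice_Gr:
  fixes J :: "complex ^ 'm ^ ('m::finite)" and g :: "'m Fmat"
  assumes J: "symplectic_gram J" and g: "invertible g"
  shows "dual_lattice J ((*v) g ` V_O) = (*v) (matrix_inv (adjoint_F J g)) ` V_O"
proof -
  let ?a = "adjoint_F J"
  have adj: "form_F J u (X *v w) = form_F J (?a X *v u) w" for X u w
  proof -
    have skew: "form_F J a b = - form_F J b a" for a b
    proof -
      have G: "gram_F J $ i $ j = - gram_F J $ j $ i" for i j
      proof -
        have "transpose J $ j $ i = (- J) $ j $ i"
          using J by (simp add: symplectic_gram_def)
        then show ?thesis
          by (simp add: gram_F_def transpose_def)
      qed
      have "form_F J a b = (\<Sum>i\<in>UNIV. \<Sum>j\<in>UNIV. a $ i * (gram_F J $ i $ j * b $ j))"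
        by (simp add: form_F_def matrix_vector_mult_def sum_distrib_left)
      also have "\<dots> = (\<Sum>i\<in>UNIV. \<Sum>j\<in>UNIV. - (b $ j * (gram_F J $ j $ i * a $ i)))"
      proof (intro sum.cong refl)
        fix i j
        show "a $ i * (gram_F J $ i $ j * b $ j) = - (b $ j * (gram_F J $ j $ i * a $ i))"
          unfolding G[of i j] by simp
      qed
      also have "\<dots> = (\<Sum>j\<in>UNIV. \<Sum>i\<in>UNIV. - (b $ j * (gram_F J $ j $ i * a $ i)))"
        by (rule sum.swap)
      finally show ?thesis
        by (simp add: form_F_def matrix_vector_mult_def sum_distrib_left sum_negf)
    qed
    show ?thesis
      using form_F_adjoint[OF J, of X w u] skew by metis
  qed
  have inv_F: "invertible (gram_F J)"
    using gram_F_inverse[OF J] by (metis invertible_right_inverse)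
  have "invertible (transpose g)"
    using g unfolding invertible_def by (metis matrix_transpose_mul transpose_mat)
  then have "invertible (?a g)"
    unfolding adjoint_F_def
    by (intro invertible_mult inv_F) (metis gram_F_inverse[OF J] invertible_left_inverse)
  then have inv: "?a g ** matrix_inv (?a g) = mat 1" "matrix_inv (?a g) ** ?a g = mat 1"
    by (simp_all add: matrix_inv_cancel)
  have "u \<in> dual_lattice J ((*v) g ` V_O) \<longleftrightarrow> ?a g *v u \<in> V_O" for u
    using dual_V_O[OF J] by (auto simp: dual_lattice_def adj)
  moreover have "?a g *v u \<in> V_O \<longleftrightarrow> u \<in> (*v) (matrix_inv (?a g)) ` V_O" for u
    using inv by (auto simp: matrix_vector_mul_assoc image_iff)
      (metis matrix_vector_mul_assoc matrix_vector_mul_lid)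
  ultimately show ?thesis by auto
qed

definition sigma ::
    "complex ^ 'm ^ 'm \<Rightarrow> 'm Fvec \<times> 'm Fvec \<times> 'm Fvec set \<times> 'm Fmat \<Rightarrow>
     'm Fvec \<times> 'm Fvec \<times> 'm Fvec set \<times> ('m::finite) Fmat" where
  "sigma J = (\<lambda>(v, w, L, x). (w, v, dual_lattice J L, - adjoint_F J x))"

text \<open>
  A \<open>\<sigma>\<close>-fixed lattice is a self-dual one and corresponds to the parahoric subalgebra of \<open>sp_F\<close>
  preserving it.
\<close>

definition stabilizer_sp :: "complex ^ 'm ^ 'm \<Rightarrow> 'm Fvec set \<Rightarrow> ('m::finite) Fmat set" where
  "stabilizer_sp J L = sp_F J \<inter> End_lattice L"

definition conormal_fixed_points ::
    "complex ^ 'm ^ 'm \<Rightarrow> (complex ^ 'm) list \<Rightarrow> int list \<Rightarrow> int list \<Rightarrow>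
     ('m Fvec \<times> 'm Fmat set \<times> ('m::finite) Fmat) set" where
  "conormal_fixed_points J e l m =
     {(v, stabilizer_sp J L, x) | v w L x.
        (v, w, L, x) \<in> conormal_bundle J e l m \<and> sigma J (v, w, L, x) = (v, w, L, x)}"

definition is_partition :: "nat \<Rightarrow> nat list \<Rightarrow> bool" where
  "is_partition n \<theta> \<longleftrightarrow> length \<theta> = n \<and> sorted_wrt (\<ge>) \<theta>"

definition self_dual_signature :: "nat list \<Rightarrow> int list" where
  "self_dual_signature \<theta> = map int \<theta> @ rev (map (\<lambda>a. - int a) \<theta>)"

definition Lambda ::
    "complex ^ 'm ^ 'm \<Rightarrow> (complex ^ 'm) list \<Rightarrow> nat list \<Rightarrow> nat list \<Rightarrow>
     ('m Fvec \<times> 'm Fmat set \<times> ('m::finite) Fmat) set" where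
  "Lambda J e \<theta> \<zeta> = mu_zero_topology J closure_of
     conormal_fixed_points J e (self_dual_signature \<theta>) (self_dual_signature \<zeta>)"

end

theory Submission
  imports Defs "HOL-Computational_Algebra.Polynomial"
begin

unbundle no fps_syntax

text \<open>
  Write \<open>p\<close> as the stabilizer of a self-dual lattice \<open>L\<close> and choose a symplectic frame \<open>E\<close> of \<open>V_O\<close> with
  \<open>L = \<Oplus> t\<^bsup>-m i\<^esup> O E\<^sub>i\<close>.  In the coordinates \<open>v = \<Sum> a\<^sub>i E\<^sub>i\<close> the vanishing of the moment map forces
  \<open>a\<^sub>i a\<^sub>j \<in> O + t\<^bsup>-m i - m j\<^esup> O\<close>, and an elementary argument with valuations puts \<open>v\<close> into a self-dual lattice
  \<open>\<Oplus> t\<^bsup>-l i\<^esup> O E\<^sub>i\<close> such that \<open>l\<close> and \<open>m - l\<close> are self-dual signatures of partitions.  Hence the zero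
  fibre is a union of strata indexed by pairs of partitions, finitely many of which meet a given stage.
  Two points of a stratum are joined by a curve in it whose coordinates are polynomials in the
  parameter: symplectic frames are related by products of transvections, and the remaining data form
  an affine bundle.  A closed set contains all or finitely many points of such a curve, so the
  strata are irreducible and their generic points are dense.  The fixed points of the conormal bundle
  lie between the generic points and the stratum with the same signatures.  An irreducible closed set inside a stage therefore lies in one
  \<open>Lambda\<close>, which is itself irreducible, closed and inside a stage.
\<close>

section \<open>Laurent series\<close>

text \<open>The obstacle is that vanishing of the moment map is quadratic in \<open>v\<close>: for a
  fixed lattice the possible \<open>v\<close> do not form a linear space. The hinge is the
  inequality \<open>l i + l j \<le> max 0 (m i + m j)\<close>, which holds whenever \<open>l\<close>
  and \<open>m - l\<close> are both antisymmetric and decreasing. For any \<open>v\<close> in the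
  lattice with exponents \<open>l\<close> it ensures that a quadratic term t a_i a_j outside
  \<open>tO 1\<close> is small enough to be cancelled by an entry of \<open>x\<close>. So for fixed
  signatures and a fixed frame the coordinates of \<open>v\<close> fill a linear space, and the
  possible \<open>x\<close> over each \<open>v\<close> form an affine space. Segments with one
  quadratic correction stay in the stratum, and curves replace dimension counts. A second obstacle
  is that the conormal bundle comes with a basis moved by GL(O), which need not be symplectic,
  whereas the strata use symplectic frames. The two are compared through elementary divisors and the
  difference form \<open>l i - l j \<le> max 0 (m i - m j)\<close> of the same inequality.\<close>

abbreviation tpow :: "int \<Rightarrow> complex fls" where
  "tpow k \<equiv> fls_X_intpow k"

lemma tpow_mult: "tpow a * tpow b = tpow (a + b)"
  by (simp add: fls_X_intpow_times_fls_X_intpow)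

lemma tpow_0: "tpow 0 = 1"
  by simp

lemma fls_X_tpow: "fls_X = tpow 1"
  by (simp add: fls_X_conv_shift_1)

lemma tpow_mult_nth: "fls_nth (tpow k * f) j = fls_nth f (j - k)"
  by (simp add: fls_X_intpow_times_conv_shift)

lemma zero_in_tO [simp]: "0 \<in> tO k"
  by (simp add: tO_def)

lemma one_in_tO [simp]: "1 \<in> tO 0"
  by (simp add: tO_def)

lemma one_notin_tO [simp]: "1 \<notin> tO 1"
  by (auto simp: tO_def intro!: exI[of _ 0])

lemma fls_const_in_tO [simp]: "fls_const c \<in> tO 0"
  by (simp add: tO_def)

lemma tO_uminus [simp]: "- f \<in> tO k \<longleftrightarrow> f \<in> tO k"
  by (simp add: tO_def)

lemma tO_diff: "f \<in> tO k \<Longrightarrow> h \<in> tO k \<Longrightarrow> f - h \<in> tO k"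
  by (simp add: tO_def)

lemma tO_mono: "f \<in> tO k \<Longrightarrow> j \<le> k \<Longrightarrow> f \<in> tO j"
  by (simp add: tO_def)

lemma tO_tpow_mult: "tpow k * f \<in> tO j \<longleftrightarrow> f \<in> tO (j - k)"
proof
  assume f: "tpow k * f \<in> tO j"
  have "fls_nth f i = 0" if "i < j - k" for i
  proof -
    have "fls_nth (tpow k * f) (i + k) = 0" using f that by (simp add: tO_def)
    then show ?thesis by (simp only: tpow_mult_nth) simp
  qed
  then show "f \<in> tO (j - k)" by (simp add: tO_def)
next
  assume "f \<in> tO (j - k)"
  then show "tpow k * f \<in> tO j" unfolding tO_def mem_Collect_eq tpow_mult_nth by simp
qed

lemma tO_X_mult: "fls_X * f \<in> tO j \<longleftrightarrow> f \<in> tO (j - 1)"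
  unfolding fls_X_tpow by (rule tO_tpow_mult)

lemma tpow_in_tO: "tpow k \<in> tO k"
  by (simp add: tO_def)

lemma tO_mult_add:
  assumes "f \<in> tO a" "h \<in> tO b"
  shows "f * h \<in> tO (a + b)"
proof -
  have "tpow (- a) * f \<in> tO 0" "tpow (- b) * h \<in> tO 0"
    using assms by (simp_all only: tO_tpow_mult) simp_all
  then have "(tpow (- a) * f) * (tpow (- b) * h) \<in> tO 0"
    by (rule tO_mult)
  also have "(tpow (- a) * f) * (tpow (- b) * h) = tpow (- a - b) * (f * h)"
    using tpow_mult[of "- a" "- b"] by (simp add: mult_ac)
  finally show ?thesis by (simp only: tO_tpow_mult) (simp add: algebra_simps)
qed

lemma tO_mult0: "c \<in> tO 0 \<Longrightarrow> f \<in> tO k \<Longrightarrow> c * f \<in> tO k"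
  using tO_mult_add[of c 0 f k] by simp

lemma tO_0_Suc: "f \<in> tO k \<Longrightarrow> fls_nth f k = 0 \<Longrightarrow> f \<in> tO (k + 1)"
  by (force simp: tO_def zless_add1_eq)

lemma inverse_in_tO:
  assumes "f \<in> tO a" "fls_nth f a \<noteq> 0"
  shows "inverse f \<in> tO (- a)" "f \<noteq> 0"
proof -
  show "f \<noteq> 0" using assms(2) by auto
  have sub: "fls_subdegree f = a"
    using assms by (intro fls_subdegree_eqI) (auto simp: tO_def)
  have "fls_subdegree (inverse f) = - a"
    by (simp add: sub)
  then show "inverse f \<in> tO (- a)" by (simp add: tO_def)
qed

text \<open>Subdegrees add, so the leading term of the square sits at twice the subdegree of
  \<open>f\<close>.\<close>

lemma square_in_tO:
  assumes "f * f \<in> tO (2 * a)"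
  shows "f \<in> tO a"
proof (cases "f = 0")
  case False
  then have "fls_nth (f * f) (fls_subdegree f + fls_subdegree f) \<noteq> 0"
    by (simp only: fls_times_base) simp
  then have "a \<le> fls_subdegree f"
    using assms by (force simp: tO_def)
  then show ?thesis by (simp add: tO_def)
qed simp

lemma ex_tO: "\<exists>k. f \<in> tO k"
  by (auto simp: tO_def intro!: exI[of _ "fls_subdegree f"])

lemma tO_all_zero: "(\<And>k. f \<in> tO k) \<Longrightarrow> f = 0"
  by (rule fls_zero_eqI) (auto simp: tO_def intro: zless_add1_eq[THEN iffD2])

section \<open>The symplectic space\<close>

definition tV :: "int \<Rightarrow> ('m::finite) Fvec set" where
  "tV k = {v. \<forall>i. v $ i \<in> tO k}"

lemma V_O_tV: "V_O = tV 0"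
  by (simp add: V_O_def tV_def)

lemma tV_add: "u \<in> tV k \<Longrightarrow> v \<in> tV k \<Longrightarrow> u + v \<in> tV k"
  by (simp add: tV_def tO_add)

lemma tV_diff: "u \<in> tV k \<Longrightarrow> v \<in> tV k \<Longrightarrow> u - v \<in> tV k"
  by (simp add: tV_def tO_diff)

lemma tV_sum: "(\<And>i. i \<in> S \<Longrightarrow> f i \<in> tV k) \<Longrightarrow> sum f S \<in> tV k"
  by (auto simp: tV_def intro!: tO_sum)

lemma tV_scale: "c \<in> tO a \<Longrightarrow> v \<in> tV b \<Longrightarrow> c *s v \<in> tV (a + b)"
  by (auto simp: tV_def intro!: tO_mult_add)

lemma tV_scale0: "c \<in> tO 0 \<Longrightarrow> v \<in> tV b \<Longrightarrow> c *s v \<in> tV b"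
  using tV_scale[of c 0 v b] by simp

lemma tV_tpow: "tpow k *s v \<in> tV j \<longleftrightarrow> v \<in> tV (j - k)"
  by (simp only: tV_def mem_Collect_eq vector_smult_component tO_tpow_mult)

lemma tV_mono: "u \<in> tV k \<Longrightarrow> j \<le> k \<Longrightarrow> u \<in> tV j"
  by (auto simp: tV_def intro: tO_mono)

text \<open>The entries are polynomial in those of \<open>u\<close> and \<open>w\<close>. Operators
  attached to a frame are built from this below, so they vary polynomially with the frame.\<close>

definition rank_one :: "complex ^ 'm ^ 'm \<Rightarrow> 'm Fvec \<Rightarrow> 'm Fvec \<Rightarrow> ('m::finite) Fmat" where
  "rank_one J u w = (\<chi> p q. w $ p * (\<Sum>r\<in>UNIV. u $ r * gram_F J $ r $ q))"

lemma gram_F_in_tO: "gram_F J $ i $ j \<in> tO 0"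
  by (simp add: gram_F_def)

lemma rank_one_apply: "rank_one J u w *v z = form_F J u z *s w"
proof -
  have "(\<Sum>q\<in>UNIV. (\<Sum>r\<in>UNIV. u $ r * gram_F J $ r $ q) * z $ q) = form_F J u z"
    unfolding form_F_def matrix_vector_mult_def
    by (simp add: sum_distrib_left sum_distrib_right mult_ac) (rule sum.swap)
  moreover have "(rank_one J u w *v z) $ p
      = w $ p * (\<Sum>q\<in>UNIV. (\<Sum>r\<in>UNIV. u $ r * gram_F J $ r $ q) * z $ q)" for p
    unfolding sum_distrib_left[of "w $ p"]
    by (simp only: rank_one_def matrix_vector_mult_def vec_lambda_beta mult.assoc)
  ultimately show ?thesis
    by (simp add: vec_eq_iff mult.commute)
qed

lemma matrix_eqI: "(\<And>z. A *v z = B *v z) \<Longrightarrow> A = (B :: ('m::finite) Fmat)"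
  by (simp add: matrix_eq)

lemma scal_apply: "scal c X *v z = c *s (X *v z)"
  by (simp add: scal_def vec_eq_iff matrix_vector_mult_def sum_distrib_left mult_ac)

lemma scal_nth [simp]: "scal c X $ i $ j = c * X $ i $ j"
  by (simp add: scal_def)

lemma matrix_sum_apply: "(\<Sum>i\<in>S. A i) *v z = (\<Sum>i\<in>S. A i *v z)"
  for A :: "'i \<Rightarrow> ('m::finite) Fmat"
  by (induction S rule: infinite_finite_induct) (simp_all add: matrix_vector_mult_add_rdistrib)

lemma matrix_apply_sum: "A *v (\<Sum>i\<in>S. z i) = (\<Sum>i\<in>S. A *v z i)"
  for A :: "('m::finite) Fmat"
  by (induction S rule: infinite_finite_induct) (simp_all add: matrix_vector_right_distrib)

lemma matrix_apply_scale: "A *v (c *s z) = c *s (A *v z)" for A :: "('m::finite) Fmat"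
  by (simp add: vec_eq_iff matrix_vector_mult_def sum_distrib_left mult_ac)

lemma matrix_uminus_apply: "(- A) *v z = - (A *v z)" for A :: "('m::finite) Fmat"
  by (simp add: vec_eq_iff matrix_vector_mult_def sum_negf)

lemma gl_O_apply_tV: "X \<in> gl_O \<Longrightarrow> u \<in> tV k \<Longrightarrow> X *v u \<in> tV k"
  by (auto simp: gl_O_def tV_def matrix_vector_mult_def intro!: tO_sum tO_mult0)

lemma gl_O_mult: "X \<in> gl_O \<Longrightarrow> Y \<in> gl_O \<Longrightarrow> X ** Y \<in> gl_O"
  by (auto simp: gl_O_def matrix_matrix_mult_def intro!: tO_sum tO_mult)

lemma axis_in_V_O: "axis j 1 \<in> tV 0"
  by (simp add: tV_def axis_def)

lemma gl_O_iff_V_O: "X \<in> gl_O \<longleftrightarrow> (\<forall>u\<in>V_O. X *v u \<in> V_O)"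
proof
  assume *: "\<forall>u\<in>V_O. X *v u \<in> V_O"
  have "X $ i $ j \<in> tO 0" for i j
  proof -
    have "X *v axis j 1 \<in> V_O" using * axis_in_V_O by (auto simp: V_O_tV)
    moreover have "(X *v axis j 1) $ i = X $ i $ j"
      by (simp add: matrix_vector_mult_def axis_def if_distrib cong: if_cong)
    ultimately show ?thesis by (auto simp: V_O_def dest: spec[of _ i])
  qed
  then show "X \<in> gl_O" by (simp add: gl_O_def)
qed (auto simp: V_O_mult)

locale symplectic_space =
  fixes J :: "complex ^ 'm ^ ('m::finite)" and n :: nat
  assumes card_UNIV: "CARD('m) = 2 * n"
    and J: "symplectic_gram J"
begin

abbreviation symplectic_form :: "'m Fvec \<Rightarrow> 'm Fvec \<Rightarrow> complex fls"  (\<open>\<langle>_,/ _\<rangle>\<close>) where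
  "\<langle>u, v\<rangle> \<equiv> form_F J u v"

lemma form_add_left: "\<langle>u + v, w\<rangle> = \<langle>u, w\<rangle> + \<langle>v, w\<rangle>"
  by (simp add: form_F_def distrib_right sum.distrib)

lemma form_scale_left: "\<langle>c *s u, w\<rangle> = c * \<langle>u, w\<rangle>"
  by (simp add: form_F_def sum_distrib_left mult_ac)

lemma form_zero_left [simp]: "\<langle>0, w\<rangle> = 0"
  by (simp add: form_F_def)

lemma form_uminus_left: "\<langle>- u, w\<rangle> = - \<langle>u, w\<rangle>"
  by (simp add: form_F_def sum_negf)

lemma form_uminus_right: "\<langle>u, - w\<rangle> = - \<langle>u, w\<rangle>"
  using form_F_scale[of J u "- 1" w] by simp

lemma form_diff_left: "\<langle>u - v, w\<rangle> = \<langle>u, w\<rangle> - \<langle>v, w\<rangle>"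
  using form_add_left[of u "- v" w] by (simp add: form_uminus_left)

lemma form_diff_right: "\<langle>u, v - w\<rangle> = \<langle>u, v\<rangle> - \<langle>u, w\<rangle>"
  using form_F_add[of J u v "- w"] by (simp add: form_uminus_right)

lemma form_sum_left: "\<langle>\<Sum>i\<in>S. f i, w\<rangle> = (\<Sum>i\<in>S. \<langle>f i, w\<rangle>)"
  by (induction S rule: infinite_finite_induct) (simp_all add: form_add_left)

lemma form_sum_right: "\<langle>u, \<Sum>i\<in>S. f i\<rangle> = (\<Sum>i\<in>S. \<langle>u, f i\<rangle>)"
  by (induction S rule: infinite_finite_induct) (simp_all add: form_F_add)

lemma gram_skew: "gram_F J $ i $ j = - gram_F J $ j $ i"
proof -
  have "transpose J $ j $ i = (- J) $ j $ i"
    using J by (simp add: symplectic_gram_def)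
  then show ?thesis
    by (simp add: gram_F_def transpose_def)
qed

lemma form_skew: "\<langle>u, v\<rangle> = - \<langle>v, u\<rangle>"
proof -
  have "\<langle>u, v\<rangle> = (\<Sum>i\<in>UNIV. \<Sum>j\<in>UNIV. u $ i * (gram_F J $ i $ j * v $ j))"
    by (simp add: form_F_def matrix_vector_mult_def sum_distrib_left)
  also have "\<dots> = (\<Sum>i\<in>UNIV. \<Sum>j\<in>UNIV. - (v $ j * (gram_F J $ j $ i * u $ i)))"
  proof (intro sum.cong refl)
    fix i j
    show "u $ i * (gram_F J $ i $ j * v $ j) = - (v $ j * (gram_F J $ j $ i * u $ i))"
      unfolding gram_skew[of i j] by simp
  qed
  also have "\<dots> = (\<Sum>j\<in>UNIV. \<Sum>i\<in>UNIV. - (v $ j * (gram_F J $ j $ i * u $ i)))"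
    by (rule sum.swap)
  finally show ?thesis
    by (simp add: form_F_def matrix_vector_mult_def sum_distrib_left sum_negf)
qed

lemma form_self [simp]: "\<langle>u, u\<rangle> = 0"
  using form_skew[of u u] by (metis add_eq_0_iff mult_2 mult_eq_0_iff zero_neq_numeral)

lemma form_in_tO: "u \<in> tV a \<Longrightarrow> v \<in> tV b \<Longrightarrow> \<langle>u, v\<rangle> \<in> tO (a + b)"
  by (auto simp: form_F_def matrix_vector_mult_def tV_def
      intro!: tO_sum tO_mult_add tO_mult0[OF gram_F_in_tO])

lemma form_in_tO0: "u \<in> tV 0 \<Longrightarrow> v \<in> tV 0 \<Longrightarrow> \<langle>u, v\<rangle> \<in> tO 0"
  using form_in_tO[of u 0 v 0] by simp

text \<open>For \<open>k = 0\<close> this is the self-duality of \<open>V_O\<close>; scaling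
  \<open>u\<close> by \<open>tpow (- k)\<close> gives the rest.\<close>

lemma tV_iff_form: "u \<in> tV k \<longleftrightarrow> (\<forall>v\<in>tV 0. \<langle>u, v\<rangle> \<in> tO k)"
proof
  assume *: "\<forall>v\<in>tV 0. \<langle>u, v\<rangle> \<in> tO k"
  have "\<langle>tpow (- k) *s u, v\<rangle> \<in> tO 0" if "v \<in> V_O" for v
    using * that by (simp add: form_scale_left V_O_tV del: fls_shift_subdegree minus_minus)
      (simp only: tO_tpow_mult, simp)
  then have "tpow (- k) *s u \<in> dual_lattice J V_O"
    by (simp add: dual_lattice_def)
  then have "tpow (- k) *s u \<in> tV 0"
    unfolding dual_V_O[OF J] by (simp only: V_O_tV)
  then show "u \<in> tV k"
    by (simp only: tV_tpow) simp
next
  assume "u \<in> tV k"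
  then show "\<forall>v\<in>tV 0. \<langle>u, v\<rangle> \<in> tO k"
    using form_in_tO[of u k _ 0] by simp
qed

text \<open>A vector orthogonal to everything lies in every \<open>tV k\<close>, and these intersect
  in zero.\<close>

lemma form_nondegenerate:
  assumes "\<And>v. \<langle>u, v\<rangle> = 0"
  shows "u = 0"
proof -
  have "u \<in> tV k" for k using assms by (subst tV_iff_form) simp
  then have "u $ i \<in> tO k" for i k by (simp add: tV_def)
  then show ?thesis using tO_all_zero by (simp add: vec_eq_iff)
qed

text \<open>A primitive vector pairs with some integral vector to a unit of O, since otherwise
  self-duality would put it into \<open>tV 1\<close>. Dividing by the unit normalizes the value to
  1.\<close>

lemma ex_hyperbolic_partner:
  assumes "u \<in> tV 0" "u \<notin> tV 1"
  shows "\<exists>v\<in>tV 0. \<langle>u, v\<rangle> = 1"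
proof -
  obtain w where w: "w \<in> tV 0" "\<langle>u, w\<rangle> \<notin> tO 1"
    using assms(2) tV_iff_form[of u 1] by blast
  have 0: "\<langle>u, w\<rangle> \<in> tO 0" using assms(1) w(1) by (rule form_in_tO0)
  then have nz: "fls_nth \<langle>u, w\<rangle> 0 \<noteq> 0" using w(2) tO_0_Suc[of _ 0] by auto
  have "inverse \<langle>u, w\<rangle> \<in> tO 0" "\<langle>u, w\<rangle> \<noteq> 0"
    using inverse_in_tO[OF 0 nz] by simp_all
  then show ?thesis
    using w(1) by (intro bexI[of _ "inverse \<langle>u, w\<rangle> *s w"]) (simp_all add: form_F_scale tV_scale0)
qed

lemma Sp_F_form: "g \<in> Sp_F J \<Longrightarrow> \<langle>g *v u, g *v v\<rangle> = \<langle>u, v\<rangle>"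
  by (simp add: Sp_F_def)

lemma Sp_F_adjoint:
  assumes "g \<in> Sp_F J"
  shows "adjoint_F J g ** g = mat 1" "g ** adjoint_F J g = mat 1" "invertible g"
    "matrix_inv g = adjoint_F J g"
proof -
  show 1: "adjoint_F J g ** g = mat 1"
  proof (rule matrix_eqI)
    fix z
    have "\<langle>u, (adjoint_F J g ** g) *v z\<rangle> = \<langle>u, z\<rangle>" for u
      using form_F_adjoint[OF J, of g u "g *v z"] Sp_F_form[OF assms, of u z]
      by (simp add: matrix_vector_mul_assoc)
    then have "\<langle>(adjoint_F J g ** g) *v z - z, u\<rangle> = 0" for u
      by (metis diff_self form_diff_left form_skew)
    then show "(adjoint_F J g ** g) *v z = mat 1 *v z"
      using form_nondegenerate by (metis eq_iff_diff_eq_0 matrix_vector_mul_lid)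
  qed
  then show 2: "g ** adjoint_F J g = mat 1"
    by (simp add: matrix_left_right_inverse)
  show inv: "invertible g"
    using 1 2 by (auto simp: invertible_def)
  show "matrix_inv g = adjoint_F J g"
    using matrix_inv_cancel[OF inv] 1 by (metis matrix_mul_assoc matrix_mul_lid matrix_mul_rid)
qed

lemma Sp_F_mult: "g \<in> Sp_F J \<Longrightarrow> h \<in> Sp_F J \<Longrightarrow> g ** h \<in> Sp_F J"
  by (simp add: Sp_F_def matrix_vector_mul_assoc[symmetric])

lemma Sp_F_inv:
  assumes "g \<in> Sp_F J"
  shows "matrix_inv g \<in> Sp_F J" "g ** matrix_inv g = mat 1" "matrix_inv g ** g = mat 1"
proof -
  show *: "g ** matrix_inv g = mat 1" "matrix_inv g ** g = mat 1"
    using matrix_inv_cancel Sp_F_adjoint(3)[OF assms] by auto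
  have "\<langle>matrix_inv g *v u, matrix_inv g *v v\<rangle> = \<langle>u, v\<rangle>" for u v
    using Sp_F_form[OF assms, of "matrix_inv g *v u" "matrix_inv g *v v"]
    by (simp add: matrix_vector_mul_assoc *)
  then show "matrix_inv g \<in> Sp_F J" by (simp add: Sp_F_def)
qed

section \<open>Hyperbolic pairs and the relative position of two self-dual lattices\<close>

definition hyperbolic :: "nat \<Rightarrow> (nat \<Rightarrow> 'm Fvec) \<Rightarrow> (nat \<Rightarrow> 'm Fvec) \<Rightarrow> bool" where
  "hyperbolic r e f \<longleftrightarrow> (\<forall>i<r. e i \<in> tV 0 \<and> f i \<in> tV 0) \<and>
     (\<forall>i<r. \<forall>j<r. \<langle>e i, e j\<rangle> = 0 \<and> \<langle>f i, f j\<rangle> = 0 \<and> \<langle>e i, f j\<rangle> = (if i = j then 1 else 0))"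

definition perp :: "nat \<Rightarrow> (nat \<Rightarrow> 'm Fvec) \<Rightarrow> (nat \<Rightarrow> 'm Fvec) \<Rightarrow> 'm Fvec set" where
  "perp r e f = {u. \<forall>i<r. \<langle>e i, u\<rangle> = 0 \<and> \<langle>f i, u\<rangle> = 0}"

text \<open>For a hyperbolic system this is the orthogonal projection onto
  \<open>perp r e f\<close>. The pairs are normalized, so no division occurs and integrality is
  preserved.\<close>

definition perp_proj :: "nat \<Rightarrow> (nat \<Rightarrow> 'm Fvec) \<Rightarrow> (nat \<Rightarrow> 'm Fvec) \<Rightarrow> 'm Fvec \<Rightarrow> 'm Fvec" where
  "perp_proj r e f u = u - (\<Sum>i<r. \<langle>u, f i\<rangle> *s e i + \<langle>e i, u\<rangle> *s f i)"

lemma perpD: "u \<in> perp r e f \<Longrightarrow> i < r \<Longrightarrow> \<langle>e i, u\<rangle> = 0 \<and> \<langle>f i, u\<rangle> = 0 \<and> \<langle>u, e i\<rangle> = 0 \<and> \<langle>u, f i\<rangle> = 0"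
  using form_skew[of u "e i"] form_skew[of u "f i"] by (simp add: perp_def)

lemma perp_proj_in_perp:
  assumes "hyperbolic r e f"
  shows "perp_proj r e f u \<in> perp r e f"
proof -
  have "\<langle>e j, perp_proj r e f u\<rangle> = 0 \<and> \<langle>f j, perp_proj r e f u\<rangle> = 0" if j: "j < r" for j
  proof
    have fe: "\<langle>f j, e i\<rangle> = - (if i = j then 1 else 0)" if "i < r" for i
      using form_skew[of "f j" "e i"] assms j that by (simp add: hyperbolic_def)
    have "\<langle>e j, perp_proj r e f u\<rangle> = \<langle>e j, u\<rangle> - (\<Sum>i<r. if i = j then \<langle>e i, u\<rangle> else 0)"
    proof -
      have "(\<Sum>i<r. \<langle>e j, \<langle>u, f i\<rangle> *s e i + \<langle>e i, u\<rangle> *s f i\<rangle>) = (\<Sum>i<r. if i = j then \<langle>e i, u\<rangle> else 0)"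
        using assms j by (intro sum.cong) (auto simp: form_F_add form_F_scale hyperbolic_def)
      then show ?thesis by (simp add: perp_proj_def form_diff_right form_sum_right)
    qed
    then show "\<langle>e j, perp_proj r e f u\<rangle> = 0" using j by simp
    have "\<langle>f j, perp_proj r e f u\<rangle> = \<langle>f j, u\<rangle> - (\<Sum>i<r. - (if i = j then \<langle>u, f i\<rangle> else 0))"
    proof -
      have "(\<Sum>i<r. \<langle>f j, \<langle>u, f i\<rangle> *s e i + \<langle>e i, u\<rangle> *s f i\<rangle>) = (\<Sum>i<r. - (if i = j then \<langle>u, f i\<rangle> else 0))"
        using assms j fe by (intro sum.cong) (auto simp: form_F_add form_F_scale hyperbolic_def)
      then show ?thesis by (simp add: perp_proj_def form_diff_right form_sum_right)
    qed
    then show "\<langle>f j, perp_proj r e f u\<rangle> = 0"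
      using j form_skew[of u "f j"] by (simp add: sum_negf)
  qed
  then show ?thesis by (simp add: perp_def)
qed

lemma form_perp_proj: "w \<in> perp r e f \<Longrightarrow> \<langle>w, perp_proj r e f u\<rangle> = \<langle>w, u\<rangle>"
  by (simp add: perp_proj_def form_diff_right form_sum_right form_F_add form_F_scale perpD)

lemma perp_proj_in_tV:
  assumes "hyperbolic r e f" "u \<in> tV 0"
  shows "perp_proj r e f u \<in> tV 0"
  using assms by (auto simp: perp_proj_def hyperbolic_def
      intro!: tV_diff tV_sum tV_add tV_scale0 form_in_tO0)

lemma hyperbolic_extend:
  assumes "hyperbolic r e f" "u \<in> tV 0" "w \<in> tV 0" "u \<in> perp r e f" "w \<in> perp r e f" "\<langle>u, w\<rangle> = 1"
  shows "hyperbolic (Suc r) (e(r := u)) (f(r := w))"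
  using assms(1-3,6) perpD[OF assms(4)] perpD[OF assms(5)]
  by (simp add: hyperbolic_def less_Suc_eq_le le_less)

text \<open>If the complement vanished, every vector would be a combination of the
  \<open>2 * r\<close> vectors of the pairs, fewer than the dimension.\<close>

lemma ex_nonzero_perp:
  assumes "hyperbolic r e f" "r < n"
  shows "\<exists>u\<in>perp r e f. u \<noteq> 0"
proof (rule ccontr)
  assume *: "\<not> ?thesis"
  let ?B = "e ` {..<r} \<union> f ` {..<r}"
  have "u \<in> vec.span ?B" for u
  proof -
    have "perp_proj r e f u = 0"
      using * perp_proj_in_perp[OF assms(1)] by blast
    then have "u = (\<Sum>i<r. \<langle>u, f i\<rangle> *s e i + \<langle>e i, u\<rangle> *s f i)"
      by (simp add: perp_proj_def)
    also have "\<dots> \<in> vec.span ?B"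
      by (intro vec.span_sum vec.span_add vec.span_scale vec.span_base) auto
    finally show ?thesis .
  qed
  then have "vec.dim (UNIV :: 'm Fvec set) \<le> card ?B"
    by (intro vec.dim_le_card) auto
  moreover have "card ?B \<le> r + r"
    by (rule order.trans[OF card_Un_le]) (intro add_mono; metis card_image_le card_lessThan finite_lessThan)
  moreover have "vec.dim (UNIV :: 'm Fvec set) = 2 * n"
    unfolding vec_dim_card by (rule card_UNIV)
  ultimately show False
    using assms(2) by linarith
qed

section \<open>Self-dual lattices and hyperbolic pairs adapted to them\<close>

definition self_dual :: "'m Fvec set \<Rightarrow> bool" where
  "self_dual L \<longleftrightarrow> dual_lattice J L = L"

lemma self_dual_mem_iff: "self_dual L \<Longrightarrow> u \<in> L \<longleftrightarrow> (\<forall>w\<in>L. \<langle>u, w\<rangle> \<in> tO 0)"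
  by (auto simp: self_dual_def dual_lattice_def)

lemma self_dual_form: "self_dual L \<Longrightarrow> u \<in> L \<Longrightarrow> w \<in> L \<Longrightarrow> \<langle>u, w\<rangle> \<in> tO 0"
  using self_dual_mem_iff by blast

lemma self_dual_add: "self_dual L \<Longrightarrow> u \<in> L \<Longrightarrow> w \<in> L \<Longrightarrow> u + w \<in> L"
  by (simp add: self_dual_mem_iff[of L "u + w"] form_add_left tO_add self_dual_form)

lemma self_dual_scale: "self_dual L \<Longrightarrow> c \<in> tO 0 \<Longrightarrow> u \<in> L \<Longrightarrow> c *s u \<in> L"
  by (simp add: self_dual_mem_iff[of L "c *s u"] form_scale_left tO_mult self_dual_form)

lemma self_dual_0: "self_dual L \<Longrightarrow> 0 \<in> L"
  by (simp add: self_dual_mem_iff[of L 0])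

lemma self_dual_sum: "self_dual L \<Longrightarrow> (\<And>i. i \<in> S \<Longrightarrow> u i \<in> L) \<Longrightarrow> sum u S \<in> L"
  by (induction S rule: infinite_finite_induct) (simp_all add: self_dual_0 self_dual_add)

lemma self_dual_uminus: "self_dual L \<Longrightarrow> u \<in> L \<Longrightarrow> - u \<in> L"
  using self_dual_scale[of L "- 1" u] by simp

text \<open>Rescaling by opposite powers of \<open>t\<close> keeps the pairing of \<open>e i\<close>
  with \<open>f i\<close>; the exponents \<open>\<mu>\<close> record how \<open>L\<close> lies
  relative to \<open>V_O\<close>.\<close>

definition adapted ::
    "nat \<Rightarrow> (nat \<Rightarrow> 'm Fvec) \<Rightarrow> (nat \<Rightarrow> 'm Fvec) \<Rightarrow> (nat \<Rightarrow> int) \<Rightarrow> 'm Fvec set \<Rightarrow> bool" where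
  "adapted r e f \<mu> L \<longleftrightarrow> (\<forall>i<r. tpow (- \<mu> i) *s e i \<in> L \<and> tpow (\<mu> i) *s f i \<in> L)"

lemma tpow_cancel: "(c * tpow k) * tpow (- k) = c" "(c * tpow (- k)) * tpow k = c"
  using tpow_mult[of k "- k"] tpow_mult[of "- k" k] by (simp_all add: mult.assoc)

text \<open>The sum in the projection is rewritten for the rescaled pairs, which lie in
  \<open>L\<close>. The opposite powers of \<open>t\<close> cancel, and self-duality makes the new
  coefficients integral.\<close>

lemma perp_proj_in_lattice:
  assumes "self_dual L" "adapted r e f \<mu> L" "u \<in> L"
  shows "perp_proj r e f u \<in> L"
proof -
  have "\<langle>u, f i\<rangle> *s e i + \<langle>e i, u\<rangle> *s f i \<in> L" if "i < r" for i
  proof -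
    have i: "tpow (- \<mu> i) *s e i \<in> L" "tpow (\<mu> i) *s f i \<in> L"
      using assms(2) that by (auto simp: adapted_def)
    have "\<langle>u, f i\<rangle> *s e i = \<langle>u, tpow (\<mu> i) *s f i\<rangle> *s (tpow (- \<mu> i) *s e i)"
      using tpow_cancel[of "\<langle>u, f i\<rangle>" "\<mu> i"]
      by (simp only: form_F_scale vector_smult_assoc mult.commute mult.left_commute)
    moreover have "\<langle>e i, u\<rangle> *s f i = \<langle>tpow (- \<mu> i) *s e i, u\<rangle> *s (tpow (\<mu> i) *s f i)"
      using tpow_cancel[of "\<langle>e i, u\<rangle>" "\<mu> i"]
      by (simp only: form_scale_left vector_smult_assoc mult.commute mult.left_commute)
    ultimately show ?thesis
      using i assms(1,3) self_dual_add self_dual_scale self_dual_form by metis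
  qed
  then have "- (\<Sum>i<r. \<langle>u, f i\<rangle> *s e i + \<langle>e i, u\<rangle> *s f i) \<in> L"
    using assms(1) by (intro self_dual_uminus self_dual_sum) auto
  then show ?thesis
    using self_dual_add[OF assms(1,3)] by (fastforce simp: perp_proj_def)
qed

lemma int_greatest:
  assumes "P (k0::int)" "\<not> P k1" "k0 \<le> k1"
  shows "\<exists>k. P k \<and> \<not> P (k + 1)"
proof (rule ccontr)
  assume "\<not> ?thesis"
  then have step: "P k \<Longrightarrow> P (k + 1)" for k by blast
  have "P k1" using assms(3) by (induction k1 rule: int_ge_induct) (simp_all add: assms(1) step)
  then show False using assms(2) by simp
qed

text \<open>
  A vector of \<open>L\<close> with the worst pole is \<open>t\<^sup>-\<^sup>k u\<close> with \<open>u\<close> primitive in \<open>V_O\<close>; then \<open>t\<^sup>k\<close> times any vector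
  of \<open>V_O\<close> pairs integrally with \<open>L\<close>, so every partner of \<open>u\<close> in \<open>V_O\<close> will do.
\<close>

lemma ex_adapted_pair:
  assumes L: "self_dual L" "L \<subseteq> tV (- K)" and h: "hyperbolic r e f" "adapted r e f \<mu> L" "r < n"
  shows "\<exists>u w k. 0 \<le> k \<and> u \<in> tV 0 \<and> w \<in> tV 0 \<and> u \<in> perp r e f \<and> w \<in> perp r e f \<and> \<langle>u, w\<rangle> = 1 \<and>
     tpow (- k) *s u \<in> L \<and> tpow k *s w \<in> L \<and> (\<forall>z\<in>L \<inter> perp r e f. tpow k *s z \<in> tV 0)"
proof -
  let ?W = "perp r e f"
  have perp_scale: "c *s u \<in> ?W" if "u \<in> ?W" for c u
    using that by (simp add: perp_def form_F_scale)
  obtain u0 where u0: "u0 \<in> ?W" "u0 \<noteq> 0" using ex_nonzero_perp[OF h(1,3)] by blast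
  have "\<exists>a. u0 \<in> tV a"
  proof -
    define a where "a = Min (range (\<lambda>i. fls_subdegree (u0 $ i)))"
    have "u0 $ i \<in> tO a" for i
      using Min_le[of "range (\<lambda>i. fls_subdegree (u0 $ i))" "fls_subdegree (u0 $ i)"]
      by (auto simp: tO_def a_def)
    then show ?thesis by (auto simp: tV_def)
  qed
  then obtain a where a: "u0 \<in> tV a" by blast
  \<comment> \<open>Dualizing \<open>L \<subseteq> tV (- K)\<close> gives this opposite inclusion; a
    nonzero vector of the complement therefore enters \<open>L\<close> after multiplication by a
    power of \<open>t\<close>.\<close>
  have big: "tV K \<subseteq> L"
  proof
    fix z :: "'m Fvec" assume "z \<in> tV K"
    then have "\<langle>z, w\<rangle> \<in> tO 0" if "w \<in> L" for w
      using form_in_tO[of z K w "- K"] L(2) that by auto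
    then show "z \<in> L" using self_dual_mem_iff[OF L(1)] by blast
  qed
  define u1 where "u1 = tpow (K - a) *s u0"
  have u1: "u1 \<in> L \<inter> ?W" "u1 \<noteq> 0"
  proof -
    have "u1 \<in> tV K" using a by (simp only: u1_def tV_tpow) simp
    then show "u1 \<in> L \<inter> ?W" using big u0(1) by (auto simp: u1_def perp_scale)
    show "u1 \<noteq> 0" using u0(2) by (auto simp: u1_def vec_eq_iff fls_shift_eq0_iff)
  qed
  define P where "P = (\<lambda>k. L \<inter> ?W \<subseteq> tV k)"
  have "P (- K)" using L(2) by (auto simp: P_def)
  moreover have "\<exists>k1. \<not> P k1 \<and> - K \<le> k1"
  proof -
    obtain i where i: "u1 $ i \<noteq> 0" using u1(2) by (auto simp: vec_eq_iff)
    obtain k where k: "u1 $ i \<notin> tO k" using tO_all_zero i by blast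
    then have "u1 $ i \<notin> tO (max k (- K))" using tO_mono[of _ "max k (- K)" k] by auto
    then have "\<not> P (max k (- K))" using u1(1) by (auto simp: P_def tV_def)
    then show ?thesis by (intro exI[of _ "max k (- K)"]) simp
  qed
  \<comment> \<open>\<open>k'\<close> is the largest exponent with
    \<open>L \<inter> perp r e f \<subseteq> tV k'\<close>. A vector of
    \<open>L \<inter> perp r e f\<close> outside \<open>tV (k' + 1)\<close> becomes primitive when
    divided by \<open>tpow k'\<close>.\<close>
  ultimately obtain k' where k': "P k'" "\<not> P (k' + 1)" using int_greatest[of P "- K"] by blast
  define k where "k = - k'"
  have Pk: "\<forall>z\<in>L \<inter> ?W. tpow k *s z \<in> tV 0"
    using k'(1) by (auto simp: P_def k_def tV_tpow simp del: fls_shift_subdegree minus_minus)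
  obtain v where v: "v \<in> L" "v \<in> ?W" "v \<notin> tV (k' + 1)" using k'(2) by (auto simp: P_def)
  define u where "u = tpow k *s v"
  have u: "u \<in> tV 0" "u \<in> ?W" "u \<notin> tV 1"
    using v Pk by (auto simp: u_def perp_scale) (simp only: tV_tpow k_def, simp add: add.commute)
  obtain w0 where w0: "w0 \<in> tV 0" "\<langle>u, w0\<rangle> = 1" using ex_hyperbolic_partner u by blast
  define w where "w = perp_proj r e f w0"
  have w: "w \<in> tV 0" "w \<in> ?W" "\<langle>u, w\<rangle> = 1"
    using w0 h(1) u(2) by (auto simp: w_def perp_proj_in_tV perp_proj_in_perp form_perp_proj)
  have ku: "tpow (- k) *s u = v"
    using tpow_mult[of "- k" k] by (simp only: u_def vector_smult_assoc) simp
  have kw: "tpow k *s w \<in> L"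
    unfolding self_dual_mem_iff[OF L(1)]
  proof
    fix z assume z: "z \<in> L"
    have "\<langle>tpow k *s w, z\<rangle> = \<langle>w, tpow k *s perp_proj r e f z\<rangle>"
      by (simp only: form_scale_left form_F_scale form_perp_proj[OF w(2)])
    moreover have "tpow k *s perp_proj r e f z \<in> tV 0"
      using Pk perp_proj_in_lattice[OF L(1) h(2) z] perp_proj_in_perp[OF h(1)] by blast
    ultimately show "\<langle>tpow k *s w, z\<rangle> \<in> tO 0"
      using w(1) form_in_tO0 by simp
  qed
  have w1: "w \<notin> tV 1"
  proof
    assume "w \<in> tV 1"
    then have "\<langle>u, w\<rangle> \<in> tO 1" using form_in_tO[OF u(1), of w 1] by simp
    then show False using w(3) by simp
  qed
  \<comment> \<open>The pole bound also applies to \<open>tpow k *s w\<close>, which lies in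
    \<open>L\<close>: a negative \<open>k\<close> would make \<open>w\<close> divisible by
    \<open>t\<close>, against \<open>\<langle>u, w\<rangle> = 1\<close>.\<close>
  have "0 \<le> k"
  proof (rule ccontr)
    assume "\<not> 0 \<le> k"
    have "tpow k *s (tpow k *s w) \<in> tV 0" using Pk kw w(2) perp_scale by blast
    then have "w \<in> tV (0 - k - k)" by (simp only: tV_tpow)
    then have "w \<in> tV 1" by (rule tV_mono) (use \<open>\<not> 0 \<le> k\<close> in simp)
    then show False using w1 by simp
  qed
  then show ?thesis using u w kw ku v(1) Pk by (intro exI[of _ u] exI[of _ w] exI[of _ k]) simp
qed

text \<open>The last conjunct carries the induction: vectors of \<open>L\<close> orthogonal to the
  pairs found so far have poles of order at most each exponent found so far. The next exponent is
  such a pole order, hence not larger.\<close>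

lemma ex_adapted_pairs:
  assumes L: "self_dual L" "L \<subseteq> tV (- K)"
  shows "r \<le> n \<Longrightarrow> \<exists>e f \<mu>. hyperbolic r e f \<and> adapted r e f \<mu> L \<and> (\<forall>i<r. 0 \<le> \<mu> i) \<and>
    (\<forall>j<r. \<forall>i\<le>j. \<mu> j \<le> \<mu> i) \<and> (\<forall>i<r. \<forall>z\<in>L \<inter> perp r e f. tpow (\<mu> i) *s z \<in> tV 0)"
proof (induction r)
  case 0
  show ?case by (simp add: hyperbolic_def adapted_def)
next
  case (Suc r)
  then obtain e f \<mu> where IH: "hyperbolic r e f" "adapted r e f \<mu> L" "\<forall>i<r. 0 \<le> \<mu> i"
      "\<forall>j<r. \<forall>i\<le>j. \<mu> j \<le> \<mu> i" "\<forall>i<r. \<forall>z\<in>L \<inter> perp r e f. tpow (\<mu> i) *s z \<in> tV 0"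
    by auto
  obtain u w k where k: "0 \<le> k" "u \<in> tV 0" "w \<in> tV 0" "u \<in> perp r e f" "w \<in> perp r e f"
      "\<langle>u, w\<rangle> = 1" "tpow (- k) *s u \<in> L" "tpow k *s w \<in> L"
      "\<forall>z\<in>L \<inter> perp r e f. tpow k *s z \<in> tV 0"
    using ex_adapted_pair[OF L IH(1,2)] Suc.prems by auto
  let ?e = "e(r := u)" and ?f = "f(r := w)" and ?\<mu> = "\<mu>(r := k)"
  \<comment> \<open>A larger new exponent would make \<open>u\<close> divisible by \<open>t\<close>,
    although \<open>u\<close> pairs to 1 with the integral vector \<open>w\<close>.\<close>
  have le: "k \<le> \<mu> i" if "i < r" for i
  proof (rule ccontr)
    assume c: "\<not> k \<le> \<mu> i"
    have "tpow (- k) *s u \<in> L \<inter> perp r e f" using k by (simp add: perp_def form_F_scale)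
    then have "tpow (\<mu> i) *s (tpow (- k) *s u) \<in> tV 0" using IH(5) that by blast
    then have "u \<in> tV (0 - \<mu> i - - k)" by (simp only: tV_tpow)
    then have "u \<in> tV 1" by (rule tV_mono) (use c in simp)
    then have "\<langle>u, w\<rangle> \<in> tO 1" using form_in_tO[of u 1 w 0] k by simp
    then show False using k(6) by simp
  qed
  have perp: "perp (Suc r) ?e ?f \<subseteq> perp r e f"
    by (auto simp: perp_def less_Suc_eq)
  have "hyperbolic (Suc r) ?e ?f" using IH(1) k by (intro hyperbolic_extend) auto
  moreover have "adapted (Suc r) ?e ?f ?\<mu> L"
    using IH(2) k by (auto simp: adapted_def less_Suc_eq)
  moreover have "\<forall>i<Suc r. 0 \<le> ?\<mu> i" using IH(3) k(1) by simp
  moreover have "\<forall>j<Suc r. \<forall>i\<le>j. ?\<mu> j \<le> ?\<mu> i"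
    using IH(4) le by auto
  moreover have "\<forall>i<Suc r. \<forall>z\<in>L \<inter> perp (Suc r) ?e ?f. tpow (?\<mu> i) *s z \<in> tV 0"
    using IH(5) k(9) perp by auto
  ultimately show ?case by blast
qed

end

section \<open>Polynomial curves\<close>

text \<open>The pole bound is uniform in \<open>s\<close>. It makes each coefficient of a product a
  finite sum over a range independent of \<open>s\<close>, and it keeps a curve inside one
  \<open>bounded_piece\<close>.\<close>

definition poly_curve :: "(complex \<Rightarrow> complex fls) \<Rightarrow> bool" where
  "poly_curve f \<longleftrightarrow> (\<exists>N. \<forall>s. f s \<in> tO N) \<and> (\<forall>j. \<exists>p. \<forall>s. fls_nth (f s) j = poly p s)"

lemma poly_curve_const [intro!]: "poly_curve (\<lambda>_. c)"
  using ex_tO[of c] unfolding poly_curve_def by (auto intro: exI[of _ "[:_:]"])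

lemma poly_curve_param [intro!]: "poly_curve fls_const"
proof -
  have "\<exists>p. \<forall>s :: complex. fls_nth (fls_const s) j = poly p s" for j
    by (rule exI[of _ "if j = 0 then [:0, 1:] else 0"]) simp
  then show ?thesis unfolding poly_curve_def by (auto intro: exI[of _ 0])
qed

lemma poly_curve_add [intro!]:
  assumes "poly_curve f" "poly_curve h"
  shows "poly_curve (\<lambda>s. f s + h s)"
proof -
  obtain a b where ab: "\<forall>s. f s \<in> tO a" "\<forall>s. h s \<in> tO b"
    using assms unfolding poly_curve_def by blast
  have "f s + h s \<in> tO (min a b)" for s
    using ab tO_mono[of _ a "min a b"] tO_mono[of _ b "min a b"] by (intro tO_add) auto
  moreover have "\<exists>p. \<forall>s. fls_nth (f s + h s) j = poly p s" for j
  proof -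
    obtain p q where "\<forall>s. fls_nth (f s) j = poly p s" "\<forall>s. fls_nth (h s) j = poly q s"
      using assms unfolding poly_curve_def by meson
    then show ?thesis by (intro exI[of _ "p + q"]) simp
  qed
  ultimately show ?thesis unfolding poly_curve_def by blast
qed

text \<open>The range of summation depends on the pole bounds and not on the subdegrees, which may
  jump along a curve.\<close>

lemma nth_mult_interval:
  assumes "f \<in> tO a" "h \<in> tO b"
  shows "fls_nth (f * h) j = (\<Sum>i = a..j - b. fls_nth f i * fls_nth h (j - i))"
proof (cases "f = 0 \<or> h = 0")
  case False
  then have "a \<le> fls_subdegree f" "b \<le> fls_subdegree h"
    using assms by (auto simp: tO_def intro!: fls_subdegree_geI)
  then show ?thesis
    unfolding fls_times_nth(2) by (intro sum.mono_neutral_left) auto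
qed auto

lemma poly_curve_mult [intro!]:
  assumes "poly_curve f" "poly_curve h"
  shows "poly_curve (\<lambda>s. f s * h s)"
proof -
  obtain a b where ab: "\<forall>s. f s \<in> tO a" "\<forall>s. h s \<in> tO b"
    using assms unfolding poly_curve_def by blast
  obtain p where p: "\<forall>j s. fls_nth (f s) j = poly (p j) s"
    using assms(1) unfolding poly_curve_def by metis
  obtain q where q: "\<forall>j s. fls_nth (h s) j = poly (q j) s"
    using assms(2) unfolding poly_curve_def by metis
  have "fls_nth (f s * h s) j = poly (\<Sum>i = a..j - b. p i * q (j - i)) s" for j s
    using nth_mult_interval[of "f s" a "h s" b j] ab p q by (simp add: poly_sum)
  moreover have "f s * h s \<in> tO (a + b)" for s
    using ab by (intro tO_mult_add) auto
  ultimately show ?thesis unfolding poly_curve_def by blast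
qed

lemma poly_curve_uminus [intro!]: "poly_curve f \<Longrightarrow> poly_curve (\<lambda>s. - f s)"
  using poly_curve_mult[OF poly_curve_const[of "- 1"], of f] by simp

lemma poly_curve_diff [intro!]: "poly_curve f \<Longrightarrow> poly_curve h \<Longrightarrow> poly_curve (\<lambda>s. f s - h s)"
  using poly_curve_add[OF _ poly_curve_uminus, of f h] by simp

lemma poly_curve_sum [intro!]:
  "(\<And>i. i \<in> S \<Longrightarrow> poly_curve (f i)) \<Longrightarrow> poly_curve (\<lambda>s. \<Sum>i\<in>S. f i s)"
  by (induction S rule: infinite_finite_induct) auto

definition poly_curve_vec :: "(complex \<Rightarrow> ('m::finite) Fvec) \<Rightarrow> bool" where
  "poly_curve_vec v \<longleftrightarrow> (\<forall>i. poly_curve (\<lambda>s. v s $ i))"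

definition poly_curve_mat :: "(complex \<Rightarrow> ('m::finite) Fmat) \<Rightarrow> bool" where
  "poly_curve_mat A \<longleftrightarrow> (\<forall>i j. poly_curve (\<lambda>s. A s $ i $ j))"

lemma poly_curve_vec_const [intro!]: "poly_curve_vec (\<lambda>_. v)"
  by (auto simp: poly_curve_vec_def)

lemma poly_curve_vec_sum [intro!]:
  "(\<And>i. i \<in> S \<Longrightarrow> poly_curve_vec (v i)) \<Longrightarrow> poly_curve_vec (\<lambda>s. \<Sum>i\<in>S. v i s)"
  by (auto simp: poly_curve_vec_def)

lemma poly_curve_vec_scale [intro!]:
  "poly_curve c \<Longrightarrow> poly_curve_vec v \<Longrightarrow> poly_curve_vec (\<lambda>s. c s *s v s)"
  by (auto simp: poly_curve_vec_def)

lemma poly_curve_vec_apply [intro!]: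
  "poly_curve_mat A \<Longrightarrow> poly_curve_vec v \<Longrightarrow> poly_curve_vec (\<lambda>s. A s *v v s)"
  by (auto simp: poly_curve_vec_def poly_curve_mat_def matrix_vector_mult_def)

lemma poly_curve_mat_const [intro!]: "poly_curve_mat (\<lambda>_. A)"
  by (auto simp: poly_curve_mat_def)

lemma poly_curve_mat_add [intro!]:
  "poly_curve_mat A \<Longrightarrow> poly_curve_mat B \<Longrightarrow> poly_curve_mat (\<lambda>s. A s + B s)"
  by (auto simp: poly_curve_mat_def)

lemma poly_curve_mat_mult [intro!]:
  "poly_curve_mat A \<Longrightarrow> poly_curve_mat B \<Longrightarrow> poly_curve_mat (\<lambda>s. A s ** B s)"
  by (auto simp: poly_curve_mat_def matrix_matrix_mult_def)

lemma poly_curve_mat_sum [intro!]: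
  "(\<And>i. i \<in> S \<Longrightarrow> poly_curve_mat (A i)) \<Longrightarrow> poly_curve_mat (\<lambda>s. \<Sum>i\<in>S. A i s)"
  by (auto simp: poly_curve_mat_def)

lemma poly_curve_mat_scal [intro!]:
  "poly_curve c \<Longrightarrow> poly_curve_mat A \<Longrightarrow> poly_curve_mat (\<lambda>s. scal (c s) (A s))"
  by (auto simp: poly_curve_mat_def)

lemma poly_curve_mat_rank_one [intro!]:
  "poly_curve_vec u \<Longrightarrow> poly_curve_vec w \<Longrightarrow> poly_curve_mat (\<lambda>s. rank_one J (u s) (w s))"
  by (auto simp: poly_curve_mat_def poly_curve_vec_def rank_one_def)

context symplectic_space
begin

section \<open>Transvections connect any two symplectic frames\<close>

definition transvection :: "complex fls \<Rightarrow> 'm Fvec \<Rightarrow> 'm Fmat" where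
  "transvection c u = mat 1 + scal c (rank_one J u u)"

lemma transvection_apply: "transvection c u *v z = z + (c * \<langle>u, z\<rangle>) *s u"
  by (simp add: transvection_def matrix_vector_mult_add_rdistrib scal_apply rank_one_apply
      vector_smult_assoc)

lemma transvection_in_Sp_F: "transvection c u \<in> Sp_F J"
proof -
  have "\<langle>transvection c u *v y, transvection c u *v z\<rangle> = \<langle>y, z\<rangle>" for y z
    using form_skew[of y u]
    by (simp add: transvection_apply form_add_left form_F_add form_scale_left form_F_scale)
  then show ?thesis by (simp add: Sp_F_def)
qed

lemma transvection_in_gl_O: "c \<in> tO 0 \<Longrightarrow> u \<in> tV 0 \<Longrightarrow> transvection c u \<in> gl_O"
  by (auto simp: gl_O_iff_V_O V_O_tV transvection_apply intro!: tV_add tV_scale0 tO_mult form_in_tO0)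

text \<open>Connectedness of Sp(O) by polynomial curves. The pointwise product of two curves
  starting at \<open>mat 1\<close> joins \<open>mat 1\<close> to the product, so products of
  transvections are covered.\<close>

definition joined_to_1 :: "'m Fmat \<Rightarrow> bool" where
  "joined_to_1 g \<longleftrightarrow>
     (\<exists>k. (\<forall>s. k s \<in> Sp_F J \<inter> gl_O) \<and> poly_curve_mat k \<and> k 0 = mat 1 \<and> k 1 = g)"

lemma joined_to_1_Sp_O: "joined_to_1 g \<Longrightarrow> g \<in> Sp_F J \<inter> gl_O"
  by (auto simp: joined_to_1_def)

lemma joined_to_1_one: "joined_to_1 (mat 1)"
proof -
  have "mat 1 \<in> Sp_F J \<inter> gl_O" by (simp add: Sp_F_def gl_O_iff_V_O)
  then show ?thesis unfolding joined_to_1_def by (intro exI[of _ "\<lambda>_. mat 1"]) auto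
qed

lemma joined_to_1_mult:
  assumes "joined_to_1 g" "joined_to_1 h"
  shows "joined_to_1 (g ** h)"
proof -
  obtain k k' where "\<forall>s. k s \<in> Sp_F J \<inter> gl_O" "poly_curve_mat k" "k 0 = mat 1" "k 1 = g"
      "\<forall>s. k' s \<in> Sp_F J \<inter> gl_O" "poly_curve_mat k'" "k' 0 = mat 1" "k' 1 = h"
    using assms unfolding joined_to_1_def by blast
  then show ?thesis unfolding joined_to_1_def
    by (intro exI[of _ "\<lambda>s. k s ** k' s"]) (auto simp: Sp_F_mult gl_O_mult)
qed

text \<open>Scaling the coefficient \<open>c\<close> by the parameter stays among the transvections
  along \<open>u\<close>.\<close>

lemma joined_to_1_transvection:
  assumes "c \<in> tO 0" "u \<in> tV 0"
  shows "joined_to_1 (transvection c u)"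
proof -
  let ?k = "\<lambda>s. transvection (fls_const s * c) u"
  have "?k s \<in> Sp_F J \<inter> gl_O" for s
    using assms by (auto intro!: transvection_in_Sp_F transvection_in_gl_O tO_mult)
  moreover have "poly_curve_mat ?k"
    unfolding transvection_def by auto
  moreover have "?k 0 = mat 1" "?k 1 = transvection c u"
    by (simp_all add: transvection_def vec_eq_iff)
  ultimately show ?thesis unfolding joined_to_1_def by (intro exI[of _ ?k]) auto
qed

text \<open>The transvection along \<open>w - u\<close> with coefficient
  \<open>inverse \<langle>w, u\<rangle>\<close> sends \<open>u\<close> to \<open>w\<close> and fixes
  all vectors orthogonal to \<open>w - u\<close>. It is integral because the pairing is a unit of
  O.\<close>

lemma ex_joined_move:
  assumes "u \<in> tV 0" "w \<in> tV 0" "fls_nth \<langle>u, w\<rangle> 0 \<noteq> 0"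
  shows "\<exists>h. joined_to_1 h \<and> h *v u = w \<and> (\<forall>z. \<langle>u, z\<rangle> = \<langle>w, z\<rangle> \<longrightarrow> h *v z = z)"
proof -
  have 0: "\<langle>w, u\<rangle> \<in> tO 0" "fls_nth \<langle>w, u\<rangle> 0 \<noteq> 0"
    using assms form_skew[of w u] by (auto intro: form_in_tO0)
  define c where "c = inverse \<langle>w, u\<rangle>"
  have c: "c \<in> tO 0" "c * \<langle>w, u\<rangle> = 1"
    using inverse_in_tO[OF 0] by (simp_all add: c_def)
  let ?h = "transvection c (w - u)"
  have "?h *v u = w"
    using c(2) by (simp add: transvection_apply form_diff_left)
  moreover have "?h *v z = z" if "\<langle>u, z\<rangle> = \<langle>w, z\<rangle>" for z
    using that by (simp add: transvection_apply form_diff_left)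
  moreover have "joined_to_1 ?h"
    using c(1) assms by (intro joined_to_1_transvection tV_diff)
  ultimately show ?thesis by blast
qed

text \<open>Induction on the number of pairs: first \<open>e r\<close> is moved to its target, then
  \<open>f r\<close>, by transvections fixing what is already in place. A single transvection needs
  a unit pairing, hence the detours through intermediate vectors.\<close>

lemma ex_joined_hyperbolic:
  assumes h: "hyperbolic n e f" "hyperbolic n e' f'"
  shows "r \<le> n \<Longrightarrow> \<exists>g. joined_to_1 g \<and> (\<forall>i<r. g *v e i = e' i \<and> g *v f i = f' i)"
proof (induction r)
  case 0
  then show ?case using joined_to_1_one by auto
next
  case (Suc r)
  then obtain g where g: "joined_to_1 g" "\<forall>i<r. g *v e i = e' i \<and> g *v f i = f' i" and r: "r < n"
    by auto
  have gSp: "g \<in> Sp_F J" "g \<in> gl_O" using joined_to_1_Sp_O[OF g(1)] by auto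
  define u p where "u = g *v e r" and "p = g *v f r"
  have O: "u \<in> tV 0" "p \<in> tV 0" "e' r \<in> tV 0" "f' r \<in> tV 0"
    using h r gSp by (auto simp: u_def p_def hyperbolic_def gl_O_apply_tV)
  have up: "\<langle>u, p\<rangle> = 1" "\<langle>e' r, f' r\<rangle> = 1"
    using h r by (auto simp: u_def p_def hyperbolic_def Sp_F_form[OF gSp(1)])
  have old: "\<langle>u, e' i\<rangle> = 0 \<and> \<langle>u, f' i\<rangle> = 0 \<and> \<langle>p, e' i\<rangle> = 0 \<and> \<langle>p, f' i\<rangle> = 0 \<and>
      \<langle>e' r, e' i\<rangle> = 0 \<and> \<langle>e' r, f' i\<rangle> = 0 \<and> \<langle>f' r, e' i\<rangle> = 0 \<and> \<langle>f' r, f' i\<rangle> = 0" if i: "i < r" for i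
  proof -
    have fe: "\<langle>f r, e i\<rangle> = 0" "\<langle>f' r, e' i\<rangle> = 0"
      using h r i form_skew[of "f r" "e i"] form_skew[of "f' r" "e' i"]
      by (simp_all add: hyperbolic_def)
    have e: "e' i = g *v e i" "f' i = g *v f i" using g(2) i by simp_all
    have "\<langle>u, e' i\<rangle> = 0 \<and> \<langle>u, f' i\<rangle> = 0 \<and> \<langle>p, e' i\<rangle> = 0 \<and> \<langle>p, f' i\<rangle> = 0"
      unfolding u_def p_def e Sp_F_form[OF gSp(1)] using h r i fe by (simp add: hyperbolic_def)
    then show ?thesis using h r i fe by (simp add: hyperbolic_def)
  qed
  \<comment> \<open>The intermediate vector must pair to units with both \<open>u\<close> and
    \<open>e' r\<close> and be orthogonal to the earlier pairs. One of \<open>p\<close> and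
    \<open>f' r\<close> works unless \<open>\<langle>p, e' r\<rangle>\<close> and
    \<open>\<langle>u, f' r\<rangle>\<close> both vanish at \<open>t = 0\<close>, and then the sum
    \<open>p + f' r\<close> works.\<close>
  obtain z where z: "z \<in> tV 0" "fls_nth \<langle>u, z\<rangle> 0 \<noteq> 0" "fls_nth \<langle>z, e' r\<rangle> 0 \<noteq> 0"
      "\<forall>i<r. \<langle>z, e' i\<rangle> = 0 \<and> \<langle>z, f' i\<rangle> = 0"
  proof (cases "fls_nth \<langle>p, e' r\<rangle> 0 = 0 \<and> fls_nth \<langle>u, f' r\<rangle> 0 = 0")
    case True
    have "\<langle>f' r, e' r\<rangle> = - 1" using up form_skew[of "f' r" "e' r"] by simp
    then show ?thesis
      using True O up old by (intro that[of "p + f' r"]) (auto simp: tV_add form_F_add form_add_left)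
  next
    case False
    have "\<langle>f' r, e' r\<rangle> = - 1" using up form_skew[of "f' r" "e' r"] by simp
    then show ?thesis
      using False O up old that[of p] that[of "f' r"] by auto
  qed
  obtain h1 where h1: "joined_to_1 h1" "h1 *v u = z" "\<forall>y. \<langle>u, y\<rangle> = \<langle>z, y\<rangle> \<longrightarrow> h1 *v y = y"
    using ex_joined_move[OF O(1) z(1,2)] by blast
  obtain h2 where h2: "joined_to_1 h2" "h2 *v z = e' r" "\<forall>y. \<langle>z, y\<rangle> = \<langle>e' r, y\<rangle> \<longrightarrow> h2 *v y = y"
    using ex_joined_move[OF z(1) O(3) z(3)] by blast
  define g1 where "g1 = h2 ** (h1 ** g)"
  have g1: "joined_to_1 g1" using g(1) h1(1) h2(1) by (simp add: g1_def joined_to_1_mult)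
  have g1_old: "g1 *v e i = e' i \<and> g1 *v f i = f' i" if "i < r" for i
    using g(2) h1(3) h2(3) z(4) old that by (simp add: g1_def matrix_vector_mul_assoc[symmetric])
  have g1_e: "g1 *v e r = e' r"
    using h1(2) h2(2) by (simp add: g1_def matrix_vector_mul_assoc[symmetric] u_def)
  have g1Sp: "g1 \<in> Sp_F J" "g1 \<in> gl_O" using joined_to_1_Sp_O[OF g1] by auto
  define q where "q = g1 *v f r"
  have q: "q \<in> tV 0" "\<langle>e' r, q\<rangle> = 1"
    using h r g1Sp g1_e Sp_F_form[OF g1Sp(1), of "e r" "f r"]
    by (auto simp: q_def hyperbolic_def gl_O_apply_tV)
  have q_old: "\<langle>q, e' i\<rangle> = 0 \<and> \<langle>q, f' i\<rangle> = 0" if i: "i < r" for i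
  proof -
    have e: "e' i = g1 *v e i" "f' i = g1 *v f i" using g1_old i by simp_all
    show ?thesis
      unfolding q_def e Sp_F_form[OF g1Sp(1)]
      using h r i form_skew[of "f r" "e i"] by (simp add: hyperbolic_def)
  qed
  have qe: "\<langle>q, e' r\<rangle> = - 1" "\<langle>f' r, e' r\<rangle> = - 1"
    using q(2) up(2) form_skew[of q "e' r"] form_skew[of "f' r" "e' r"] by simp_all
  \<comment> \<open>\<open>q\<close> and \<open>f' r\<close> have the same pairing with
    \<open>e' r\<close>, so their difference is orthogonal to it and \<open>e' r\<close> stays
    fixed. The same holds for both steps of the detour through \<open>q + e' r\<close>, taken when
    \<open>q\<close> and \<open>f' r\<close> do not pair to a unit.\<close>
  have "\<exists>h. joined_to_1 h \<and> h *v q = f' r \<and> h *v e' r = e' r \<and>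
      (\<forall>i<r. h *v e' i = e' i \<and> h *v f' i = f' i)"
  proof (cases "fls_nth \<langle>q, f' r\<rangle> 0 = 0")
    case False
    then obtain h where "joined_to_1 h" "h *v q = f' r" "\<forall>y. \<langle>q, y\<rangle> = \<langle>f' r, y\<rangle> \<longrightarrow> h *v y = y"
      using ex_joined_move[OF q(1) O(4)] by blast
    then show ?thesis using q_old old qe by (intro exI[of _ h]) auto
  next
    case True
    have a: "q + e' r \<in> tV 0" using q(1) O(3) by (rule tV_add)
    have "fls_nth \<langle>q, q + e' r\<rangle> 0 \<noteq> 0" "fls_nth \<langle>q + e' r, f' r\<rangle> 0 \<noteq> 0"
      using True qe up by (simp_all add: form_F_add form_add_left)
    then obtain h3 h4 where h3: "joined_to_1 h3" "h3 *v q = q + e' r"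
        "\<forall>y. \<langle>q, y\<rangle> = \<langle>q + e' r, y\<rangle> \<longrightarrow> h3 *v y = y"
      and h4: "joined_to_1 h4" "h4 *v (q + e' r) = f' r"
        "\<forall>y. \<langle>q + e' r, y\<rangle> = \<langle>f' r, y\<rangle> \<longrightarrow> h4 *v y = y"
      using ex_joined_move[OF q(1) a] ex_joined_move[OF a O(4)] by blast
    show ?thesis
      using h3 h4 q_old old qe
      by (intro exI[of _ "h4 ** h3"])
        (auto simp: joined_to_1_mult form_add_left matrix_vector_mul_assoc[symmetric])
  qed
  then obtain h where h: "joined_to_1 h" "h *v q = f' r" "h *v e' r = e' r"
      "\<forall>i<r. h *v e' i = e' i \<and> h *v f' i = f' i"
    by blast
  have "joined_to_1 (h ** g1)" using h(1) g1 by (rule joined_to_1_mult)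
  moreover have "\<forall>i<Suc r. (h ** g1) *v e i = e' i \<and> (h ** g1) *v f i = f' i"
    using h g1_old g1_e by (auto simp: less_Suc_eq matrix_vector_mul_assoc[symmetric] q_def)
  ultimately show ?case by blast
qed

end

lemma tpow_cancel_left: "a + b = 0 \<Longrightarrow> tpow a * (tpow b * x) = x"
  by (simp only: mult.assoc[symmetric] tpow_mult tpow_0 mult_1)

context symplectic_space
begin

section \<open>Symplectic frames\<close>

text \<open>The antidiagonal Gram matrix pairs the index \<open>i\<close> with
  \<open>2 * n - 1 - i\<close>, the reflection under which a self-dual signature changes
  sign.\<close>

definition omega :: "nat \<Rightarrow> nat \<Rightarrow> complex fls" where
  "omega i j = (if i + j + 1 = 2 * n then if i < n then 1 else - 1 else 0)"

definition frame :: "(nat \<Rightarrow> 'm Fvec) \<Rightarrow> bool" where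
  "frame E \<longleftrightarrow> (\<forall>i<2*n. E i \<in> tV 0) \<and> (\<forall>i<2*n. \<forall>j<2*n. \<langle>E i, E j\<rangle> = omega i j)"

text \<open>The signs are chosen so that pairing with \<open>dual_frame E i\<close> on the left
  reads off the \<open>i\<close>-th coordinate.\<close>

definition dual_frame :: "(nat \<Rightarrow> 'm Fvec) \<Rightarrow> nat \<Rightarrow> 'm Fvec" where
  "dual_frame E i = (if i < n then - 1 else 1) *s E (2 * n - 1 - i)"

lemma frame_hyperbolic:
  assumes "hyperbolic n e f"
  shows "frame (\<lambda>i. if i < n then e i else f (2 * n - 1 - i))"
proof -
  have fe: "\<langle>f i, e j\<rangle> = - (if j = i then 1 else 0)" if "i < n" "j < n" for i j
    using assms that form_skew[of "f i" "e j"] by (simp add: hyperbolic_def)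
  have ef: "\<langle>e i, f j\<rangle> = (if i = j then 1 else 0)" "\<langle>e i, e j\<rangle> = 0" "\<langle>f i, f j\<rangle> = 0"
    if "i < n" "j < n" for i j
    using assms that by (auto simp: hyperbolic_def)
  have V: "e i \<in> tV 0" "f i \<in> tV 0" if "i < n" for i
    using assms that by (auto simp: hyperbolic_def)
  show ?thesis
    unfolding frame_def
    by (auto simp: omega_def ef fe V)
qed

lemma hyperbolic_frame:
  assumes "frame E"
  shows "hyperbolic n E (\<lambda>i. E (2 * n - 1 - i))"
  using assms unfolding frame_def hyperbolic_def omega_def by auto

lemma frame_in_tV: "frame E \<Longrightarrow> i < 2 * n \<Longrightarrow> E i \<in> tV 0"
  by (simp add: frame_def)

lemma frame_form: "frame E \<Longrightarrow> i < 2 * n \<Longrightarrow> j < 2 * n \<Longrightarrow> \<langle>E i, E j\<rangle> = omega i j"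
  by (simp add: frame_def)

lemma dual_frame_in_tV: "frame E \<Longrightarrow> i < 2 * n \<Longrightarrow> dual_frame E i \<in> tV 0"
  using frame_in_tV[of E "2 * n - 1 - i"] by (simp add: dual_frame_def tV_scale0)

lemma dual_frame_form:
  assumes "frame E" "i < 2 * n" "j < 2 * n"
  shows "\<langle>dual_frame E i, E j\<rangle> = (if i = j then 1 else 0)"
    "\<langle>E j, dual_frame E i\<rangle> = (if i = j then - 1 else 0)"
proof -
  show "\<langle>dual_frame E i, E j\<rangle> = (if i = j then 1 else 0)"
    using assms by (auto simp: dual_frame_def form_scale_left form_uminus_left frame_form omega_def)
  then show "\<langle>E j, dual_frame E i\<rangle> = (if i = j then - 1 else 0)"
    using form_skew[of "E j" "dual_frame E i"] by simp
qed

definition comb :: "(nat \<Rightarrow> 'm Fvec) \<Rightarrow> (nat \<Rightarrow> complex fls) \<Rightarrow> 'm Fvec" where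
  "comb E a = (\<Sum>i<2*n. a i *s E i)"

lemma form_dual_frame_comb:
  assumes "frame E" "i < 2 * n"
  shows "\<langle>dual_frame E i, comb E a\<rangle> = a i"
proof -
  have "\<langle>dual_frame E i, comb E a\<rangle> = (\<Sum>j<2*n. a j * \<langle>dual_frame E i, E j\<rangle>)"
    by (simp add: comb_def form_sum_right form_F_scale)
  also have "\<dots> = (\<Sum>j<2*n. if j = i then a j else 0)"
    using assms by (intro sum.cong) (auto simp: dual_frame_form)
  finally have "\<langle>dual_frame E i, comb E a\<rangle> = (\<Sum>j<2*n. if j = i then a j else 0)" .
  then show ?thesis using assms(2) by simp
qed

text \<open>The dual frame reads off coefficients, which makes the \<open>2 * n\<close> frame
  vectors independent; by dimension they span.\<close>

lemma frame_expansion: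
  assumes "frame E"
  shows "u = comb E (\<lambda>i. \<langle>dual_frame E i, u\<rangle>)"
proof -
  have inj: "inj_on E {..<2*n}"
  proof (rule inj_onI)
    fix i j assume "i \<in> {..<2*n}" "j \<in> {..<2*n}" "E i = E j"
    then show "i = j"
      using dual_frame_form(1)[OF assms, of i i] dual_frame_form(1)[OF assms, of i j]
      by (auto split: if_splits)
  qed
  have "vec.independent (E ` {..<2*n})"
  proof (rule vec.independent_if_scalars_zero)
    fix g x assume 0: "(\<Sum>x\<in>E ` {..<2*n}. g x *s x) = 0" and "x \<in> E ` {..<2*n}"
    then obtain i where i: "i < 2*n" "x = E i" by auto
    have "comb E (\<lambda>i. g (E i)) = 0"
      using 0 by (simp add: sum.reindex[OF inj] comb_def)
    then show "g x = 0"
      using form_dual_frame_comb[OF assms i(1), of "\<lambda>i. g (E i)"] i by simp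
  qed simp
  moreover have "vec.dim (UNIV :: 'm Fvec set) \<le> card (E ` {..<2*n})"
    unfolding vec_dim_card card_image[OF inj] by (simp add: card_UNIV)
  ultimately have "UNIV \<subseteq> vec.span (E ` {..<2*n})"
    by (intro vec.card_ge_dim_independent) auto
  then have "u \<in> range (\<lambda>g. \<Sum>x\<in>E ` {..<2*n}. g x *s x)"
    by (subst vec.span_finite[symmetric]) auto
  then obtain g where "u = (\<Sum>x\<in>E ` {..<2*n}. g x *s x)" by auto
  then have u: "u = comb E (\<lambda>i. g (E i))" by (simp add: sum.reindex[OF inj] comb_def)
  have "comb E (\<lambda>i. \<langle>dual_frame E i, u\<rangle>) = comb E (\<lambda>i. g (E i))"
    unfolding comb_def[of _ "\<lambda>i. \<langle>dual_frame E i, u\<rangle>"] comb_def[of _ "\<lambda>i. g (E i)"]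
    by (intro sum.cong refl) (simp add: u form_dual_frame_comb[OF assms])
  then show ?thesis using u by simp
qed

lemma frame_eqI:
  assumes "frame E" "\<And>i. i < 2 * n \<Longrightarrow> \<langle>dual_frame E i, u\<rangle> = \<langle>dual_frame E i, w\<rangle>"
  shows "u = w"
proof -
  have "u = comb E (\<lambda>i. \<langle>dual_frame E i, u\<rangle>)" by (rule frame_expansion[OF assms(1)])
  also have "\<dots> = comb E (\<lambda>i. \<langle>dual_frame E i, w\<rangle>)"
    by (simp add: comb_def assms(2))
  also have "\<dots> = w" by (rule frame_expansion[OF assms(1), symmetric])
  finally show ?thesis .
qed

lemma frame_conv_dual_frame:
  "i < 2 * n \<Longrightarrow> E i = (if i < n then 1 else - 1) *s dual_frame E (2 * n - 1 - i)"
  by (auto simp: dual_frame_def)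

lemma frame_matrix_eqI:
  assumes "frame E" "\<And>i j. i < 2 * n \<Longrightarrow> j < 2 * n \<Longrightarrow>
    \<langle>dual_frame E j, A *v dual_frame E i\<rangle> = \<langle>dual_frame E j, B *v dual_frame E i\<rangle>"
  shows "A = B"
proof (rule matrix_eqI)
  fix z
  have "A *v dual_frame E i = B *v dual_frame E i" if "i < 2 * n" for i
    using assms that by (intro frame_eqI[OF assms(1)]) auto
  then have E: "A *v E i = B *v E i" if "i < 2 * n" for i
    using that by (subst (1 2) frame_conv_dual_frame[OF that]) (simp add: matrix_apply_scale)
  have "A *v comb E a = B *v comb E a" for a
    using E by (simp add: comb_def matrix_apply_sum matrix_apply_scale)
  then show "A *v z = B *v z"
    using frame_expansion[OF assms(1), of z] by metis
qed

text \<open>Coordinates on endomorphisms that fit the symmetric square: symmetric coefficients give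
  the symplectic Lie algebra, and \<open>S2\<close> of a vector with coordinates \<open>a\<close>
  has the coefficients \<open>fls_X * a i * a j\<close>.\<close>

definition endo :: "(nat \<Rightarrow> 'm Fvec) \<Rightarrow> (nat \<Rightarrow> nat \<Rightarrow> complex fls) \<Rightarrow> 'm Fmat" where
  "endo E c = (\<Sum>i<2*n. \<Sum>j<2*n. scal (c i j) (rank_one J (E i) (E j)))"

lemma endo_apply: "endo E c *v z = (\<Sum>i<2*n. \<Sum>j<2*n. (c i j * \<langle>E i, z\<rangle>) *s E j)"
  by (simp add: endo_def matrix_sum_apply scal_apply rank_one_apply vector_smult_assoc)

lemma endo_dual_frame:
  assumes "frame E" "i < 2 * n"
  shows "endo E c *v dual_frame E i = comb E (\<lambda>j. - c i j)"
proof -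
  have "endo E c *v dual_frame E i = (\<Sum>k<2*n. if k = i then (\<Sum>j<2*n. (- c k j) *s E j) else 0)"
    unfolding endo_apply
  proof (intro sum.cong refl)
    fix k assume k: "k \<in> {..<2*n}"
    then have "\<langle>E k, dual_frame E i\<rangle> = (if i = k then - 1 else 0)"
      using assms by (intro dual_frame_form) auto
    then show "(\<Sum>j<2*n. (c k j * \<langle>E k, dual_frame E i\<rangle>) *s E j) =
        (if k = i then \<Sum>j<2*n. (- c k j) *s E j else 0)"
      by auto
  qed
  then show ?thesis using assms(2) by (simp add: comb_def)
qed

lemma endo_coeff:
  assumes "frame E" "i < 2 * n" "j < 2 * n"
  shows "\<langle>dual_frame E j, endo E c *v dual_frame E i\<rangle> = - c i j"
  using assms by (simp add: endo_dual_frame form_dual_frame_comb)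

lemma endo_expansion:
  assumes "frame E"
  shows "X = endo E (\<lambda>i j. - \<langle>dual_frame E j, X *v dual_frame E i\<rangle>)"
  using assms by (intro frame_matrix_eqI[OF assms]) (simp add: endo_coeff)

lemma endo_eq_iff:
  assumes "frame E"
  shows "endo E c = endo E d \<longleftrightarrow> (\<forall>i<2*n. \<forall>j<2*n. c i j = d i j)"
proof
  assume "endo E c = endo E d"
  then show "\<forall>i<2*n. \<forall>j<2*n. c i j = d i j"
    using endo_coeff[OF assms] by (metis neg_equal_iff_equal)
qed (simp add: endo_def)

lemma scal_endo: "scal x (endo E c) = endo E (\<lambda>i j. x * c i j)"
  by (rule matrix_eqI)
    (simp add: scal_apply endo_apply vec.scale_sum_right vector_smult_assoc mult.assoc)

lemma endo_add: "endo E c + endo E d = endo E (\<lambda>i j. c i j + d i j)"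
  unfolding endo_def sum.distrib[symmetric]
  by (intro sum.cong refl) (simp add: vec_eq_iff distrib_right)

lemma S2_comb:
  assumes "frame E"
  shows "S2 J (comb E a) = endo E (\<lambda>i j. fls_X * a i * a j)"
proof (rule frame_matrix_eqI[OF assms])
  fix i j assume ij: "i < 2 * n" "j < 2 * n"
  have "\<langle>comb E a, dual_frame E i\<rangle> = - a i"
    using form_dual_frame_comb[OF assms ij(1), of a] form_skew[of "comb E a" "dual_frame E i"] by simp
  then show "\<langle>dual_frame E j, S2 J (comb E a) *v dual_frame E i\<rangle> =
      \<langle>dual_frame E j, endo E (\<lambda>i j. fls_X * a i * a j) *v dual_frame E i\<rangle>"
    using ij assms by (simp add: S2_apply form_F_scale form_uminus_right form_dual_frame_comb endo_coeff)
qed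

lemma endo_in_sp_F_iff:
  assumes "frame E"
  shows "endo E c \<in> sp_F J \<longleftrightarrow> (\<forall>i<2*n. \<forall>j<2*n. c i j = c j i)"
proof
  assume sp: "endo E c \<in> sp_F J"
  show "\<forall>i<2*n. \<forall>j<2*n. c i j = c j i"
  proof (intro allI impI)
    fix i j assume ij: "i < 2 * n" "j < 2 * n"
    have "\<langle>endo E c *v dual_frame E i, dual_frame E j\<rangle> + \<langle>dual_frame E i, endo E c *v dual_frame E j\<rangle> = 0"
      using sp by (simp add: sp_F_def)
    then show "c i j = c j i"
      using ij assms form_skew[of "endo E c *v dual_frame E i" "dual_frame E j"] by (simp add: endo_coeff)
  qed
next
  assume sym: "\<forall>i<2*n. \<forall>j<2*n. c i j = c j i"
  have "\<langle>endo E c *v y, z\<rangle> + \<langle>y, endo E c *v z\<rangle> = 0" for y z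
  proof -
    have "\<langle>y, endo E c *v z\<rangle> = (\<Sum>i<2*n. \<Sum>j<2*n. c i j * \<langle>E i, z\<rangle> * \<langle>y, E j\<rangle>)"
      by (simp add: endo_apply form_sum_right form_F_scale)
    also have "\<dots> = (\<Sum>j<2*n. \<Sum>i<2*n. c i j * \<langle>E i, z\<rangle> * \<langle>y, E j\<rangle>)"
      by (rule sum.swap)
    also have "\<dots> = (\<Sum>j<2*n. \<Sum>i<2*n. - (c j i * \<langle>E j, y\<rangle> * \<langle>E i, z\<rangle>))"
    proof (intro sum.cong refl)
      fix i j assume "i \<in> {..<2*n}" "j \<in> {..<2*n}"
      then have "c i j = c j i" using sym by simp
      then show "c i j * \<langle>E i, z\<rangle> * \<langle>y, E j\<rangle> = - (c j i * \<langle>E j, y\<rangle> * \<langle>E i, z\<rangle>)"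
        using form_skew[of y "E j"] by simp
    qed
    finally show ?thesis
      by (simp add: endo_apply form_sum_left form_scale_left sum_negf)
  qed
  then show "endo E c \<in> sp_F J" by (simp add: sp_F_def)
qed

section \<open>Lattices adapted to a frame\<close>

definition lattice :: "(nat \<Rightarrow> 'm Fvec) \<Rightarrow> (nat \<Rightarrow> int) \<Rightarrow> 'm Fvec set" where
  "lattice E m = {u. \<forall>i<2*n. \<langle>dual_frame E i, u\<rangle> \<in> tO (- m i)}"

text \<open>Under this condition \<open>lattice E m\<close> is self-dual: the paired vectors
  \<open>E i\<close> and \<open>E (2 * n - 1 - i)\<close> get opposite exponents.\<close>

definition antisymmetric :: "(nat \<Rightarrow> int) \<Rightarrow> bool" where
  "antisymmetric m \<longleftrightarrow> (\<forall>i<2*n. m (2 * n - 1 - i) = - m i)"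

lemma comb_in_lattice_iff:
  "frame E \<Longrightarrow> comb E a \<in> lattice E m \<longleftrightarrow> (\<forall>i<2*n. a i \<in> tO (- m i))"
  by (simp add: lattice_def form_dual_frame_comb)

lemma lattice_0:
  assumes "frame E"
  shows "lattice E (\<lambda>_. 0) = tV 0"
proof
  show "lattice E (\<lambda>_. 0) \<subseteq> tV 0"
  proof
    fix u assume "u \<in> lattice E (\<lambda>_. 0)"
    then have "comb E (\<lambda>i. \<langle>dual_frame E i, u\<rangle>) \<in> tV 0"
      using assms by (auto simp: comb_def lattice_def intro!: tV_sum tV_scale0[OF _ frame_in_tV[OF assms]])
    then show "u \<in> tV 0" using frame_expansion[OF assms, of u] by simp
  qed
  show "tV 0 \<subseteq> lattice E (\<lambda>_. 0)"
    using assms by (auto simp: lattice_def intro!: form_in_tO0 dual_frame_in_tV)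
qed

lemma scaled_dual_frame_in_lattice:
  assumes "frame E" "antisymmetric m" "i < 2 * n"
  shows "tpow (m i) *s dual_frame E i \<in> lattice E m"
proof -
  have "\<langle>dual_frame E j, tpow (m i) *s dual_frame E i\<rangle> \<in> tO (- m j)" if "j < 2 * n" for j
  proof (cases "j = 2 * n - 1 - i")
    case True
    then have mj: "- m j = m i" using assms(2,3) by (simp add: antisymmetric_def)
    have "tpow (m i) *s dual_frame E i \<in> tV (m i)"
      using tV_scale[OF tpow_in_tO dual_frame_in_tV[OF assms(1,3)], of "m i"] by simp
    then show ?thesis
      using form_in_tO[OF dual_frame_in_tV[OF assms(1) that]] unfolding mj by fastforce
  next
    case False
    then have "\<langle>E (2 * n - 1 - j), E (2 * n - 1 - i)\<rangle> = 0"
      using assms that by (subst frame_form[OF assms(1)]) (auto simp: omega_def)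
    then show ?thesis
      by (simp add: dual_frame_def form_scale_left form_F_scale form_uminus_left form_uminus_right)
  qed
  then show ?thesis by (simp add: lattice_def)
qed

text \<open>The term with coefficient \<open>c i j\<close> pairs its argument with
  \<open>E i\<close>, which picks the coordinate with the reflected index. By antisymmetry that
  coordinate lies in \<open>tO (m i)\<close>, so both exponents enter the bound with the same
  sign.\<close>

lemma endo_in_End_lattice_iff:
  assumes "frame E" "antisymmetric m"
  shows "endo E c \<in> End_lattice (lattice E m) \<longleftrightarrow> (\<forall>i<2*n. \<forall>j<2*n. c i j \<in> tO (- m i - m j))"
proof
  assume End: "endo E c \<in> End_lattice (lattice E m)"
  show "\<forall>i<2*n. \<forall>j<2*n. c i j \<in> tO (- m i - m j)"
  proof (intro allI impI)
    fix i j assume ij: "i < 2 * n" "j < 2 * n"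
    have "endo E c *v (tpow (m i) *s dual_frame E i) \<in> lattice E m"
      using End scaled_dual_frame_in_lattice[OF assms ij(1)] by (simp add: End_lattice_def)
    then have "tpow (m i) * - c i j \<in> tO (- m j)"
      unfolding lattice_def using ij(2)
      by (auto simp only: matrix_apply_scale form_F_scale endo_coeff[OF assms(1) ij])
    then show "c i j \<in> tO (- m i - m j)"
      unfolding tO_tpow_mult by (simp only: diff_conv_add_uminus add.commute tO_uminus)
  qed
next
  assume c: "\<forall>i<2*n. \<forall>j<2*n. c i j \<in> tO (- m i - m j)"
  show "endo E c \<in> End_lattice (lattice E m)"
    unfolding End_lattice_def
  proof (intro CollectI ballI)
    fix u assume u: "u \<in> lattice E m"
    have "\<langle>E i, u\<rangle> \<in> tO (m i)" if i: "i < 2 * n" for i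
    proof -
      have "\<langle>dual_frame E (2 * n - 1 - i), u\<rangle> \<in> tO (- m (2 * n - 1 - i))"
        using u i by (simp add: lattice_def)
      moreover have "- m (2 * n - 1 - i) = m i" using assms(2) i by (simp add: antisymmetric_def)
      moreover have "\<langle>E i, u\<rangle> = (if i < n then 1 else - 1) * \<langle>dual_frame E (2 * n - 1 - i), u\<rangle>"
        by (subst frame_conv_dual_frame[OF i]) (simp add: form_scale_left form_uminus_left)
      ultimately show ?thesis by auto
    qed
    then have "c i j * \<langle>E i, u\<rangle> \<in> tO (- m i - m j + m i)" if "i < 2 * n" "j < 2 * n" for i j
      using c that by (intro tO_mult_add) auto
    then have "(\<Sum>i<2*n. c i j * \<langle>E i, u\<rangle>) \<in> tO (- m j)" if "j < 2 * n" for j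
      using that by (intro tO_sum) (simp add: algebra_simps)
    moreover have "endo E c *v u = comb E (\<lambda>j. \<Sum>i<2*n. c i j * \<langle>E i, u\<rangle>)"
      unfolding endo_apply comb_def vec.scale_sum_left by (rule sum.swap)
    ultimately show "endo E c *v u \<in> lattice E m"
      using assms(1) by (simp add: comb_in_lattice_iff)
  qed
qed

lemma gl_O_End_lattice: "frame E \<Longrightarrow> gl_O = End_lattice (lattice E (\<lambda>_. 0))"
  by (auto simp: lattice_0 End_lattice_def gl_O_iff_V_O V_O_tV)

text \<open>Multiplying an operator by \<open>t\<close> multiplies its coefficients by
  \<open>t\<close>, which shifts every bound by one.\<close>

lemma endo_in_scal_iff:
  assumes "frame E" and S: "\<And>c. endo E c \<in> S \<longleftrightarrow> (\<forall>i<2*n. \<forall>j<2*n. c i j = c j i \<and> c i j \<in> tO (k i j))"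
  shows "endo E c \<in> scal fls_X ` S \<longleftrightarrow> (\<forall>i<2*n. \<forall>j<2*n. c i j = c j i \<and> c i j \<in> tO (k i j + 1))"
proof
  assume "endo E c \<in> scal fls_X ` S"
  then obtain Y where Y: "Y \<in> S" "endo E c = scal fls_X Y" by blast
  obtain d where d: "Y = endo E d" using endo_expansion[OF assms(1)] by blast
  have "\<forall>i<2*n. \<forall>j<2*n. c i j = fls_X * d i j"
    using Y(2) unfolding d scal_endo endo_eq_iff[OF assms(1)] .
  moreover have "\<forall>i<2*n. \<forall>j<2*n. d i j = d j i \<and> d i j \<in> tO (k i j)"
    using Y(1) S d by simp
  ultimately show "\<forall>i<2*n. \<forall>j<2*n. c i j = c j i \<and> c i j \<in> tO (k i j + 1)"
    by (simp add: tO_X_mult)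
next
  assume c: "\<forall>i<2*n. \<forall>j<2*n. c i j = c j i \<and> c i j \<in> tO (k i j + 1)"
  define d where "d = (\<lambda>i j. tpow (- 1) * c i j)"
  have "endo E d \<in> S"
    unfolding S using c by (simp add: d_def tO_tpow_mult del: fls_shift_subdegree minus_minus)
  moreover have "fls_X * d i j = c i j" for i j
    unfolding d_def fls_X_tpow by (rule tpow_cancel_left) simp
  then have "endo E c = scal fls_X (endo E d)"
    by (simp add: scal_endo)
  ultimately show "endo E c \<in> scal fls_X ` S" by blast
qed

lemma endo_in_nil_radical_iff:
  assumes "frame E" "antisymmetric m"
  shows "endo E c \<in> nil_radical (stabilizer_sp J (lattice E m)) \<longleftrightarrow>
    (\<forall>i<2*n. \<forall>j<2*n. c i j = c j i \<and> c i j \<in> tO (1 - m i - m j))"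
proof -
  have "endo E c \<in> stabilizer_sp J (lattice E m) \<longleftrightarrow>
      (\<forall>i<2*n. \<forall>j<2*n. c i j = c j i \<and> c i j \<in> tO (- m i - m j))" for c
    using assms by (auto simp: stabilizer_sp_def endo_in_sp_F_iff endo_in_End_lattice_iff)
  then show ?thesis
    unfolding nil_radical_def
    by (subst endo_in_scal_iff[OF assms(1), of _ "\<lambda>i j. - m i - m j"]) (auto simp: algebra_simps)
qed

lemma endo_in_t_sp_O_iff:
  assumes "frame E"
  shows "endo E c \<in> scal fls_X ` sp_O J \<longleftrightarrow> (\<forall>i<2*n. \<forall>j<2*n. c i j = c j i \<and> c i j \<in> tO 1)"
proof -
  have "antisymmetric (\<lambda>_. 0)" by (simp add: antisymmetric_def)
  moreover have "sp_O J = stabilizer_sp J (lattice E (\<lambda>_. 0))"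
    using gl_O_End_lattice[OF assms] by (simp add: sp_O_def stabilizer_sp_def)
  ultimately show ?thesis
    using endo_in_nil_radical_iff[OF assms, of "\<lambda>_. 0" c] by (simp add: nil_radical_def)
qed

text \<open>Sends \<open>B i\<close> to \<open>tpow (- m i) *s E i\<close>. For fixed
  \<open>B\<close> its entries are polynomial in those of \<open>E\<close>, so a curve of frames
  gives a curve in Sp(F) above the curve of lattices.\<close>

definition transition :: "(nat \<Rightarrow> 'm Fvec) \<Rightarrow> (nat \<Rightarrow> int) \<Rightarrow> (nat \<Rightarrow> 'm Fvec) \<Rightarrow> 'm Fmat" where
  "transition B m E = (\<Sum>i<2*n. scal (tpow (- m i)) (rank_one J (dual_frame B i) (E i)))"

lemma transition_apply: "transition B m E *v z = comb E (\<lambda>i. tpow (- m i) * \<langle>dual_frame B i, z\<rangle>)"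
  by (simp add: transition_def matrix_sum_apply scal_apply rank_one_apply comb_def vector_smult_assoc)

lemma form_comb:
  assumes "frame E"
  shows "\<langle>comb E a, comb E b\<rangle> = (\<Sum>i<2*n. \<Sum>j<2*n. a i * b j * omega i j)"
proof -
  have "\<langle>comb E a, comb E b\<rangle> = (\<Sum>i<2*n. \<Sum>j<2*n. a i * (b j * \<langle>E i, E j\<rangle>))"
    by (simp only: comb_def form_sum_left form_scale_left form_sum_right[of "E _"] form_F_scale
        sum_distrib_left)
  then show ?thesis using assms by (simp add: frame_form mult.assoc)
qed

text \<open>Only the indices with \<open>i + j + 1 = 2 * n\<close> contribute to the form, and there
  the two powers of \<open>t\<close> cancel.\<close>

lemma transition_in_Sp_F:
  assumes "frame B" "frame E" "antisymmetric m"
  shows "transition B m E \<in> Sp_F J"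
proof -
  have "\<langle>transition B m E *v y, transition B m E *v z\<rangle> = \<langle>y, z\<rangle>" for y z
  proof -
    have "\<langle>transition B m E *v y, transition B m E *v z\<rangle> =
        (\<Sum>i<2*n. \<Sum>j<2*n. \<langle>dual_frame B i, y\<rangle> * \<langle>dual_frame B j, z\<rangle> * omega i j)"
      unfolding transition_apply form_comb[OF assms(2)]
    proof (intro sum.cong refl)
      fix i j assume ij: "i \<in> {..<2*n}" "j \<in> {..<2*n}"
      show "tpow (- m i) * \<langle>dual_frame B i, y\<rangle> * (tpow (- m j) * \<langle>dual_frame B j, z\<rangle>) * omega i j =
          \<langle>dual_frame B i, y\<rangle> * \<langle>dual_frame B j, z\<rangle> * omega i j"
      proof (cases "i + j + 1 = 2 * n")
        case True
        then have "j = 2 * n - 1 - i" by simp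
        then have "- m i + - m j = 0" using assms(3) ij by (simp add: antisymmetric_def)
        then show ?thesis
          using tpow_cancel_left[of "- m i" "- m j"] by (simp only: mult.assoc mult.left_commute)
      qed (simp add: omega_def)
    qed
    also have "\<dots> = \<langle>comb B (\<lambda>i. \<langle>dual_frame B i, y\<rangle>), comb B (\<lambda>i. \<langle>dual_frame B i, z\<rangle>)\<rangle>"
      by (simp add: form_comb[OF assms(1)])
    finally show ?thesis using frame_expansion[OF assms(1)] by simp
  qed
  then show ?thesis by (simp add: Sp_F_def)
qed

lemma transition_V_O:
  assumes "frame B" "frame E"
  shows "(*v) (transition B m E) ` V_O = lattice E m"
proof
  show "(*v) (transition B m E) ` V_O \<subseteq> lattice E m"
  proof (rule image_subsetI)
    fix z :: "'m Fvec" assume z: "z \<in> V_O"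
    have "tpow (- m i) * \<langle>dual_frame B i, z\<rangle> \<in> tO (- m i)" if "i < 2 * n" for i
    proof -
      have "\<langle>dual_frame B i, z\<rangle> \<in> tO 0"
        using assms(1) z that by (intro form_in_tO0 dual_frame_in_tV) (simp_all add: V_O_tV)
      then show ?thesis unfolding tO_tpow_mult by simp
    qed
    then show "transition B m E *v z \<in> lattice E m"
      unfolding transition_apply comb_in_lattice_iff[OF assms(2)] by blast
  qed
  show "lattice E m \<subseteq> (*v) (transition B m E) ` V_O"
  proof
    fix u assume u: "u \<in> lattice E m"
    define z where "z = comb B (\<lambda>i. tpow (m i) * \<langle>dual_frame E i, u\<rangle>)"
    have "\<langle>dual_frame E i, u\<rangle> \<in> tO (- m i)" if "i < 2 * n" for i
      using u that by (simp add: lattice_def)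
    then have "z \<in> lattice B (\<lambda>_. 0)"
      unfolding z_def comb_in_lattice_iff[OF assms(1)] tO_tpow_mult by simp
    then have "z \<in> V_O" by (simp add: lattice_0[OF assms(1)] V_O_tV)
    have c: "tpow (- m i) * (tpow (m i) * x) = x" for i x
      using tpow_mult[of "- m i" "m i"] by (simp add: mult.assoc[symmetric])
    have "transition B m E *v z = comb E (\<lambda>i. \<langle>dual_frame E i, u\<rangle>)"
      unfolding transition_apply
      unfolding comb_def[of E]
      by (intro sum.cong refl) (simp only: z_def form_dual_frame_comb[OF assms(1)] lessThan_iff c)
    also have "\<dots> = u" by (rule frame_expansion[OF assms(2), symmetric])
    finally show "u \<in> (*v) (transition B m E) ` V_O" using \<open>z \<in> V_O\<close> by blast
  qed
qed

lemma stabilizer_sp_image: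
  assumes "g \<in> Sp_F J"
  shows "stabilizer_sp J ((*v) g ` V_O) = Ad g ` sp_O J"
proof -
  have inv: "g ** matrix_inv g = mat 1" "matrix_inv g ** g = mat 1" "matrix_inv g \<in> Sp_F J"
    using Sp_F_inv[OF assms] by auto
  have Ad_apply: "Ad h X *v z = h *v (X *v (matrix_inv h *v z))" for h X z
    by (simp add: Ad_def matrix_vector_mul_assoc matrix_mul_assoc)
  have ginv: "matrix_inv g *v (g *v z) = z" "g *v (matrix_inv g *v z) = z" for z
    by (simp_all add: matrix_vector_mul_assoc inv)
  have Ad_sp: "Ad g X \<in> sp_F J" if "X \<in> sp_F J" for X
  proof -
    have "\<langle>Ad g X *v y, z\<rangle> + \<langle>y, Ad g X *v z\<rangle> = 0" for y z
    proof -
      have "\<langle>g *v (X *v (matrix_inv g *v y)), g *v (matrix_inv g *v z)\<rangle> +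
          \<langle>g *v (matrix_inv g *v y), g *v (X *v (matrix_inv g *v z))\<rangle> = 0"
        unfolding Sp_F_form[OF assms] using that by (simp add: sp_F_def)
      then show ?thesis by (simp add: Ad_apply ginv)
    qed
    then show ?thesis by (simp add: sp_F_def)
  qed
  show ?thesis
  proof
    show "Ad g ` sp_O J \<subseteq> stabilizer_sp J ((*v) g ` V_O)"
      using Ad_sp by (auto simp: sp_O_def stabilizer_sp_def End_lattice_def Ad_apply ginv V_O_mult)
    show "stabilizer_sp J ((*v) g ` V_O) \<subseteq> Ad g ` sp_O J"
    proof
      fix X assume X: "X \<in> stabilizer_sp J ((*v) g ` V_O)"
      define Y where "Y = matrix_inv g ** X ** g"
      have "X = Ad g Y"
        by (rule matrix_eqI) (simp add: Ad_apply Y_def ginv matrix_vector_mul_assoc[symmetric])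
      moreover have "\<langle>Y *v y, z\<rangle> + \<langle>y, Y *v z\<rangle> = 0" for y z
      proof -
        have "\<langle>X *v (g *v y), g *v z\<rangle> + \<langle>g *v y, X *v (g *v z)\<rangle> = 0"
          using X by (simp add: stabilizer_sp_def sp_F_def)
        then have "\<langle>g *v (Y *v y), g *v z\<rangle> + \<langle>g *v y, g *v (Y *v z)\<rangle> = 0"
          by (simp add: Y_def ginv matrix_vector_mul_assoc[symmetric])
        then show ?thesis unfolding Sp_F_form[OF assms] .
      qed
      moreover have "Y *v z \<in> V_O" if "z \<in> V_O" for z
      proof -
        have "X *v (g *v z) \<in> (*v) g ` V_O"
          using X that by (auto simp: stabilizer_sp_def End_lattice_def)
        then show ?thesis by (auto simp: Y_def ginv matrix_vector_mul_assoc[symmetric])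
      qed
      ultimately show "X \<in> Ad g ` sp_O J"
        by (auto simp: sp_O_def sp_F_def gl_O_iff_V_O)
    qed
  qed
qed

lemma self_dual_image:
  assumes "g \<in> Sp_F J"
  shows "self_dual ((*v) g ` V_O)"
proof -
  have "matrix_inv (adjoint_F J g) = g"
    using Sp_F_adjoint[OF assms] by (metis matrix_inv_cancel invertible_def matrix_mul_assoc
        matrix_mul_lid matrix_mul_rid)
  then show ?thesis
    using dual_lattice_Gr[OF J Sp_F_adjoint(3)[OF assms]] by (simp add: self_dual_def)
qed

end

section \<open>Dominant exponents: adapted frames and elementary divisors\<close>

lemma underdetermined_system:
  fixes M :: "nat \<Rightarrow> nat \<Rightarrow> 'a::field"
  shows "\<exists>\<gamma>. (\<exists>j\<le>r. \<gamma> j \<noteq> 0) \<and> (\<forall>i<r. (\<Sum>j\<le>r. \<gamma> j * M i j) = 0)"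
proof (induction r arbitrary: M)
  case 0
  show ?case by (auto intro: exI[of _ "\<lambda>_. 1"])
next
  case (Suc r)
  show ?case
  proof (cases "\<exists>i\<le>r. M i (Suc r) \<noteq> 0")
    case False
    then show ?thesis
      by (intro exI[of _ "\<lambda>j. if j = Suc r then 1 else 0"]) auto
  next
    case True
    then obtain p where p: "p \<le> r" "M p (Suc r) \<noteq> 0" by blast
    \<comment> \<open>\<open>q\<close> enumerates the rows other than the pivot row
      \<open>p\<close>, with row \<open>r\<close> in the place of \<open>p\<close>;
      \<open>M'\<close> is the system left after eliminating the last unknown.\<close>
    define q where "q = (\<lambda>i. if i = p then r else i)"
    define M' where "M' = (\<lambda>i j. M (q i) j - M (q i) (Suc r) / M p (Suc r) * M p j)"
    obtain \<gamma> where \<gamma>: "\<exists>j\<le>r. \<gamma> j \<noteq> 0" "\<forall>i<r. (\<Sum>j\<le>r. \<gamma> j * M' i j) = 0"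
      using Suc.IH[of M'] by blast
    define x where "x = - (\<Sum>j\<le>r. \<gamma> j * M p j) / M p (Suc r)"
    define \<delta> where "\<delta> = \<gamma>(Suc r := x)"
    have sum: "(\<Sum>j\<le>Suc r. \<delta> j * M i j) = (\<Sum>j\<le>r. \<gamma> j * M i j) + x * M i (Suc r)" for i
      by (simp add: \<delta>_def)
    have row_p: "(\<Sum>j\<le>Suc r. \<delta> j * M p j) = 0"
      unfolding sum using p(2) by (simp add: x_def)
    have "(\<Sum>j\<le>Suc r. \<delta> j * M (q i) j) = 0" if "i < r" for i
    proof -
      have "(\<Sum>j\<le>r. \<gamma> j * M' i j) =
          (\<Sum>j\<le>r. \<gamma> j * M (q i) j) - M (q i) (Suc r) / M p (Suc r) * (\<Sum>j\<le>r. \<gamma> j * M p j)"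
        by (simp add: M'_def right_diff_distrib sum_subtractf sum_distrib_left sum_divide_distrib mult_ac)
      then show ?thesis
        unfolding sum using \<gamma>(2) that p(2) by (simp add: x_def)
    qed
    moreover have "i = p \<or> (\<exists>i'<r. i = q i')" if "i < Suc r" for i
    proof (cases "i = r")
      case True
      then show ?thesis using p(1) by (cases "p = r") (auto simp: q_def intro!: exI[of _ p])
    next
      case False
      then show ?thesis using that by (auto simp: q_def intro!: exI[of _ i])
    qed
    ultimately have "\<forall>i<Suc r. (\<Sum>j\<le>Suc r. \<delta> j * M i j) = 0"
      using row_p by blast
    moreover obtain j where "j \<le> r" "\<gamma> j \<noteq> 0" using \<gamma>(1) by blast
    then have "\<exists>j\<le>Suc r. \<delta> j \<noteq> 0" by (intro exI[of _ j]) (simp add: \<delta>_def)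
    ultimately show ?thesis by blast
  qed
qed

lemma fls_const_sum: "fls_const (\<Sum>i\<in>S. h i) = (\<Sum>i\<in>S. fls_const (h i))"
  for h :: "'i \<Rightarrow> complex"
  by (induction S rule: infinite_finite_induct) (simp_all add: fls_plus_const[symmetric])

context symplectic_space
begin

definition dominant :: "(nat \<Rightarrow> int) \<Rightarrow> bool" where
  "dominant m \<longleftrightarrow> (\<forall>j<2*n. \<forall>i\<le>j. m j \<le> m i)"

text \<open>The first half of the indices suffices, since the reflection reverses both the order of
  the indices and the sign of the values.\<close>

lemma dominantI:
  assumes "antisymmetric m" "\<And>i. i < n \<Longrightarrow> 0 \<le> m i" "\<And>i j. i \<le> j \<Longrightarrow> j < n \<Longrightarrow> m j \<le> m i"
  shows "dominant m"
  unfolding dominant_def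
proof (intro allI impI)
  fix i j assume ij: "j < 2 * n" "i \<le> j"
  have refl: "m k = - m (2 * n - 1 - k)" if "k < 2 * n" for k
    using assms(1) that by (simp add: antisymmetric_def)
  consider "j < n" | "i < n" "n \<le> j" | "n \<le> i" using ij by linarith
  then show "m j \<le> m i"
  proof cases
    case 2
    then have "2 * n - 1 - j < n" by linarith
    then show ?thesis using 2 refl[of j] assms(2)[of i] assms(2)[of "2 * n - 1 - j"] ij by simp
  next
    case 3
    then show ?thesis
      using refl[of i] refl[of j] assms(3)[of "2 * n - 1 - j" "2 * n - 1 - i"] ij by simp
  qed (use assms(3) ij in auto)
qed

text \<open>The adapted pairs become a frame when the \<open>f i\<close> are listed in reverse
  order. The rescaled frame vectors lie in \<open>L\<close>, which gives one inclusion; their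
  pairings with \<open>L\<close> are integral, which bounds coordinates and gives the other.\<close>

lemma ex_adapted_frame:
  assumes L: "self_dual L" "L \<subseteq> tV (- K)"
  shows "\<exists>E m. frame E \<and> antisymmetric m \<and> dominant m \<and> (\<forall>i<n. 0 \<le> m i \<and> m i \<le> K) \<and> L = lattice E m"
proof -
  obtain e f \<mu> where h: "hyperbolic n e f" "adapted n e f \<mu> L" "\<forall>i<n. 0 \<le> \<mu> i"
      "\<forall>j<n. \<forall>i\<le>j. \<mu> j \<le> \<mu> i"
    using ex_adapted_pairs[OF L, of n] by auto
  define E where "E = (\<lambda>i. if i < n then e i else f (2 * n - 1 - i))"
  define m where "m = (\<lambda>i. if i < n then \<mu> i else - \<mu> (2 * n - 1 - i))"
  have E: "frame E" unfolding E_def by (rule frame_hyperbolic[OF h(1)])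
  have anti: "antisymmetric m" by (auto simp: antisymmetric_def m_def)
  have "dominant m" using anti h(3,4) by (intro dominantI) (auto simp: m_def)
  have tE: "tpow (- m i) *s E i \<in> L" if "i < 2 * n" for i
    using h(2) that by (auto simp: adapted_def E_def m_def)
  \<comment> \<open>\<open>E i\<close> is primitive, so its multiple
    \<open>tpow (- m i) *s E i\<close> in \<open>L\<close> has a pole of order
    \<open>m i\<close>.\<close>
  have "m i \<le> K" if "i < n" for i
  proof (rule ccontr)
    assume c: "\<not> m i \<le> K"
    have "tpow (- m i) *s E i \<in> tV (- K)" using tE[of i] L(2) that by auto
    then have "E i \<in> tV (- K - - m i)" by (simp only: tV_tpow)
    then have "E i \<in> tV 1" by (rule tV_mono) (use c in simp)
    then have "\<langle>dual_frame E i, E i\<rangle> \<in> tO 1"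
      using form_in_tO[OF dual_frame_in_tV[OF E], of i "E i" 1] that by simp
    then show False using dual_frame_form(1)[OF E, of i i] that by simp
  qed
  moreover have "L = lattice E m"
  proof
    show "lattice E m \<subseteq> L"
    proof
      fix u assume u: "u \<in> lattice E m"
      have "\<langle>dual_frame E i, u\<rangle> *s E i \<in> L" if "i < 2 * n" for i
      proof -
        have "\<langle>dual_frame E i, u\<rangle> \<in> tO (- m i)" using u that by (simp add: lattice_def)
        then have "tpow (m i) * \<langle>dual_frame E i, u\<rangle> \<in> tO 0" unfolding tO_tpow_mult by simp
        then have "(tpow (m i) * \<langle>dual_frame E i, u\<rangle>) *s (tpow (- m i) *s E i) \<in> L"
          by (rule self_dual_scale[OF L(1) _ tE[OF that]])
        moreover have "tpow (m i) * \<langle>dual_frame E i, u\<rangle> * tpow (- m i) = \<langle>dual_frame E i, u\<rangle>"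
          by (subst mult.commute) (rule tpow_cancel_left, simp)
        ultimately show ?thesis by (simp only: vector_smult_assoc)
      qed
      then have "comb E (\<lambda>i. \<langle>dual_frame E i, u\<rangle>) \<in> L"
        unfolding comb_def by (intro self_dual_sum[OF L(1)]) auto
      then show "u \<in> L" using frame_expansion[OF E, of u] by simp
    qed
    show "L \<subseteq> lattice E m"
    proof
      fix u assume u: "u \<in> L"
      have "\<langle>dual_frame E i, u\<rangle> \<in> tO (- m i)" if i: "i < 2 * n" for i
      proof -
        have "- m (2 * n - 1 - i) = m i" using anti i by (simp add: antisymmetric_def)
        then have "tpow (m i) *s E (2 * n - 1 - i) \<in> L" using tE[of "2 * n - 1 - i"] i by auto
        then have "\<langle>tpow (m i) *s E (2 * n - 1 - i), u\<rangle> \<in> tO 0"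
          by (rule self_dual_form[OF L(1) _ u])
        then have "\<langle>E (2 * n - 1 - i), u\<rangle> \<in> tO (- m i)"
          unfolding form_scale_left tO_tpow_mult by simp
        then show ?thesis by (simp add: dual_frame_def form_uminus_left)
      qed
      then show "u \<in> lattice E m" by (simp add: lattice_def)
    qed
  qed
  ultimately show ?thesis
    using E anti \<open>dominant m\<close> h(3) by (intro exI[of _ E] exI[of _ m]) (auto simp: m_def)
qed

text \<open>If \<open>m r > m' r\<close>, then modulo \<open>t\<close> the first \<open>r + 1\<close> of the \<open>b\<close> lie in the span of the first \<open>r\<close> of the \<open>b'\<close>.\<close>

lemma elementary_divisors_le:
  fixes b b' :: "nat \<Rightarrow> 'm Fvec"
  assumes indep: "\<And>\<gamma>. (\<Sum>j<2*n. fls_const (\<gamma> j) *s b j) \<in> tV 1 \<Longrightarrow> \<forall>j<2*n. \<gamma> j = 0"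
    and b': "\<And>i. i < 2 * n \<Longrightarrow> b' i \<in> tV 0"
    and A: "\<And>j. j < 2 * n \<Longrightarrow> b j = (\<Sum>i<2*n. A i j *s b' i)"
    and A0: "\<And>i j. i < 2 * n \<Longrightarrow> j < 2 * n \<Longrightarrow> A i j \<in> tO 0 \<and> A i j \<in> tO (m j - m' i)"
    and dom: "dominant m" "dominant m'" and r: "r < 2 * n"
  shows "m r \<le> m' r"
proof (rule ccontr)
  assume c: "\<not> m r \<le> m' r"
  obtain \<gamma> where \<gamma>: "\<exists>j\<le>r. \<gamma> j \<noteq> 0" "\<forall>i<r. (\<Sum>j\<le>r. \<gamma> j * fls_nth (A i j) 0) = 0"
    using underdetermined_system[of r "\<lambda>i j. fls_nth (A i j) 0"] by blast
  \<comment> \<open>With \<open>\<gamma>\<close> extended by zero, the combination of the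
    \<open>b j\<close> has all its \<open>b'\<close>-coordinates in \<open>tO 1\<close>: those
    before \<open>r\<close> by the choice of \<open>\<gamma>\<close>, the others because
    \<open>m j - m' i\<close> is positive for \<open>j \<le> r \<le> i\<close>.\<close>
  define \<delta> where "\<delta> = (\<lambda>j. if j \<le> r then \<gamma> j else 0)"
  have sum\<delta>: "(\<Sum>j<2*n. fls_const (\<delta> j) * A i j) = (\<Sum>j\<le>r. fls_const (\<gamma> j) * A i j)" for i
    using r by (intro sum.mono_neutral_cong_right) (auto simp: \<delta>_def)
  have coeff: "(\<Sum>j<2*n. fls_const (\<delta> j) * A i j) \<in> tO 1" if i: "i < 2 * n" for i
  proof (cases "i < r")
    case True
    have "(\<Sum>j\<le>r. fls_const (\<gamma> j) * A i j) \<in> tO 0"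
      using A0 i r by (intro tO_sum tO_mult) auto
    moreover have "fls_nth (\<Sum>j\<le>r. fls_const (\<gamma> j) * A i j) 0 = 0"
      using \<gamma>(2) True by (simp add: fls_nth_sum)
    ultimately show ?thesis unfolding sum\<delta> using tO_0_Suc[of _ 0] by simp
  next
    case False
    have "A i j \<in> tO 1" if "j \<le> r" for j
    proof -
      have "m r \<le> m j" "m' i \<le> m' r" using dom that False i r by (auto simp: dominant_def)
      then have "1 \<le> m j - m' i" using c by linarith
      then show ?thesis using A0[OF i, of j] that r by (auto intro: tO_mono)
    qed
    then show ?thesis unfolding sum\<delta> by (intro tO_sum tO_mult0) auto
  qed
  have "(\<Sum>j<2*n. fls_const (\<delta> j) *s b j) = (\<Sum>j<2*n. \<Sum>i<2*n. (fls_const (\<delta> j) * A i j) *s b' i)"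
    by (intro sum.cong refl) (simp add: A vec.scale_sum_right vector_smult_assoc)
  also have "\<dots> = (\<Sum>i<2*n. (\<Sum>j<2*n. fls_const (\<delta> j) * A i j) *s b' i)"
    unfolding vec.scale_sum_left by (rule sum.swap)
  also have "\<dots> \<in> tV 1"
    using tV_scale[OF coeff b'] by (intro tV_sum) simp
  finally have "\<forall>j<2*n. \<delta> j = 0" by (rule indep)
  moreover obtain j where "j \<le> r" "\<gamma> j \<noteq> 0" using \<gamma>(1) by blast
  ultimately show False using r by (auto simp: \<delta>_def dest: spec[of _ j])
qed

lemma lattice_eqI_stabilizer:
  assumes "self_dual L" "self_dual L'" "stabilizer_sp J L = stabilizer_sp J L'"
  shows "L = L'"
proof -
  text \<open>The square of a vector \<open>v\<close> of \<open>L\<close> stabilizes \<open>L'\<close>, so \<open>\<langle>v, w\<rangle>\<^sup>2\<close> is integral for \<open>w\<close> in \<open>L'\<close>.\<close>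
  have "L1 \<subseteq> L2" if sd: "self_dual L1" "self_dual L2" and st: "stabilizer_sp J L1 \<subseteq> stabilizer_sp J L2"
    for L1 L2
  proof
    fix v assume v: "v \<in> L1"
    have "rank_one J v v \<in> sp_F J"
      using form_skew[of _ v] by (simp add: sp_F_def rank_one_apply form_scale_left form_F_scale)
    moreover have "rank_one J v v \<in> End_lattice L1"
      using v sd(1) by (simp add: End_lattice_def rank_one_apply self_dual_scale self_dual_form)
    ultimately have R: "rank_one J v v \<in> End_lattice L2" using st by (auto simp: stabilizer_sp_def)
    have "\<langle>v, w\<rangle> \<in> tO 0" if w: "w \<in> L2" for w
    proof -
      have "\<langle>v, w\<rangle> *s v \<in> L2" using R w by (simp add: End_lattice_def rank_one_apply)
      then have "\<langle>\<langle>v, w\<rangle> *s v, w\<rangle> \<in> tO 0" by (rule self_dual_form[OF sd(2) _ w])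
      then show ?thesis using square_in_tO[of "\<langle>v, w\<rangle>" 0] by (simp add: form_scale_left)
    qed
    then show "v \<in> L2" using self_dual_mem_iff[OF sd(2)] by blast
  qed
  then show ?thesis using assms by blast
qed

section \<open>Stratification of the zero fibre\<close>

text \<open>
  \<open>a\<close> and \<open>c\<close> are the coordinates of \<open>v\<close> and \<open>x\<close> in a frame adapted to \<open>L\<close>; the condition on \<open>a\<close> says that
  \<open>v\<close> lies in the self-dual lattice with the exponents \<open>l\<close>, which is between \<open>V_O \<inter> L\<close> and \<open>V_O + L\<close>.
\<close>

definition admissible ::
    "(nat \<Rightarrow> int) \<Rightarrow> (nat \<Rightarrow> int) \<Rightarrow> (nat \<Rightarrow> complex fls) \<Rightarrow> (nat \<Rightarrow> nat \<Rightarrow> complex fls) \<Rightarrow> bool" where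
  "admissible l m a c \<longleftrightarrow> (\<forall>i<2*n. a i \<in> tO (- l i)) \<and>
     (\<forall>i<2*n. \<forall>j<2*n. c i j = c j i \<and> c i j \<in> tO (1 - m i - m j) \<and> fls_X * a i * a j + c i j \<in> tO 1)"

definition stratum :: "(nat \<Rightarrow> int) \<Rightarrow> (nat \<Rightarrow> int) \<Rightarrow> ('m Fvec \<times> 'm Fmat set \<times> 'm Fmat) set" where
  "stratum l m = {(comb E a, stabilizer_sp J (lattice E m), endo E c) | E a c. frame E \<and> admissible l m a c}"

lemma moment_map_eq_iff:
  "moment_map J (v, p, x) = scal fls_X ` sp_O J \<longleftrightarrow> S2 J v + x \<in> scal fls_X ` sp_O J"
proof -
  have sp: "0 \<in> sp_O J" "\<And>A B. A \<in> sp_O J \<Longrightarrow> B \<in> sp_O J \<Longrightarrow> A + B \<in> sp_O J"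
    "\<And>A. A \<in> sp_O J \<Longrightarrow> - A \<in> sp_O J"
    by (auto simp: sp_O_def sp_F_def gl_O_def matrix_vector_mult_add_rdistrib matrix_uminus_apply
        form_add_left form_F_add form_uminus_left form_uminus_right tO_add algebra_simps
        add_eq_0_iff)
  let ?T = "scal fls_X ` sp_O J"
  have s: "scal fls_X A + scal fls_X B = scal fls_X (A + B)" "- scal fls_X A = scal fls_X (- A)"
    "scal fls_X 0 = 0" for A B :: "'m Fmat"
    by (simp_all add: vec_eq_iff algebra_simps)
  have T: "0 \<in> ?T" "\<And>A B. A \<in> ?T \<Longrightarrow> B \<in> ?T \<Longrightarrow> A + B \<in> ?T" "\<And>A. A \<in> ?T \<Longrightarrow> - A \<in> ?T"
    using sp s by (metis image_eqI) (use sp s in \<open>auto intro!: imageI\<close>)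
  define W where "W = S2 J v + x"
  have "{W + Z | Z. Z \<in> ?T} = ?T \<longleftrightarrow> W \<in> ?T"
  proof
    assume "{W + Z | Z. Z \<in> ?T} = ?T"
    moreover have "W + 0 \<in> {W + Z | Z. Z \<in> ?T}" using T(1) by blast
    ultimately show "W \<in> ?T" by simp
  next
    assume W: "W \<in> ?T"
    have "Z \<in> {W + Z | Z. Z \<in> ?T}" if "Z \<in> ?T" for Z
    proof -
      have "- W + Z \<in> ?T" using T W that by blast
      moreover have "Z = W + (- W + Z)" by simp
      ultimately show ?thesis by blast
    qed
    then show "{W + Z | Z. Z \<in> ?T} = ?T" using T(2)[OF W] by blast
  qed
  then show ?thesis by (simp add: moment_map_def W_def)
qed

lemma lattice_Sp_image: "frame E \<Longrightarrow> antisymmetric m \<Longrightarrow> \<exists>g\<in>Sp_F J. lattice E m = (*v) g ` V_O"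
  using transition_in_Sp_F[of E E m] transition_V_O[of E E m] by blast

lemma self_dual_lattice: "frame E \<Longrightarrow> antisymmetric m \<Longrightarrow> self_dual (lattice E m)"
  using lattice_Sp_image[of E m] self_dual_image by auto

lemma stabilizer_lattice_in_Gr: "frame E \<Longrightarrow> antisymmetric m \<Longrightarrow> stabilizer_sp J (lattice E m) \<in> Gr_Sp J"
  using lattice_Sp_image[of E m] stabilizer_sp_image by (auto simp: Gr_Sp_def)

lemma mu_zero_iff:
  assumes "frame E" "antisymmetric m"
  shows "(comb E a, stabilizer_sp J (lattice E m), endo E c) \<in> mu_zero J \<longleftrightarrow>
    (\<forall>i<2*n. \<forall>j<2*n. c i j = c j i \<and> c i j \<in> tO (1 - m i - m j) \<and> fls_X * a i * a j + c i j \<in> tO 1)"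
  using stabilizer_lattice_in_Gr[OF assms]
  unfolding mu_zero_def cotangent_Sp_def mem_Collect_eq moment_map_eq_iff S2_comb[OF assms(1)] endo_add
    endo_in_t_sp_O_iff[OF assms(1)] case_prod_conv endo_in_nil_radical_iff[OF assms]
  by (auto simp: mult_ac)

lemma stratum_subset_mu_zero: "antisymmetric m \<Longrightarrow> stratum l m \<subseteq> mu_zero J"
  by (auto simp: stratum_def mu_zero_iff admissible_def)


text \<open>\<open>A\<close> stands for the pole orders of the coordinates of \<open>v\<close>. On
  the first half of the indices \<open>l\<close> is the smallest nonnegative function dominating
  \<open>A\<close> for which \<open>l\<close> and \<open>m - l\<close> both decrease. Being
  smallest, it leaves room for the reflected bounds on the second half, where the hypothesis on sums
  enters.\<close>

lemma ex_exponents: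
  fixes m A :: "nat \<Rightarrow> int"
  assumes m: "antisymmetric m" "dominant m" "\<And>i. i < n \<Longrightarrow> 0 \<le> m i"
    and S: "S \<subseteq> {..<2*n}"
    and A: "\<And>i j. i \<in> S \<Longrightarrow> j \<in> S \<Longrightarrow> A i + A j \<le> max 0 (m i + m j)"
  shows "\<exists>l. antisymmetric l \<and> (\<forall>i<n. 0 \<le> l i \<and> l i \<le> m i) \<and>
     (\<forall>j<n. \<forall>i\<le>j. l j \<le> l i \<and> m j - l j \<le> m i - l i) \<and> (\<forall>i\<in>S. A i \<le> l i)"
proof -
  define T where "T = S \<inter> {..<n}"
  \<comment> \<open>A pole order \<open>A k\<close> at \<open>k\<close> forces at least
    \<open>A k\<close> at all earlier indices if \<open>l\<close> decreases, and at least
    \<open>A k - (m k - m i)\<close> at later \<open>i\<close> if \<open>m - l\<close> decreases.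
    \<open>h\<close> is the maximum of 0 and these constraints.\<close>
  define h where "h = (\<lambda>i. Max (insert 0 ((\<lambda>k. A k - max 0 (m k - m i)) ` T)))"
  have fin: "finite (insert 0 ((\<lambda>k. A k - max 0 (m k - m i)) ` T))" for i
    by (simp add: T_def)
  have hI: "h i \<le> x" if "0 \<le> x" "\<And>k. k \<in> T \<Longrightarrow> A k - max 0 (m k - m i) \<le> x" for i x
    unfolding h_def using that by (subst Max_le_iff[OF fin]) auto
  have h0: "0 \<le> h i" for i
    unfolding h_def by (intro Max_ge[OF fin]) simp
  have hk: "A k - max 0 (m k - m i) \<le> h i" if "k \<in> T" for i k
    unfolding h_def using that by (intro Max_ge[OF fin]) auto
  have T: "k < n" "k \<in> S" "A k \<le> m k" if "k \<in> T" for k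
    using that A[of k k] m(3)[of k] by (auto simp: T_def)
  have mono: "m j \<le> m i" if "i \<le> j" "j < n" for i j
    using m(2) that by (simp add: dominant_def)
  have le_m: "h i \<le> m i" if "i < n" for i
    using m(3)[OF that] T(3) by (intro hI) force+
  have anti: "h j \<le> h i" if "i \<le> j" "j < n" for i j
  proof (rule hI[OF h0])
    fix k assume "k \<in> T"
    then show "A k - max 0 (m k - m j) \<le> h i" using hk[of k i] mono[OF that] by linarith
  qed
  have lip: "h i \<le> h j + (m i - m j)" if "i \<le> j" "j < n" for i j
  proof (rule hI)
    show "0 \<le> h j + (m i - m j)" using h0[of j] mono[OF that] by simp
    fix k assume "k \<in> T"
    then show "A k - max 0 (m k - m i) \<le> h j + (m i - m j)"
      using hk[of k j] mono[OF that] by linarith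
  qed
  define l where "l = (\<lambda>i. if i < n then h i else - h (2 * n - 1 - i))"
  have "antisymmetric l" by (auto simp: antisymmetric_def l_def)
  moreover have "\<forall>i<n. 0 \<le> l i \<and> l i \<le> m i" using h0 le_m by (simp add: l_def)
  moreover have "\<forall>j<n. \<forall>i\<le>j. l j \<le> l i \<and> m j - l j \<le> m i - l i"
  proof (intro allI impI)
    fix j i assume "j < n" "i \<le> j"
    then show "l j \<le> l i \<and> m j - l j \<le> m i - l i"
      using anti[of i j] lip[of i j] by (simp add: l_def)
  qed
  moreover have "A i \<le> l i" if i: "i \<in> S" for i
  proof (cases "i < n")
    case True
    then show ?thesis using hk[of i i] i by (simp add: l_def T_def)
  next
    case False
    have i2: "i < 2 * n" using i S by auto
    then have lt: "2 * n - 1 - i < n" using False by simp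
    have mi: "m (2 * n - 1 - i) = - m i" using m(1) i2 by (simp add: antisymmetric_def)
    \<comment> \<open>After \<open>m\<close> changes sign under the reflection, each constraint
      defining \<open>h\<close> here is an instance of the hypothesis on sums; the constraint 0
      comes from the pair \<open>i\<close>, \<open>i\<close>.\<close>
    have "h (2 * n - 1 - i) \<le> - A i"
    proof (rule hI)
      show "0 \<le> - A i" using A[OF i i] m(3)[OF lt] mi by simp
      fix k assume "k \<in> T"
      then show "A k - max 0 (m k - m (2 * n - 1 - i)) \<le> - A i"
        using A[of k i] T[of k] i mi by simp
    qed
    then show ?thesis using False by (simp add: l_def)
  qed
  ultimately show ?thesis by blast
qed

section \<open>Self-dual signatures of pairs of partitions\<close>

definition sig :: "nat list \<Rightarrow> nat \<Rightarrow> int" where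
  "sig \<theta> i = self_dual_signature \<theta> ! i"

lemma sig_eq:
  assumes "is_partition n \<theta>" "i < 2 * n"
  shows "sig \<theta> i = (if i < n then int (\<theta> ! i) else - int (\<theta> ! (2 * n - 1 - i)))"
proof -
  have "n - Suc (i - n) = 2 * n - 1 - i" if "n \<le> i" using that assms(2) by simp
  then show ?thesis
    using assms by (auto simp: sig_def self_dual_signature_def is_partition_def nth_append rev_nth)
qed

lemma sig_antisymmetric:
  assumes "is_partition n \<theta>"
  shows "antisymmetric (sig \<theta>)"
  unfolding antisymmetric_def using sig_eq[OF assms] by auto

lemma sig_nonneg: "is_partition n \<theta> \<Longrightarrow> i < n \<Longrightarrow> 0 \<le> sig \<theta> i"
  by (simp add: sig_eq)

lemma sig_dominant:
  assumes "is_partition n \<theta>"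
  shows "dominant (sig \<theta>)"
proof (rule dominantI[OF sig_antisymmetric[OF assms] sig_nonneg[OF assms]])
  fix i j assume "i \<le> j" "j < n"
  then show "sig \<theta> j \<le> sig \<theta> i"
    using assms by (cases "i = j") (auto simp: sig_eq is_partition_def sorted_wrt_iff_nth_less)
qed

lemma antisymmetric_add: "antisymmetric l \<Longrightarrow> antisymmetric z \<Longrightarrow> antisymmetric (\<lambda>i. l i + z i)"
  by (simp add: antisymmetric_def)

lemma dominant_add: "dominant l \<Longrightarrow> dominant z \<Longrightarrow> dominant (\<lambda>i. l i + z i)"
  by (simp add: dominant_def add_mono)

text \<open>For \<open>i \<le> j\<close> the decrease of \<open>z\<close> bounds by the second
  argument of the maximum, otherwise the decrease of \<open>l\<close> bounds by 0. In effect an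
  integral change of basis that preserves the lattice with exponents \<open>l + z\<close> also
  preserves the one with exponents \<open>l\<close>.\<close>

lemma bisignature_bound:
  assumes "dominant l" "dominant z" "i < 2 * n" "j < 2 * n"
  shows "l i - l j \<le> max 0 ((l i + z i) - (l j + z j))"
proof (cases "i \<le> j")
  case True
  then have "z j \<le> z i" using assms(2,4) by (simp add: dominant_def)
  then show ?thesis by simp
next
  case False
  then have "l i \<le> l j" using assms(1,3) by (simp add: dominant_def)
  then show ?thesis by simp
qed

text \<open>The bound for differences at the reflected index. It is what allows the entries of
  \<open>x\<close> to absorb the quadratic terms in \<open>v\<close>.\<close>

lemma bisignature_bound_sum:
  assumes "antisymmetric l" "antisymmetric z" "dominant l" "dominant z" "i < 2 * n" "j < 2 * n"
  shows "l i + l j \<le> max 0 ((l i + z i) + (l j + z j))"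
  using bisignature_bound[OF assms(3,4,5), of "2 * n - 1 - j"] assms(1,2,6)
  by (simp add: antisymmetric_def)

lemma ex_partition:
  assumes "antisymmetric l" "\<And>i. i < n \<Longrightarrow> 0 \<le> l i \<and> l i \<le> int k"
    "\<And>i j. i \<le> j \<Longrightarrow> j < n \<Longrightarrow> l j \<le> l i"
  shows "\<exists>\<theta>. is_partition n \<theta> \<and> set \<theta> \<subseteq> {..k} \<and> (\<forall>i<2*n. sig \<theta> i = l i)"
proof (intro exI conjI allI impI)
  let ?\<theta> = "map (\<lambda>i. nat (l i)) [0..<n]"
  show p: "is_partition n ?\<theta>"
    using assms(2,3) by (auto simp: is_partition_def sorted_wrt_iff_nth_less intro!: nat_mono)
  show "set ?\<theta> \<subseteq> {..k}" using assms(2) by (auto simp: nat_le_iff)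
  fix i assume i: "i < 2 * n"
  show "sig ?\<theta> i = l i"
  proof (cases "i < n")
    case True
    then show ?thesis using sig_eq[OF p i] assms(2)[of i] by simp
  next
    case False
    then have "2 * n - 1 - i < n" using i by linarith
    moreover have "l (2 * n - 1 - i) = - l i" using assms(1) i by (simp add: antisymmetric_def)
    ultimately show ?thesis using sig_eq[OF p i] assms(2)[of "2 * n - 1 - i"] False by simp
  qed
qed

lemma Sp_F_image_in_tV_iff:
  "(*v) g ` V_O \<subseteq> tV (- K) \<longleftrightarrow> (\<forall>i j. g $ i $ j \<in> tO (- K))" for g :: "'m Fmat"
proof
  assume *: "(*v) g ` V_O \<subseteq> tV (- K)"
  show "\<forall>i j. g $ i $ j \<in> tO (- K)"
  proof (intro allI)
    fix i j
    have "g *v axis j 1 \<in> tV (- K)" using * axis_in_V_O[of j] by (auto simp: V_O_tV)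
    then show "g $ i $ j \<in> tO (- K)"
      by (auto simp: tV_def matrix_vector_mult_def axis_def if_distrib cong: if_cong)
  qed
next
  assume *: "\<forall>i j. g $ i $ j \<in> tO (- K)"
  show "(*v) g ` V_O \<subseteq> tV (- K)"
  proof (rule image_subsetI)
    fix z :: "'m Fvec" assume "z \<in> V_O"
    then have "g $ i $ j * z $ j \<in> tO (- K)" for i j
      using tO_mult_add[of "g $ i $ j" "- K" "z $ j" 0] * by (simp add: V_O_def)
    then show "g *v z \<in> tV (- K)" by (auto simp: tV_def matrix_vector_mult_def intro!: tO_sum)
  qed
qed

lemma mem_bounded_piece_entries:
  "(v, g, x) \<in> bounded_piece entries k \<longleftrightarrow>
    (\<forall>i. v $ i \<in> tO (- int k)) \<and> (\<forall>i j. g $ i $ j \<in> tO (- int k)) \<and> (\<forall>i j. x $ i $ j \<in> tO (- int k))"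
  for v :: "'m Fvec"
proof -
  have *: "entries = range (\<lambda>i (v :: 'm Fvec, g :: 'm Fmat, x :: 'm Fmat). v $ i) \<union>
      range (\<lambda>(i, j) (v, g, x). g $ i $ j) \<union> range (\<lambda>(i, j) (v, g, x). x $ i $ j)"
    by (auto simp: entries_def image_iff)
  show ?thesis
    unfolding bounded_piece_def * ball_Un by (simp add: split_paired_All)
qed

lemma mu_zero_stage_covered:
  assumes "q \<in> mu_zero J" "q \<in> stage J k"
  shows "\<exists>\<theta> \<zeta>. is_partition n \<theta> \<and> is_partition n \<zeta> \<and> set \<theta> \<subseteq> {..k} \<and> set \<zeta> \<subseteq> {..k} \<and>
    q \<in> stratum (sig \<theta>) (\<lambda>i. sig \<theta> i + sig \<zeta> i)"
proof -
  obtain v g x where gx: "q = (v, Ad g ` sp_O J, x)" "(v, g, x) \<in> cover J" "(v, g, x) \<in> bounded_piece entries k"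
    using assms(2) by (auto simp: stage_def cover_proj_def)
  define L where "L = (*v) g ` V_O"
  have g: "g \<in> Sp_F J" using gx(2) by (simp add: cover_def)
  have q: "q = (v, stabilizer_sp J L, x)"
    using gx(1) stabilizer_sp_image[OF g] by (simp add: L_def)
  have "self_dual L" unfolding L_def by (rule self_dual_image[OF g])
  moreover have "L \<subseteq> tV (- int k)"
    using gx(3) unfolding L_def mem_bounded_piece_entries Sp_F_image_in_tV_iff by blast
  ultimately obtain E m where E: "frame E" and m: "antisymmetric m" "dominant m"
      "\<forall>i<n. 0 \<le> m i \<and> m i \<le> int k" and L: "L = lattice E m"
    using ex_adapted_frame by blast
  define a where "a = (\<lambda>i. \<langle>dual_frame E i, v\<rangle>)"
  define c where "c = (\<lambda>i j. - \<langle>dual_frame E j, x *v dual_frame E i\<rangle>)"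
  have v: "v = comb E a" unfolding a_def by (rule frame_expansion[OF E])
  have x: "x = endo E c" unfolding c_def by (rule endo_expansion[OF E])
  have c: "\<forall>i<2*n. \<forall>j<2*n. c i j = c j i \<and> c i j \<in> tO (1 - m i - m j) \<and> fls_X * a i * a j + c i j \<in> tO 1"
    using assms(1) mu_zero_iff[OF E m(1)] unfolding q L v x by blast
  \<comment> \<open>Pole orders of the coordinates. A zero coordinate has subdegree 0 by convention
    and imposes no condition, hence the restriction to \<open>S\<close>.\<close>
  define A where "A = (\<lambda>i. - fls_subdegree (a i))"
  define S where "S = {i. i < 2 * n \<and> a i \<noteq> 0}"
  have "A i + A j \<le> max 0 (m i + m j)" if "i \<in> S" "j \<in> S" for i j
  proof -
    have ij: "i < 2 * n" "j < 2 * n" "a i \<noteq> 0" "a j \<noteq> 0" using that by (auto simp: S_def)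
    \<comment> \<open>The smaller of the exponents in the bounds for the sum and for
      \<open>c i j\<close>, hence a bound for their difference, which is the quadratic term.\<close>
    let ?N = "1 - max 0 (m i + m j)"
    have "fls_X * a i * a j + c i j \<in> tO 1" "c i j \<in> tO (1 - m i - m j)"
      using c ij by blast+
    then have "fls_X * a i * a j + c i j \<in> tO ?N" "c i j \<in> tO ?N"
      by (auto elim!: tO_mono)
    then have "(fls_X * a i * a j + c i j) - c i j \<in> tO ?N" by (rule tO_diff)
    then have "fls_X * (a i * a j) \<in> tO ?N" by (simp add: mult.assoc)
    then have "a i * a j \<in> tO (?N - 1)" by (simp only: tO_X_mult)
    then have "?N - 1 \<le> fls_subdegree (a i * a j)"
      using ij by (intro fls_subdegree_geI) (auto simp: tO_def)
    then show ?thesis using ij by (simp add: A_def)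
  qed
  moreover have "S \<subseteq> {..<2*n}" by (auto simp: S_def)
  ultimately obtain l where l: "antisymmetric l" "\<forall>i<n. 0 \<le> l i \<and> l i \<le> m i"
     "\<forall>j<n. \<forall>i\<le>j. l j \<le> l i \<and> m j - l j \<le> m i - l i" "\<forall>i\<in>S. A i \<le> l i"
    using ex_exponents[OF m(1,2), of S A] m(3) by blast
  \<comment> \<open>Both \<open>l\<close> and \<open>m - l\<close> lie between 0 and
    \<open>m\<close>, hence are at most \<open>k\<close> on the first half. This bound on the parts
    leaves finitely many pairs of partitions for one stage.\<close>
  have "\<exists>\<theta>. is_partition n \<theta> \<and> set \<theta> \<subseteq> {..k} \<and> (\<forall>i<2*n. sig \<theta> i = l i)"
    using l(1,2,3) m(3) by (intro ex_partition) force+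
  then obtain \<theta> where \<theta>: "is_partition n \<theta>" "set \<theta> \<subseteq> {..k}" "\<forall>i<2*n. sig \<theta> i = l i" by blast
  have "\<exists>\<zeta>. is_partition n \<zeta> \<and> set \<zeta> \<subseteq> {..k} \<and> (\<forall>i<2*n. sig \<zeta> i = m i - l i)"
    using l(1,2,3) m(1,3) by (intro ex_partition) (force simp: antisymmetric_def)+
  then obtain \<zeta> where \<zeta>: "is_partition n \<zeta>" "set \<zeta> \<subseteq> {..k}" "\<forall>i<2*n. sig \<zeta> i = m i - l i" by blast
  let ?m = "\<lambda>i. sig \<theta> i + sig \<zeta> i"
  have m': "?m i = m i" if "i < 2 * n" for i using \<theta>(3) \<zeta>(3) that by simp
  have "a i \<in> tO (- sig \<theta> i)" if "i < 2 * n" for i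
  proof (cases "a i = 0")
    case False
    then have "- sig \<theta> i \<le> fls_subdegree (a i)"
      using l(4) \<theta>(3) that by (auto simp: S_def A_def)
    then show ?thesis by (auto simp: tO_def)
  qed simp
  then have "admissible (sig \<theta>) ?m a c"
    using c m' unfolding admissible_def by simp
  moreover have "lattice E ?m = L"
    unfolding L lattice_def by (simp add: m')
  ultimately have "q \<in> stratum (sig \<theta>) ?m"
    unfolding stratum_def q v x using E by blast
  then show ?thesis using \<theta>(1,2) \<zeta>(1,2) by blast
qed

section \<open>Fixed points of the conormal bundles\<close>

lemma sp_F_iff_adjoint: "X \<in> sp_F J \<longleftrightarrow> - adjoint_F J X = X"
proof
  assume X: "X \<in> sp_F J"
  show "- adjoint_F J X = X"
  proof (rule matrix_eqI)
    fix z
    have "\<langle>y, adjoint_F J X *v z + X *v z\<rangle> = \<langle>X *v y, z\<rangle> + \<langle>y, X *v z\<rangle>" for y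
      by (simp add: form_F_add form_F_adjoint[OF J])
    then have "\<langle>y, adjoint_F J X *v z + X *v z\<rangle> = 0" for y
      using X by (simp add: sp_F_def)
    then have "adjoint_F J X *v z + X *v z = 0"
      using form_nondegenerate form_skew by (metis neg_equal_0_iff_equal)
    then show "- adjoint_F J X *v z = X *v z"
      by (simp add: matrix_uminus_apply neg_eq_iff_add_eq_0)
  qed
next
  assume *: "- adjoint_F J X = X"
  have "\<langle>X *v y, z\<rangle> + \<langle>y, X *v z\<rangle> = 0" for y z
  proof -
    have "X *v z = - (adjoint_F J X *v z)" by (subst *[symmetric]) (simp add: matrix_uminus_apply)
    then show ?thesis using form_F_adjoint[OF J, of X y z] by (simp add: form_uminus_right)
  qed
  then show "X \<in> sp_F J" by (simp add: sp_F_def)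
qed

lemma trace_pairing_zero_iff:
  "(\<forall>X\<in>gl_O. trace_pairing Y X = 0) \<longleftrightarrow> (\<forall>i j. Y $ i $ j \<in> tO 1)" for Y :: "'m Fmat"
proof
  assume *: "\<forall>X\<in>gl_O. trace_pairing Y X = 0"
  show "\<forall>i j. Y $ i $ j \<in> tO 1"
  proof (intro allI)
    fix i j
    have "fls_nth (Y $ i $ j) k = 0" if k: "k < 1" for k
    proof -
      \<comment> \<open>This multiple of a matrix unit extracts the coefficient with index
        \<open>k\<close> of the entry \<open>(i, j)\<close>; it is integral because
        \<open>k < 1\<close>.\<close>
      define X :: "'m Fmat" where "X = (\<chi> p q. if p = j \<and> q = i then tpow (- k) else 0)"
      have "tpow (- k) \<in> tO 0" using k by (intro tO_mono[OF tpow_in_tO]) simp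
      then have "X \<in> gl_O" by (simp add: X_def gl_O_def)
      have "(Y ** X) $ p $ p = (if p = i then Y $ i $ j * tpow (- k) else 0)" for p
        by (simp add: X_def matrix_matrix_mult_def if_distrib cong: if_cong)
      then have "trace (Y ** X) = tpow (- k) * Y $ i $ j"
        by (simp add: trace_def mult.commute)
      then have "trace_pairing Y X = fls_nth (Y $ i $ j) k"
        using tpow_mult_nth[of "- k" "Y $ i $ j" 0]
        by (simp add: trace_pairing_def fls_X_inv_times_conv_shift)
      then show ?thesis using * \<open>X \<in> gl_O\<close> by simp
    qed
    then show "Y $ i $ j \<in> tO 1" by (simp add: tO_def)
  qed
next
  assume *: "\<forall>i j. Y $ i $ j \<in> tO 1"
  show "\<forall>X\<in>gl_O. trace_pairing Y X = 0"
  proof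
    fix X :: "'m Fmat" assume "X \<in> gl_O"
    then have "Y $ i $ j * X $ j $ i \<in> tO 1" for i j
      using * tO_mult_add[of "Y $ i $ j" 1 "X $ j $ i" 0] by (simp add: gl_O_def)
    then have "trace (Y ** X) \<in> tO 1"
      unfolding trace_def by (auto simp: matrix_matrix_mult_def intro!: tO_sum)
    then show "trace_pairing Y X = 0"
      by (simp add: trace_pairing_def fls_X_inv_times_conv_shift tO_def)
  qed
qed

lemma t_sp_O_iff: "Y \<in> scal fls_X ` sp_O J \<longleftrightarrow> Y \<in> sp_F J \<and> (\<forall>i j. Y $ i $ j \<in> tO 1)"
proof
  assume Y: "Y \<in> sp_F J \<and> (\<forall>i j. Y $ i $ j \<in> tO 1)"
  define Z where "Z = scal (tpow (- 1)) Y"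
  have "Y = scal fls_X Z"
    unfolding fls_X_tpow Z_def vec_eq_iff scal_nth by (simp only: tpow_cancel_left[of 1 "- 1"]) simp
  moreover have "Z $ i $ j \<in> tO 0" for i j
    using Y unfolding Z_def scal_nth tO_tpow_mult by simp
  moreover have "Z \<in> sp_F J"
  proof -
    have "\<langle>Z *v y, z\<rangle> + \<langle>y, Z *v z\<rangle> = tpow (- 1) * (\<langle>Y *v y, z\<rangle> + \<langle>y, Y *v z\<rangle>)" for y z
      by (simp only: Z_def scal_apply form_scale_left form_F_scale distrib_left)
    then show ?thesis using Y by (simp add: sp_F_def)
  qed
  ultimately show "Y \<in> scal fls_X ` sp_O J" by (auto simp: sp_O_def gl_O_def)
next
  assume "Y \<in> scal fls_X ` sp_O J"
  then obtain Z :: "'m Fmat" where Z: "Y = scal fls_X Z" "Z \<in> sp_F J" "\<forall>i j. Z $ i $ j \<in> tO 0"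
    by (auto simp: sp_O_def gl_O_def)
  have "\<langle>Y *v y, z\<rangle> + \<langle>y, Y *v z\<rangle> = fls_X * (\<langle>Z *v y, z\<rangle> + \<langle>y, Z *v z\<rangle>)" for y z
    by (simp only: Z(1) scal_apply form_scale_left form_F_scale distrib_left)
  then show "Y \<in> sp_F J \<and> (\<forall>i j. Y $ i $ j \<in> tO 1)"
    using Z by (simp add: sp_F_def tO_X_mult)
qed

lemma S2_in_sp_F: "S2 J v \<in> sp_F J"
  using form_skew[of _ v] by (simp add: sp_F_def S2_apply form_scale_left form_F_scale)

lemma sp_F_add: "X \<in> sp_F J \<Longrightarrow> Y \<in> sp_F J \<Longrightarrow> X + Y \<in> sp_F J"
  by (simp add: sp_F_iff_adjoint adjoint_F_def transpose_def matrix_add_ldistrib vec_eq_iff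
      matrix_matrix_mult_def sum.distrib algebra_simps)

text \<open>By \<open>moment_map_pairing\<close> the left side says that \<open>S2 J v + x\<close>
  annihilates \<open>gl_O\<close>, so its entries lie in \<open>tO 1\<close>. As it belongs to
  \<open>sp_F J\<close>, this is membership in t g_O. Thus at points with equal vector components
  the conormal condition becomes the vanishing of the symplectic moment map.\<close>

lemma conormal_iff_moment:
  assumes "x \<in> sp_F J"
  shows "(\<forall>X\<in>gl_O. covector_pairing J (v, x) (X *v v, X) = 0) \<longleftrightarrow> S2 J v + x \<in> scal fls_X ` sp_O J"
  unfolding t_sp_O_iff trace_pairing_zero_iff[symmetric]
  using sp_F_add[OF S2_in_sp_F assms] by (simp add: covector_pairing_def moment_map_pairing)


text \<open>An O-basis of \<open>V_O\<close> together with its coordinate functionals. No symplectic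
  condition is imposed, so frames, bases of V and their images under \<open>GL_O\<close> are treated
  alike.\<close>

definition O_basis :: "(nat \<Rightarrow> 'm Fvec) \<Rightarrow> (nat \<Rightarrow> 'm Fvec \<Rightarrow> complex fls) \<Rightarrow> bool" where
  "O_basis b \<psi> \<longleftrightarrow> (\<forall>i<2*n. b i \<in> tV 0) \<and> (\<forall>i<2*n. \<forall>j<2*n. \<psi> i (b j) = (if i = j then 1 else 0)) \<and>
     (\<forall>z. z = (\<Sum>i<2*n. \<psi> i z *s b i)) \<and> (\<forall>i<2*n. \<forall>z\<in>tV 0. \<psi> i z \<in> tO 0) \<and>
     (\<forall>i y z. \<psi> i (y + z) = \<psi> i y + \<psi> i z) \<and> (\<forall>i c z. \<psi> i (c *s z) = c * \<psi> i z)"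

lemma O_basis_expansion: "O_basis b \<psi> \<Longrightarrow> z = (\<Sum>i<2*n. \<psi> i z *s b i)"
  by (simp add: O_basis_def)

lemma O_basis_coeff_sum:
  assumes "O_basis b \<psi>"
  shows "\<psi> i (\<Sum>j\<in>S. c j *s y j) = (\<Sum>j\<in>S. c j * \<psi> i (y j))"
proof -
  have add: "\<psi> i (y + z) = \<psi> i y + \<psi> i z" and scale: "\<psi> i (c *s z) = c * \<psi> i z" for y z c
    using assms by (auto simp: O_basis_def)
  have "\<psi> i 0 = 0" using scale[of 0 0] by simp
  then show ?thesis
    by (induction S rule: infinite_finite_induct) (simp_all add: add scale)
qed

lemma O_basis_coeff:
  assumes "O_basis b \<psi>" "i < 2 * n"
  shows "\<psi> i (\<Sum>j<2*n. c j *s b j) = c i"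
proof -
  have "(\<Sum>j<2*n. c j * \<psi> i (b j)) = (\<Sum>j<2*n. if i = j then c j else 0)"
    using assms by (intro sum.cong) (auto simp: O_basis_def)
  then show ?thesis using assms(2) by (simp add: O_basis_coeff_sum[OF assms(1)])
qed

lemma O_basis_coeff_in_tO:
  assumes "O_basis b \<psi>" "i < 2 * n" "z \<in> tV k"
  shows "\<psi> i z \<in> tO k"
proof -
  have "tpow (- k) *s z \<in> tV 0" using assms(3) unfolding tV_tpow by simp
  then have "\<psi> i (tpow (- k) *s z) \<in> tO 0" using assms(1,2) unfolding O_basis_def by blast
  moreover have "\<psi> i (tpow (- k) *s z) = tpow (- k) * \<psi> i z" using assms(1) by (simp add: O_basis_def)
  ultimately have "tpow (- k) * \<psi> i z \<in> tO 0" by simp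
  then show ?thesis unfolding tO_tpow_mult by simp
qed

lemma O_basis_tV_iff:
  assumes "O_basis b \<psi>"
  shows "z \<in> tV k \<longleftrightarrow> (\<forall>i<2*n. \<psi> i z \<in> tO k)"
proof
  assume *: "\<forall>i<2*n. \<psi> i z \<in> tO k"
  have "\<psi> i z *s b i \<in> tV k" if "i < 2 * n" for i
    using tV_scale[of "\<psi> i z" k "b i" 0] * assms that by (simp add: O_basis_def)
  then have "(\<Sum>i<2*n. \<psi> i z *s b i) \<in> tV k" by (intro tV_sum) auto
  then show "z \<in> tV k" using O_basis_expansion[OF assms, of z] by simp
qed (use O_basis_coeff_in_tO[OF assms] in blast)

lemma O_basis_coeff_scaled:
  assumes "O_basis b \<psi>" "i < 2 * n" "j < 2 * n"
  shows "\<psi> i (tpow (- m j) *s b j) \<in> tO (- m i)"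
proof -
  have "\<psi> i (tpow (- m j) *s b j) = tpow (- m j) * (if i = j then 1 else 0)"
    using assms by (simp add: O_basis_def)
  also have "\<dots> \<in> tO (- m i)"
    by (cases "i = j") (simp_all only: simp_thms if_True if_False mult_1_right mult_zero_right tpow_in_tO zero_in_tO)
  finally show ?thesis .
qed

lemma frame_O_basis: "frame E \<Longrightarrow> O_basis E (\<lambda>i z. \<langle>dual_frame E i, z\<rangle>)"
  unfolding O_basis_def
  by (auto simp: frame_in_tV dual_frame_form form_F_add form_F_scale frame_expansion[unfolded comb_def, symmetric]
      intro!: form_in_tO0 dual_frame_in_tV)

lemma O_basis_rescale:
  assumes b: "O_basis b \<psi>" and u: "\<And>i. i < 2 * n \<Longrightarrow> u i \<in> tO 0 \<and> inverse (u i) \<in> tO 0 \<and> u i \<noteq> 0"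
  shows "O_basis (\<lambda>i. u i *s b i) (\<lambda>i z. inverse (u i) * \<psi> i z)"
proof -
  have "(\<Sum>i<2*n. (inverse (u i) * \<psi> i z) *s (u i *s b i)) = (\<Sum>i<2*n. \<psi> i z *s b i)" for z
    using u by (intro sum.cong refl) (simp add: vector_smult_assoc)
  then have "z = (\<Sum>i<2*n. (inverse (u i) * \<psi> i z) *s (u i *s b i))" for z
    using O_basis_expansion[OF b, of z] by simp
  then show ?thesis
    using b u unfolding O_basis_def
    by (auto simp: distrib_left mult.left_commute intro!: tO_mult tV_scale0)
qed

lemma GL_O_inverse:
  assumes "g \<in> GL_O"
  obtains h where "h \<in> gl_O" "\<And>z :: 'm Fvec. g *v (h *v z) = z" "\<And>z. h *v (g *v z) = z" "g \<in> gl_O"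
  using assms that by (auto simp: GL_O_def matrix_vector_mul_assoc)

lemma O_basis_GL_O_image:
  assumes b: "O_basis b \<psi>" and g: "g \<in> gl_O" and h: "h \<in> gl_O" "\<And>z. g *v (h *v z) = z" "\<And>z. h *v (g *v z) = z"
  shows "O_basis (\<lambda>i. g *v b i) (\<lambda>i z. \<psi> i (h *v z))"
proof -
  have "z = (\<Sum>i<2*n. \<psi> i (h *v z) *s (g *v b i))" for z
  proof -
    have "h *v z = (\<Sum>i<2*n. \<psi> i (h *v z) *s b i)" by (rule O_basis_expansion[OF b])
    then have "g *v (h *v z) = g *v (\<Sum>i<2*n. \<psi> i (h *v z) *s b i)" by simp
    then show ?thesis by (simp add: h(2) matrix_apply_sum matrix_apply_scale)
  qed
  then show ?thesis
    using b g h unfolding O_basis_def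
    by (auto simp: gl_O_apply_tV matrix_vector_right_distrib matrix_apply_scale)
qed

text \<open>Matching coordinates gives integral maps in both directions, inverse to each
  other.\<close>

lemma ex_GL_O_between_bases:
  assumes b: "O_basis b \<psi>" and b': "O_basis b' \<psi>'"
  shows "\<exists>g\<in>GL_O. \<forall>z. g *v z = (\<Sum>i<2*n. \<psi> i z *s b' i)"
proof -
  have ex: "\<exists>M\<in>gl_O. \<forall>z. M *v z = (\<Sum>i<2*n. \<psi> i z *s b' i)"
    if b: "O_basis b \<psi>" and b': "O_basis b' \<psi>'" for b \<psi> b' \<psi>'
  proof -
    have "Vector_Spaces.linear (*s) (*s) (\<lambda>z. \<Sum>i<2*n. \<psi> i z *s b' i)"
      using b by unfold_locales
        (simp_all add: O_basis_def vec.scale_left_distrib sum.distrib vec.scale_sum_right vector_smult_assoc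
          vec.scale_right_distrib algebra_simps)
    then have M: "matrix (\<lambda>z. \<Sum>i<2*n. \<psi> i z *s b' i) *v z = (\<Sum>i<2*n. \<psi> i z *s b' i)" for z
      by (rule matrix_works)
    moreover have "(\<Sum>i<2*n. \<psi> i z *s b' i) \<in> tV 0" if "z \<in> tV 0" for z
      using b b' that by (intro tV_sum tV_scale0) (auto simp: O_basis_def)
    ultimately show ?thesis
      by (intro bexI[of _ "matrix (\<lambda>z. \<Sum>i<2*n. \<psi> i z *s b' i)"]) (auto simp: gl_O_iff_V_O V_O_tV)
  qed
  obtain g where g: "g \<in> gl_O" "\<And>z. g *v z = (\<Sum>i<2*n. \<psi> i z *s b' i)" using ex[OF b b'] by blast
  obtain h where h: "h \<in> gl_O" "\<And>z. h *v z = (\<Sum>i<2*n. \<psi>' i z *s b i)" using ex[OF b' b] by blast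
  have "g *v (h *v z) = z" for z
  proof -
    have "g *v (h *v z) = (\<Sum>i<2*n. \<psi>' i z *s b' i)"
      unfolding g h(2) using O_basis_coeff[OF b] by simp
    then show ?thesis using O_basis_expansion[OF b', of z] by simp
  qed
  then have "g ** h = mat 1"
    by (intro matrix_eqI) (simp add: matrix_vector_mul_assoc)
  moreover from this have "h ** g = mat 1"
    by (simp add: matrix_left_right_inverse)
  ultimately show ?thesis
    using g h by (intro bexI[of _ g]) (auto simp: GL_O_def)
qed

text \<open>Each inclusion between the two descriptions of the lattice bounds one sequence of
  exponents by the other. The \<open>b'\<close>-coordinates of \<open>b j\<close> are integral, and
  since \<open>tpow (- m j) *s b j\<close> is in the lattice they also satisfy the bound
  \<open>m j - m' i\<close>.\<close>

lemma elementary_divisors_unique: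
  assumes b: "O_basis b \<psi>" and b': "O_basis b' \<psi>'" and dom: "dominant m" "dominant m'"
    and L: "{z. \<forall>i<2*n. \<psi> i z \<in> tO (- m i)} = {z. \<forall>i<2*n. \<psi>' i z \<in> tO (- m' i)}" and r: "r < 2 * n"
  shows "m r = m' r"
proof -
  have le: "m r \<le> m' r"
    if b: "O_basis b \<psi>" and b': "O_basis b' \<psi>'" and dom: "dominant m" "dominant m'"
      and L: "{z. \<forall>i<2*n. \<psi> i z \<in> tO (- m i)} \<subseteq> {z. \<forall>i<2*n. \<psi>' i z \<in> tO (- m' i)}"
    for b \<psi> b' \<psi>' m m'
  proof (rule elementary_divisors_le[of b b' "\<lambda>i j. \<psi>' i (b j)" m m' r])
    show "\<forall>j<2*n. \<gamma> j = 0" if "(\<Sum>j<2*n. fls_const (\<gamma> j) *s b j) \<in> tV 1" for \<gamma>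
    proof (intro allI impI)
      fix j assume j: "j < 2 * n"
      have "fls_const (\<gamma> j) \<in> tO 1"
        using O_basis_coeff_in_tO[OF b j that] O_basis_coeff[OF b j] by simp
      then show "\<gamma> j = 0" by (auto simp: tO_def dest: spec[of _ 0])
    qed
    show "b' i \<in> tV 0" if "i < 2 * n" for i using b' that by (simp add: O_basis_def)
    show "b j = (\<Sum>i<2*n. \<psi>' i (b j) *s b' i)" for j by (rule O_basis_expansion[OF b'])
    show "\<psi>' i (b j) \<in> tO 0 \<and> \<psi>' i (b j) \<in> tO (m j - m' i)" if ij: "i < 2 * n" "j < 2 * n" for i j
    proof
      show "\<psi>' i (b j) \<in> tO 0" using b b' ij by (simp add: O_basis_def)
      have "\<psi> i' (tpow (- m j) *s b j) \<in> tO (- m i')" if "i' < 2 * n" for i'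
        using O_basis_coeff_scaled[OF b that ij(2)] .
      then have "\<psi>' i (tpow (- m j) *s b j) \<in> tO (- m' i)" using L ij by blast
      moreover have "\<psi>' i (tpow (- m j) *s b j) = tpow (- m j) * \<psi>' i (b j)"
        using b' by (simp add: O_basis_def)
      ultimately have "tpow (- m j) * \<psi>' i (b j) \<in> tO (- m' i)" by simp
      then show "\<psi>' i (b j) \<in> tO (m j - m' i)" unfolding tO_tpow_mult by simp
    qed
  qed (use dom r in auto)
  show ?thesis using le[OF b b' dom] le[OF b' b dom(2,1)] L by simp
qed

lemma basis_length:
  fixes e :: "(complex ^ 'm) list"
  assumes "is_basis e"
  shows "length e = 2 * n"
proof -
  have "vec.dim (UNIV :: (complex ^ 'm) set) = card (set e)"
    using assms vec.dim_span_eq_card_independent[of "set e"] by (simp add: is_basis_def)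
  then have "2 * n = card (set e)" unfolding vec_dim_card card_UNIV .
  then show ?thesis
    using assms by (simp add: is_basis_def distinct_card)
qed

text \<open>The coordinates with respect to \<open>e\<close> over the constants are extended to
  Laurent series; \<open>d\<close> is the inverse of the matrix of \<open>e\<close>. The bijection
  \<open>h\<close> links the positions in the list \<open>e\<close> with the index type of
  V.\<close>

lemma ex_basis_coordinates:
  fixes e :: "(complex ^ 'm) list"
  assumes "is_basis e"
  shows "\<exists>\<psi>. O_basis (\<lambda>i. base_change (e ! i)) \<psi>"
proof -
  have len: "length e = 2 * n" by (rule basis_length[OF assms])
  have dist: "distinct e" using assms by (simp add: is_basis_def)
  have inj: "inj_on ((!) e) {..<2*n}" using dist len by (simp add: inj_on_nth)
  have set: "set e = (!) e ` {..<2*n}" using len by (auto simp: set_conv_nth)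
  obtain h :: "nat \<Rightarrow> 'm" where h: "bij_betw h {..<2*n} UNIV"
    using finite_same_card_bij[of "{..<2*n}" "UNIV :: 'm set"] card_UNIV by auto
  obtain f where f: "Vector_Spaces.linear (*s) (*s) f"
      "\<forall>x\<in>set e. f x = axis (h (inv_into {..<2*n} ((!) e) x)) (1 :: complex)"
    using vec.linear_independent_extend[of "set e" "\<lambda>x. axis (h (inv_into {..<2*n} ((!) e) x)) 1"] assms
    unfolding is_basis_def by blast
  define d where "d = (\<lambda>i p. matrix f $ h i $ p)"
  have f_e: "f (e ! j) = axis (h j) 1" if "j < 2 * n" for j
    using f(2) that inj len by (simp add: inv_into_f_f)
  have d: "(\<Sum>p\<in>UNIV. d i p * x $ p) = f x $ h i" for i x
    using matrix_works[OF f(1), of x] by (simp add: d_def matrix_vector_mult_def vec_eq_iff)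
  have d_e: "(\<Sum>p\<in>UNIV. d i p * (e ! j) $ p) = (if i = j then 1 else 0)"
    if "i < 2 * n" "j < 2 * n" for i j
    using that h by (auto simp: d f_e axis_def bij_betw_def inj_on_def)
  \<comment> \<open>The other inverse identity, obtained by expanding the standard vectors in
    \<open>e\<close>: rows and columns are indexed by different sets.\<close>
  have e_d: "(\<Sum>i<2*n. d i q * (e ! i) $ p) = (if p = q then 1 else 0)" for p q
  proof -
    have "axis q 1 \<in> vec.span (set e)" using assms by (simp add: is_basis_def)
    then obtain u where "axis q 1 = (\<Sum>x\<in>set e. u x *s x)"
      by (auto simp: vec.span_finite)
    then have u: "axis q 1 = (\<Sum>i<2*n. u (e ! i) *s e ! i)"
      by (simp add: set sum.reindex[OF inj])
    have "d i q = u (e ! i)" if i: "i < 2 * n" for i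
    proof -
      have "d i q = (\<Sum>p\<in>UNIV. d i p * axis q 1 $ p)"
        by (simp add: axis_def if_distrib cong: if_cong)
      also have "\<dots> = (\<Sum>j<2*n. u (e ! j) * (\<Sum>p\<in>UNIV. d i p * (e ! j) $ p))"
        unfolding u by (simp add: sum_distrib_left mult_ac) (rule sum.swap)
      also have "\<dots> = (\<Sum>j<2*n. if i = j then u (e ! j) else 0)"
        using i by (intro sum.cong) (auto simp: d_e)
      finally show ?thesis using i by simp
    qed
    then have "(\<Sum>i<2*n. d i q * (e ! i) $ p) = axis q 1 $ p"
      unfolding u by simp
    then show ?thesis by (simp add: axis_def)
  qed
  define \<psi> where "\<psi> = (\<lambda>i (z :: 'm Fvec). \<Sum>p\<in>UNIV. fls_const (d i p) * z $ p)"
  have "(\<Sum>i<2*n. \<psi> i z *s base_change (e ! i)) $ p = z $ p" for z p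
  proof -
    have "(\<Sum>i<2*n. \<psi> i z *s base_change (e ! i)) $ p =
        (\<Sum>q\<in>UNIV. \<Sum>i<2*n. fls_const (d i q * (e ! i) $ p) * z $ q)"
      by (simp add: \<psi>_def base_change_def sum_distrib_right sum_distrib_left mult_ac
          fls_const_mult_const[symmetric] del: fls_const_mult_const) (rule sum.swap)
    also have "\<dots> = (\<Sum>q\<in>UNIV. fls_const (\<Sum>i<2*n. d i q * (e ! i) $ p) * z $ q)"
      by (simp add: fls_const_sum sum_distrib_right)
    also have "\<dots> = z $ p"
      unfolding e_d by (simp add: if_distrib if_distribR cong: if_cong)
    finally show ?thesis .
  qed
  moreover have "\<psi> i (base_change (e ! j)) = (if i = j then 1 else 0)" if "i < 2 * n" "j < 2 * n" for i j
  proof -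
    have "\<psi> i (base_change (e ! j)) = fls_const (\<Sum>p\<in>UNIV. d i p * (e ! j) $ p)"
      by (simp add: \<psi>_def base_change_def fls_const_sum)
    then show ?thesis using d_e[OF that] by simp
  qed
  moreover have "\<psi> i z \<in> tO 0" if "z \<in> tV 0" for i z
    using that by (auto simp: \<psi>_def tV_def intro!: tO_sum tO_mult)
  ultimately have "O_basis (\<lambda>i. base_change (e ! i)) \<psi>"
    unfolding O_basis_def
    by (auto simp: vec_eq_iff \<psi>_def distrib_left sum.distrib sum_distrib_left mult_ac tV_def base_change_def)
  then show ?thesis by blast
qed

lemma base_lattice_eq:
  fixes e :: "(complex ^ 'm) list"
  assumes "length e = 2 * n" "O_basis (\<lambda>i. base_change (e ! i)) \<psi>"
  shows "base_lattice e l z = {u. \<forall>i<2*n. \<psi> i u \<in> tO (- (l ! i + z ! i))}"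
proof
  show "base_lattice e l z \<subseteq> {u. \<forall>i<2*n. \<psi> i u \<in> tO (- (l ! i + z ! i))}"
  proof
    fix u assume "u \<in> base_lattice e l z"
    then obtain a where a: "\<forall>i<2*n. a i \<in> tO 0"
        "u = (\<Sum>i<2*n. (a i * tpow (- (l ! i) - z ! i)) *s base_change (e ! i))"
      unfolding base_lattice_def assms(1) by blast
    have "\<psi> i u \<in> tO (- (l ! i + z ! i))" if i: "i < 2 * n" for i
    proof -
      have "\<psi> i u = tpow (- (l ! i) - z ! i) * a i"
        unfolding a(2) O_basis_coeff[OF assms(2) i] by (rule mult.commute)
      moreover have "\<dots> \<in> tO (- (l ! i + z ! i))"
        unfolding tO_tpow_mult using a(1) i by simp
      ultimately show ?thesis by simp
    qed
    then show "u \<in> {u. \<forall>i<2*n. \<psi> i u \<in> tO (- (l ! i + z ! i))}" by simp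
  qed
  show "{u. \<forall>i<2*n. \<psi> i u \<in> tO (- (l ! i + z ! i))} \<subseteq> base_lattice e l z"
  proof
    fix u assume "u \<in> {u. \<forall>i<2*n. \<psi> i u \<in> tO (- (l ! i + z ! i))}"
    then have u: "\<psi> i u \<in> tO (- (l ! i + z ! i))" if "i < 2 * n" for i using that by simp
    define a where "a = (\<lambda>i. tpow (l ! i + z ! i) * \<psi> i u)"
    have "a i \<in> tO 0" if "i < 2 * n" for i
      unfolding a_def tO_tpow_mult using u[OF that] by simp
    moreover have "a i * tpow (- (l ! i) - z ! i) = \<psi> i u" for i
      unfolding a_def by (subst mult.commute) (rule tpow_cancel_left, simp)
    then have "u = (\<Sum>i<2*n. (a i * tpow (- (l ! i) - z ! i)) *s base_change (e ! i))"
      using O_basis_expansion[OF assms(2), of u] by simp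
    ultimately show "u \<in> base_lattice e l z"
      unfolding base_lattice_def assms(1) by blast
  qed
qed

text \<open>The orbit provides an O-basis \<open>b\<close> adapted to \<open>v\<close> and
  \<open>L\<close> that need not be symplectic. The self-dual \<open>L\<close> also has an adapted
  frame \<open>E\<close>, with the same exponents by uniqueness of elementary divisors. The change
  from \<open>b\<close> to \<open>E\<close> respects \<open>V_O\<close> and \<open>L\<close>, hence
  by \<open>bisignature_bound\<close> also the lattices with exponents \<open>sig \<theta>\<close>,
  and this bounds the coordinates of \<open>v\<close>.\<close>

lemma conormal_subset_stratum:
  assumes e: "is_basis e" and p: "is_partition n \<theta>" "is_partition n \<zeta>"
  shows "conormal_fixed_points J e (self_dual_signature \<theta>) (self_dual_signature \<zeta>) \<subseteq>
    stratum (sig \<theta>) (\<lambda>i. sig \<theta> i + sig \<zeta> i)"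
proof
  let ?l = "self_dual_signature \<theta>" and ?z = "self_dual_signature \<zeta>"
  let ?m = "\<lambda>i. sig \<theta> i + sig \<zeta> i"
  fix q assume "q \<in> conormal_fixed_points J e ?l ?z"
  then obtain v w L x where q: "q = (v, stabilizer_sp J L, x)"
      and con: "(v, w, L, x) \<in> conormal_bundle J e ?l ?z" and fp: "sigma J (v, w, L, x) = (v, w, L, x)"
    by (auto simp: conormal_fixed_points_def)
  have w: "w = v" "self_dual L" "x \<in> sp_F J"
    using fp unfolding sigma_def self_dual_def sp_F_iff_adjoint case_prod_conv prod.inject by blast+
  have "(v, L) \<in> GL_orbit e ?l ?z" using con by (simp add: conormal_bundle_def)
  then obtain g where g: "g \<in> GL_O" "v = g *v base_vector e ?l" "L = (*v) g ` base_lattice e ?l ?z"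
    by (auto simp: GL_orbit_def)
  obtain h where h: "h \<in> gl_O" "\<And>z :: 'm Fvec. g *v (h *v z) = z" "\<And>z. h *v (g *v z) = z" "g \<in> gl_O"
    using GL_O_inverse[OF g(1)] by blast
  have len: "length e = 2 * n" by (rule basis_length[OF e])
  obtain \<phi> where \<phi>: "O_basis (\<lambda>i. base_change (e ! i)) \<phi>" using ex_basis_coordinates[OF e] by blast
  define b where "b = (\<lambda>i. g *v base_change (e ! i))"
  define \<psi> where "\<psi> = (\<lambda>i z. \<phi> i (h *v z))"
  have b: "O_basis b \<psi>" unfolding b_def \<psi>_def by (rule O_basis_GL_O_image[OF \<phi> h(4,1,2,3)])
  have L: "L = {z. \<forall>i<2*n. \<psi> i z \<in> tO (- ?m i)}"
  proof -
    have "z \<in> (*v) g ` M \<longleftrightarrow> h *v z \<in> M" for z M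
      using h(2,3) by (metis image_iff)
    then show ?thesis
      unfolding g(3) base_lattice_eq[OF len \<phi>] \<psi>_def by (auto simp: sig_def h(3))
  qed
  have v: "v = (\<Sum>j<2*n. tpow (- sig \<theta> j) *s b j)"
    by (simp add: g(2) base_vector_def len b_def matrix_apply_sum matrix_apply_scale sig_def)
  \<comment> \<open>A crude bound for the poles of \<open>L\<close>, as required by
    \<open>ex_adapted_frame\<close>.\<close>
  define K where "K = (\<Sum>i<2*n. \<bar>?m i\<bar>)"
  have K: "?m i \<le> K" if "i < 2 * n" for i
    unfolding K_def using that member_le_sum[of i "{..<2*n}" "\<lambda>i. \<bar>?m i\<bar>"] by auto
  have "L \<subseteq> tV (- K)"
  proof
    fix z assume "z \<in> L"
    then have "\<psi> i z \<in> tO (- K)" if "i < 2 * n" for i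
      using tO_mono[of "\<psi> i z" "- ?m i" "- K"] K[OF that] that \<open>z \<in> L\<close> unfolding L by simp
    then show "z \<in> tV (- K)" unfolding O_basis_tV_iff[OF b] by blast
  qed
  then obtain E m' where E: "frame E" and m': "antisymmetric m'" "dominant m'" "L = lattice E m'"
    using ex_adapted_frame[OF w(2)] by blast
  have L': "L = {z. \<forall>i<2*n. \<langle>dual_frame E i, z\<rangle> \<in> tO (- m' i)}"
    using m'(3) by (simp add: lattice_def)
  have dom: "dominant ?m" by (intro dominant_add sig_dominant p)
  have mm: "m' i = ?m i" if "i < 2 * n" for i
    using elementary_divisors_unique[OF b frame_O_basis[OF E] dom m'(2) _ that] L L' by simp
  define a where "a = (\<lambda>i. \<langle>dual_frame E i, v\<rangle>)"
  define c where "c = (\<lambda>i j. - \<langle>dual_frame E j, x *v dual_frame E i\<rangle>)"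
  have va: "v = comb E a" unfolding a_def by (rule frame_expansion[OF E])
  have xc: "x = endo E c" unfolding c_def by (rule endo_expansion[OF E])
  have LE: "L = lattice E ?m" unfolding m'(3) lattice_def using mm by simp
  have anti: "antisymmetric ?m" by (intro antisymmetric_add sig_antisymmetric p)
  have "a i \<in> tO (- sig \<theta> i)" if i: "i < 2 * n" for i
  proof -
    have "tpow (- sig \<theta> j) * \<langle>dual_frame E i, b j\<rangle> \<in> tO (- sig \<theta> i)" if j: "j < 2 * n" for j
    proof -
      have "\<psi> k (tpow (- ?m j) *s b j) \<in> tO (- ?m k)" if "k < 2 * n" for k
        using O_basis_coeff_scaled[OF b that j, of ?m] .
      then have "tpow (- ?m j) *s b j \<in> L" unfolding L by blast
      then have "\<langle>dual_frame E i, tpow (- ?m j) *s b j\<rangle> \<in> tO (- m' i)"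
        using i unfolding L' by blast
      then have "\<langle>dual_frame E i, tpow (- ?m j) *s b j\<rangle> \<in> tO (- ?m i)"
        unfolding mm[OF i] .
      then have 1: "\<langle>dual_frame E i, b j\<rangle> \<in> tO (- ?m i - - ?m j)"
        unfolding form_F_scale tO_tpow_mult .
      have 2: "\<langle>dual_frame E i, b j\<rangle> \<in> tO 0"
        using b i j E by (intro form_in_tO0 dual_frame_in_tV) (auto simp: O_basis_def)
      have "sig \<theta> j - sig \<theta> i \<le> max 0 (?m j - ?m i)"
        using bisignature_bound[OF sig_dominant[OF p(1)] sig_dominant[OF p(2)] j i] by simp
      then have "\<langle>dual_frame E i, b j\<rangle> \<in> tO (- sig \<theta> i - - sig \<theta> j)"
        by (cases "0 \<le> ?m j - ?m i") (rule tO_mono[OF 1] tO_mono[OF 2], simp)+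
      then show ?thesis unfolding tO_tpow_mult .
    qed
    then show ?thesis
      unfolding a_def v form_sum_right form_F_scale by (intro tO_sum) auto
  qed
  \<comment> \<open>Dividing \<open>x\<close> by \<open>t\<close> stays in \<open>sp_F J\<close>,
    because \<open>fls_X\<close> is not a zero divisor.\<close>
  moreover have "x \<in> nil_radical (stabilizer_sp J L)"
  proof -
    have "x \<in> nil_radical (End_lattice L)" using con by (simp add: conormal_bundle_def)
    then obtain Y where Y: "Y \<in> End_lattice L" "x = scal fls_X Y" by (auto simp: nil_radical_def)
    have "fls_X * (\<langle>Y *v y, z\<rangle> + \<langle>y, Y *v z\<rangle>) = 0" for y z
    proof -
      have "\<langle>x *v y, z\<rangle> + \<langle>y, x *v z\<rangle> = 0" using w(3) by (simp add: sp_F_def)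
      then show ?thesis
        by (simp only: Y(2) scal_apply form_scale_left form_F_scale distrib_left)
    qed
    then have "Y \<in> sp_F J" by (simp add: sp_F_def)
    then show ?thesis using Y by (auto simp: nil_radical_def stabilizer_sp_def)
  qed
  then have "endo E c \<in> nil_radical (stabilizer_sp J (lattice E ?m))" by (simp only: xc[symmetric] LE[symmetric])
  moreover have "S2 J v + x \<in> scal fls_X ` sp_O J"
    using con w(1) unfolding conormal_iff_moment[OF w(3), symmetric] by (simp add: conormal_bundle_def)
  then have "endo E (\<lambda>i j. fls_X * a i * a j + c i j) \<in> scal fls_X ` sp_O J"
    by (simp only: va xc S2_comb[OF E] endo_add)
  ultimately have "admissible (sig \<theta>) ?m a c"
    unfolding admissible_def endo_in_nil_radical_iff[OF E anti] endo_in_t_sp_O_iff[OF E] by blast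
  then show "q \<in> stratum (sig \<theta>) ?m"
    unfolding stratum_def q va xc LE using E by blast
qed

text \<open>The nonzero leading coefficients make each \<open>a i\<close> equal to
  \<open>tpow (- l i)\<close> times a unit of O, and such units can be absorbed into the
  basis.\<close>

definition generic_stratum :: "(nat \<Rightarrow> int) \<Rightarrow> (nat \<Rightarrow> int) \<Rightarrow> ('m Fvec \<times> 'm Fmat set \<times> 'm Fmat) set" where
  "generic_stratum l m = {(comb E a, stabilizer_sp J (lattice E m), endo E c) | E a c.
     frame E \<and> admissible l m a c \<and> (\<forall>i<2*n. fls_nth (a i) (- l i) \<noteq> 0)}"

text \<open>Multiplying the frame vectors by the units \<open>u i\<close> gives an O-basis in which
  \<open>v\<close> has coordinates \<open>tpow (- sig \<theta> i)\<close>, while the exponents of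
  the lattice stay the same. An element of \<open>GL_O\<close> carrying the given basis to this one
  places the pair in the orbit.\<close>

lemma generic_stratum_subset_conormal:
  assumes e: "is_basis e" and p: "is_partition n \<theta>" "is_partition n \<zeta>"
  shows "generic_stratum (sig \<theta>) (\<lambda>i. sig \<theta> i + sig \<zeta> i) \<subseteq>
    conormal_fixed_points J e (self_dual_signature \<theta>) (self_dual_signature \<zeta>)"
proof
  let ?l = "self_dual_signature \<theta>" and ?z = "self_dual_signature \<zeta>"
  let ?m = "\<lambda>i. sig \<theta> i + sig \<zeta> i"
  fix q assume "q \<in> generic_stratum (sig \<theta>) ?m"
  then obtain E a c where q: "q = (comb E a, stabilizer_sp J (lattice E ?m), endo E c)"
      and E: "frame E" and ac: "admissible (sig \<theta>) ?m a c"
      and gen: "\<forall>i<2*n. fls_nth (a i) (- sig \<theta> i) \<noteq> 0"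
    by (auto simp: generic_stratum_def)
  let ?L = "lattice E ?m" and ?v = "comb E a" and ?x = "endo E c"
  have anti: "antisymmetric ?m" by (intro antisymmetric_add sig_antisymmetric p)
  have len: "length e = 2 * n" by (rule basis_length[OF e])
  obtain \<phi> where \<phi>: "O_basis (\<lambda>i. base_change (e ! i)) \<phi>" using ex_basis_coordinates[OF e] by blast
  define u where "u = (\<lambda>i. tpow (sig \<theta> i) * a i)"
  have u: "u i \<in> tO 0 \<and> inverse (u i) \<in> tO 0 \<and> u i \<noteq> 0" if i: "i < 2 * n" for i
  proof -
    have "u i \<in> tO 0" unfolding u_def tO_tpow_mult using ac i by (simp add: admissible_def)
    moreover have "fls_nth (u i) 0 \<noteq> 0"
      unfolding u_def tpow_mult_nth using gen i by simp
    ultimately show ?thesis using inverse_in_tO[of "u i" 0] by simp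
  qed
  let ?b = "\<lambda>i. u i *s E i" and ?\<psi> = "\<lambda>i z. inverse (u i) * \<langle>dual_frame E i, z\<rangle>"
  have b: "O_basis ?b ?\<psi>" using O_basis_rescale[OF frame_O_basis[OF E] u] .
  obtain g where g: "g \<in> GL_O" "\<And>z. g *v z = (\<Sum>i<2*n. \<phi> i z *s ?b i)"
    using ex_GL_O_between_bases[OF \<phi> b] by blast
  obtain h where h: "h \<in> gl_O" "\<And>z :: 'm Fvec. g *v (h *v z) = z" "\<And>z. h *v (g *v z) = z" "g \<in> gl_O"
    using GL_O_inverse[OF g(1)] by blast
  have \<psi>g: "?\<psi> i (g *v z) = \<phi> i z" if "i < 2 * n" for i z
    unfolding g(2) using O_basis_coeff[OF b that] .
  have "g *v base_vector e ?l = ?v"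
  proof -
    have "\<phi> i (base_vector e ?l) = tpow (- sig \<theta> i)" if "i < 2 * n" for i
      unfolding base_vector_def len O_basis_coeff[OF \<phi> that] by (simp add: sig_def)
    moreover have "tpow (- sig \<theta> i) * u i = a i" for i
      unfolding u_def by (rule tpow_cancel_left) simp
    ultimately show ?thesis
      unfolding g(2) comb_def by (intro sum.cong refl) (simp add: vector_smult_assoc del: minus_minus)
  qed
  moreover have "(*v) g ` base_lattice e ?l ?z = ?L"
  proof -
    have u_unit: "inverse (u i) * y \<in> tO k \<longleftrightarrow> y \<in> tO k" if "i < 2 * n" for i y k
    proof
      assume "inverse (u i) * y \<in> tO k"
      then have "u i * (inverse (u i) * y) \<in> tO k" using u[OF that] by (metis tO_mult0)
      then show "y \<in> tO k" using u[OF that] by (simp add: mult.assoc[symmetric])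
    qed (use u[OF that] tO_mult0 in blast)
    have "\<langle>dual_frame E i, z\<rangle> \<in> tO k \<longleftrightarrow> \<phi> i (h *v z) \<in> tO k" if "i < 2 * n" for i z k
      using \<psi>g[OF that, of "h *v z"] u_unit[OF that] h(2) by metis
    then have "z \<in> ?L \<longleftrightarrow> h *v z \<in> base_lattice e ?l ?z" for z
      by (simp add: base_lattice_eq[OF len \<phi>] lattice_def sig_def)
    then show ?thesis using h(2,3) by (auto simp: image_iff) metis
  qed
  ultimately have orb: "(?v, ?L) \<in> GL_orbit e ?l ?z"
    unfolding GL_orbit_def using g(1) by (intro CollectI exI[of _ g]) (simp only: simp_thms)
  have Gr: "?L \<in> Gr_GL"
  proof -
    obtain k where k: "k \<in> Sp_F J" "?L = (*v) k ` V_O" using lattice_Sp_image[OF E anti] by blast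
    then show ?thesis using Sp_F_adjoint(3)[OF k(1)] unfolding Gr_GL_def by blast
  qed
  have rad: "?x \<in> nil_radical (stabilizer_sp J ?L)"
    unfolding endo_in_nil_radical_iff[OF E anti] using ac by (auto simp: admissible_def)
  then have rad': "?x \<in> nil_radical (End_lattice ?L)"
    by (auto simp: nil_radical_def stabilizer_sp_def)
  have sp: "?x \<in> sp_F J" using ac by (auto simp: admissible_def endo_in_sp_F_iff[OF E])
  have "S2 J ?v + ?x \<in> scal fls_X ` sp_O J"
    unfolding S2_comb[OF E] endo_add endo_in_t_sp_O_iff[OF E]
    using ac by (auto simp: admissible_def mult_ac)
  then have "(?v, ?v, ?L, ?x) \<in> conormal_bundle J e ?l ?z"
    unfolding conormal_iff_moment[OF sp, symmetric] conormal_bundle_def using orb Gr rad' by simp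
  moreover have "sigma J (?v, ?v, ?L, ?x) = (?v, ?v, ?L, ?x)"
    using sp self_dual_lattice[OF E anti] by (simp add: sigma_def sp_F_iff_adjoint self_dual_def)
  ultimately show "q \<in> conormal_fixed_points J e ?l ?z"
    unfolding conormal_fixed_points_def q by blast
qed

end

section \<open>Topology of the zero fibre\<close>

lemma irreducible_set_finite_cover:
  assumes "irreducible_set T Z" "finite I" "\<And>i. i \<in> I \<Longrightarrow> closedin T (A i)" "Z \<subseteq> (\<Union>i\<in>I. A i)"
  shows "\<exists>i\<in>I. Z \<subseteq> A i"
  using assms(2-4)
proof (induction I)
  case empty
  then show ?case using assms(1) by (simp add: irreducible_set_def)
next
  case (insert i I)
  have "closedin T (\<Union>i\<in>I. A i)" using insert by (intro closedin_Union) auto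
  then have "Z \<subseteq> A i \<or> Z \<subseteq> (\<Union>i\<in>I. A i)"
    using insert.prems assms(1) unfolding irreducible_set_def by simp
  then show ?case using insert by auto
qed

lemma irreducible_set_closure:
  assumes "irreducible_set T Z"
  shows "irreducible_set T (T closure_of Z)"
proof -
  have sub: "Z \<subseteq> T closure_of Z"
    using assms by (intro closure_of_subset) (simp add: irreducible_set_def)
  show ?thesis
    unfolding irreducible_set_def
  proof (intro conjI allI impI)
    show "T closure_of Z \<noteq> {}" using assms sub by (auto simp: irreducible_set_def)
    show "T closure_of Z \<subseteq> topspace T" by (rule closure_of_subset_topspace)
    fix A B assume AB: "closedin T A" "closedin T B" "T closure_of Z \<subseteq> A \<union> B"
    then have "Z \<subseteq> A \<or> Z \<subseteq> B" using assms sub unfolding irreducible_set_def by blast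
    then show "T closure_of Z \<subseteq> A \<or> T closure_of Z \<subseteq> B"
      using AB closure_of_minimal by metis
  qed
qed

lemma finite_choice_lower_bound:
  assumes "\<And>i. \<exists>N. \<forall>s. f s i \<in> tO N"
  shows "\<exists>N. \<forall>s. \<forall>i :: 'i :: finite. f s i \<in> tO N"
proof -
  obtain N where N: "\<And>i s. f s i \<in> tO (N i)" using assms by metis
  have "f s i \<in> tO (Min (range N))" for s i
    using N[of s i] by (rule tO_mono) simp
  then show ?thesis by blast
qed

text \<open>Along the curve every polynomial function becomes a polynomial in \<open>s\<close>,
  which is zero or has finitely many roots. The uniform pole bounds keep the curve in one piece, so
  one set of equations decides membership for all \<open>s\<close>.\<close>

lemma zariski_closed_curve:
  fixes V :: "complex \<Rightarrow> ('m::finite) Fvec" and G X :: "complex \<Rightarrow> 'm Fmat"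
  assumes "zariski_closed entries S" and VGX: "poly_curve_vec V" "poly_curve_mat G" "poly_curve_mat X"
  shows "finite {s. (V s, G s, X s) \<in> S} \<or> (\<forall>s. (V s, G s, X s) \<in> S)"
proof -
  let ?\<gamma> = "\<lambda>s. (V s, G s, X s)"
  have poly: "\<exists>P. \<forall>s. p (?\<gamma> s) = poly P s" if "p \<in> polynomial_functions entries" for p
    using that
  proof induction
    case (const c)
    show ?case by (rule exI[of _ "[:c:]"]) simp
  next
    case (coeff f j)
    then have "poly_curve (\<lambda>s. f (?\<gamma> s))"
      using VGX by (auto simp: entries_def poly_curve_vec_def poly_curve_mat_def)
    then show ?case by (simp add: poly_curve_def)
  next
    case (add p q)
    then obtain P Q where "\<forall>s. p (?\<gamma> s) = poly P s" "\<forall>s. q (?\<gamma> s) = poly Q s" by blast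
    then show ?case by (intro exI[of _ "P + Q"]) simp
  next
    case (mult p q)
    then obtain P Q where "\<forall>s. p (?\<gamma> s) = poly P s" "\<forall>s. q (?\<gamma> s) = poly Q s" by blast
    then show ?case by (intro exI[of _ "P * Q"]) simp
  qed
  have bound: "\<exists>N. \<forall>s. \<forall>i j. A s $ i $ j \<in> tO N" if "poly_curve_mat A" for A :: "complex \<Rightarrow> 'm Fmat"
    using finite_choice_lower_bound[of "\<lambda>s (i, j). A s $ i $ j"] that
    by (auto simp: poly_curve_mat_def poly_curve_def)
  obtain N1 where N1: "\<forall>s. \<forall>i. V s $ i \<in> tO N1"
    using finite_choice_lower_bound[of "\<lambda>s i. V s $ i"] VGX(1)
    by (auto simp: poly_curve_vec_def poly_curve_def)
  obtain N2 N3 where N23: "\<forall>s. \<forall>i j. G s $ i $ j \<in> tO N2" "\<forall>s. \<forall>i j. X s $ i $ j \<in> tO N3"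
    using bound VGX(2,3) by meson
  define k where "k = nat (max (- N1) (max (- N2) (- N3)))"
  have "f \<in> tO (- int k)" if "f \<in> tO N1 \<or> f \<in> tO N2 \<or> f \<in> tO N3" for f
    using that by (auto simp: k_def elim!: tO_mono)
  then have piece: "?\<gamma> s \<in> bounded_piece entries k" for s
    using N1 N23 by (auto simp: bounded_piece_def entries_def)
  obtain P where P: "P \<subseteq> polynomial_functions entries"
      "S \<inter> bounded_piece entries k = {a \<in> bounded_piece entries k. \<forall>p\<in>P. p a = 0}"
    using assms(1) unfolding zariski_closed_def by blast
  have S: "?\<gamma> s \<in> S \<longleftrightarrow> (\<forall>p\<in>P. p (?\<gamma> s) = 0)" for s
    using piece[of s] P(2) by blast
  show ?thesis
  proof (cases "\<forall>p\<in>P. \<forall>s. p (?\<gamma> s) = 0")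
    case True
    then show ?thesis using S by blast
  next
    case False
    then obtain p s0 where p: "p \<in> P" "p (?\<gamma> s0) \<noteq> 0" by blast
    obtain Q where Q: "\<forall>s. p (?\<gamma> s) = poly Q s" using poly p(1) P(1) by blast
    then have "Q \<noteq> 0" using p(2) by auto
    then have "finite {s. poly Q s = 0}" by (rule poly_roots_finite)
    moreover have "{s. ?\<gamma> s \<in> S} \<subseteq> {s. poly Q s = 0}" using S p(1) Q by auto
    ultimately show ?thesis using finite_subset by blast
  qed
qed

context symplectic_space
begin

lemma topspace_cotangent: "topspace (cotangent_topology J) = cotangent_Sp J"
  using quotient_imp_surjective_map[OF quotient_map_cover_proj[of J]] cover_proj_image[of J] by simp

lemma topspace_mu_zero: "topspace (mu_zero_topology J) = mu_zero J"
  by (auto simp: mu_zero_topology_def topspace_cotangent mu_zero_def)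

lemma closedin_cotangent_iff:
  "closedin (cotangent_topology J) A \<longleftrightarrow> A \<subseteq> cotangent_Sp J \<and>
    (\<exists>S. zariski_closed entries S \<and> (\<forall>a\<in>cover J. cover_proj J a \<in> A \<longleftrightarrow> a \<in> S))"
proof -
  have "openin (cotangent_topology J) (cotangent_Sp J - A) \<longleftrightarrow>
     (\<exists>S. zariski_closed entries S \<and> (\<forall>a\<in>cover J. cover_proj J a \<in> A \<longleftrightarrow> a \<in> S))"
  proof
    assume "openin (cotangent_topology J) (cotangent_Sp J - A)"
    then obtain U where U: "zariski_closed entries (- U)"
        "{a \<in> cover J. cover_proj J a \<in> cotangent_Sp J - A} = U \<inter> cover J"
      by (auto simp: openin_cotangent_topology openin_subtopology openin_ind_zariski)
    have "cover_proj J a \<in> A \<longleftrightarrow> a \<in> - U" if "a \<in> cover J" for a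
      using U(2) that cover_proj_image[of J] by blast
    then show "\<exists>S. zariski_closed entries S \<and> (\<forall>a\<in>cover J. cover_proj J a \<in> A \<longleftrightarrow> a \<in> S)"
      using U(1) by blast
  next
    assume "\<exists>S. zariski_closed entries S \<and> (\<forall>a\<in>cover J. cover_proj J a \<in> A \<longleftrightarrow> a \<in> S)"
    then obtain S where S: "zariski_closed entries S" "\<forall>a\<in>cover J. cover_proj J a \<in> A \<longleftrightarrow> a \<in> S"
      by blast
    have "{a \<in> cover J. cover_proj J a \<in> cotangent_Sp J - A} = - S \<inter> cover J"
      using S(2) cover_proj_image[of J] by blast
    moreover have "openin (ind_zariski entries) (- S)" using S(1) by (simp add: openin_ind_zariski)
    ultimately show "openin (cotangent_topology J) (cotangent_Sp J - A)"
      unfolding openin_cotangent_topology openin_subtopology by blast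
  qed
  then show ?thesis by (auto simp: closedin_def topspace_cotangent)
qed

lemma closedin_mu_zeroE:
  assumes "closedin (mu_zero_topology J) A"
  obtains S where "zariski_closed entries S"
    "\<And>a. a \<in> cover J \<Longrightarrow> cover_proj J a \<in> mu_zero J \<Longrightarrow> cover_proj J a \<in> A \<longleftrightarrow> a \<in> S"
proof -
  obtain A' where A': "closedin (cotangent_topology J) A'" "A = A' \<inter> mu_zero J"
    using assms by (auto simp: mu_zero_topology_def closedin_subtopology)
  then show thesis using that unfolding closedin_cotangent_iff by blast
qed

text \<open>The stages do not depend on the choice of \<open>g\<close>, because \<open>p\<close> determines the lattice \<open>g V_O\<close>.\<close>

lemma cover_proj_in_stage_iff:
  assumes "a \<in> cover J"
  shows "cover_proj J a \<in> stage J k \<longleftrightarrow> a \<in> bounded_piece entries k"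
proof
  assume "cover_proj J a \<in> stage J k"
  then obtain b where b: "b \<in> cover J" "b \<in> bounded_piece entries k" "cover_proj J a = cover_proj J b"
    by (auto simp: stage_def)
  obtain v g x where a: "a = (v, g, x)" by (cases a)
  obtain v' g' x' where b': "b = (v', g', x')" by (cases b)
  have Sp: "g \<in> Sp_F J" "g' \<in> Sp_F J" using assms b(1) a b' by (auto simp: cover_def)
  have eq: "v = v'" "x = x'" "Ad g ` sp_O J = Ad g' ` sp_O J" using b(3) a b' by (auto simp: cover_proj_def)
  have "(*v) g ` V_O = (*v) g' ` V_O"
    using eq(3) by (intro lattice_eqI_stabilizer self_dual_image Sp) (simp add: stabilizer_sp_image Sp)
  then show "a \<in> bounded_piece entries k"
    using b(2) eq(1,2) unfolding a b' mem_bounded_piece_entries Sp_F_image_in_tV_iff[symmetric] by simp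
qed (use assms in \<open>auto simp: stage_def\<close>)

lemma zariski_closed_bounded_piece: "zariski_closed C (bounded_piece C k)"
  unfolding zariski_closed_def
proof
  fix k'
  let ?P = "{(\<lambda>a. fls_nth (f a) j) | f j. f \<in> C \<and> j < - int k}"
  have "?P \<subseteq> polynomial_functions C" by (auto intro: polynomial_functions.coeff)
  moreover have "bounded_piece C k \<inter> bounded_piece C k' = {a \<in> bounded_piece C k'. \<forall>p\<in>?P. p a = 0}"
    by (auto simp: bounded_piece_def tO_def) blast
  ultimately show "\<exists>P \<subseteq> polynomial_functions C.
      bounded_piece C k \<inter> bounded_piece C k' = {a \<in> bounded_piece C k'. \<forall>p\<in>P. p a = 0}"
    by blast
qed

lemma closedin_stage: "closedin (mu_zero_topology J) (stage J k \<inter> mu_zero J)"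
proof -
  have "stage J k \<subseteq> cotangent_Sp J"
    using cover_proj_image[of J] by (auto simp: stage_def)
  then have "closedin (cotangent_topology J) (stage J k)"
    unfolding closedin_cotangent_iff using zariski_closed_bounded_piece cover_proj_in_stage_iff by blast
  then show ?thesis
    by (auto simp: mu_zero_topology_def closedin_subtopology)
qed

lemma frame_Sp_O_image:
  assumes "frame E" "k \<in> Sp_F J" "k \<in> gl_O"
  shows "frame (\<lambda>i. k *v E i)"
  using assms by (auto simp: frame_def Sp_F_form gl_O_apply_tV)

lemma frame_cong:
  assumes "\<And>i. i < 2 * n \<Longrightarrow> E i = E' i"
  shows "comb E a = comb E' a" "endo E c = endo E' c" "lattice E m = lattice E' m"
  using assms by (auto simp: comb_def endo_def lattice_def dual_frame_def intro!: sum.cong)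

lemma generic_stratum_subset: "generic_stratum l m \<subseteq> stratum l m"
  unfolding generic_stratum_def stratum_def by blast

section \<open>Curves joining two points of a stratum\<close>

definition sum_bounded :: "(nat \<Rightarrow> int) \<Rightarrow> (nat \<Rightarrow> int) \<Rightarrow> bool" where
  "sum_bounded l m \<longleftrightarrow> (\<forall>i<2*n. \<forall>j<2*n. l i + l j \<le> max 0 (m i + m j))"

lemma sum_bounded_bisignature:
  assumes "is_partition n \<theta>" "is_partition n \<zeta>"
  shows "sum_bounded (sig \<theta>) (\<lambda>i. sig \<theta> i + sig \<zeta> i)"
  unfolding sum_bounded_def
  using bisignature_bound_sum[OF sig_antisymmetric sig_antisymmetric sig_dominant sig_dominant] assms by blast

definition point ::
    "(nat \<Rightarrow> int) \<Rightarrow> (nat \<Rightarrow> 'm Fvec) \<Rightarrow> (nat \<Rightarrow> complex fls) \<Rightarrow> (nat \<Rightarrow> nat \<Rightarrow> complex fls) \<Rightarrow>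
     'm Fvec \<times> 'm Fmat set \<times> 'm Fmat" where
  "point m E a c = (comb E a, stabilizer_sp J (lattice E m), endo E c)"

text \<open>A preimage of \<open>point m E a c\<close> in the cover, where coordinates are
  available; along a curve the base frame \<open>B\<close> stays constant.\<close>

definition lift ::
    "(nat \<Rightarrow> int) \<Rightarrow> (nat \<Rightarrow> 'm Fvec) \<Rightarrow> (nat \<Rightarrow> 'm Fvec) \<Rightarrow> (nat \<Rightarrow> complex fls) \<Rightarrow>
     (nat \<Rightarrow> nat \<Rightarrow> complex fls) \<Rightarrow> 'm Fvec \<times> 'm Fmat \<times> 'm Fmat" where
  "lift m B E a c = (comb E a, transition B m E, endo E c)"

lemma lift_in_cover:
  assumes "frame B" "frame E" "antisymmetric m" "admissible l m a c"
  shows "lift m B E a c \<in> cover J" "cover_proj J (lift m B E a c) = point m E a c"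
proof -
  have g: "transition B m E \<in> Sp_F J" by (rule transition_in_Sp_F[OF assms(1-3)])
  have st: "Ad (transition B m E) ` sp_O J = stabilizer_sp J (lattice E m)"
    using stabilizer_sp_image[OF g] transition_V_O[OF assms(1,2)] by simp
  have "endo E c \<in> nil_radical (stabilizer_sp J (lattice E m))"
    unfolding endo_in_nil_radical_iff[OF assms(2,3)] using assms(4) by (auto simp: admissible_def)
  then show "lift m B E a c \<in> cover J" using g by (simp add: cover_def lift_def st)
  show "cover_proj J (lift m B E a c) = point m E a c"
    by (simp add: cover_proj_def lift_def point_def st)
qed

text \<open>
  On the \<open>(i, j)\<close> with \<open>m i + m j > 0\<close> the quadratic term \<open>t a i * a j\<close> may have a pole and has to be cancelled by
  \<open>c i j\<close>; the correction \<open>s (1 - s) (a i - a' i) (a j - a' j)\<close> is the failure of \<open>a i * a j\<close> to be affine in \<open>s\<close>.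
\<close>

lemma ex_admissible_curve:
  assumes bound: "sum_bounded l m"
    and ac: "admissible l m a c" and ac': "admissible l m a' c'"
  shows "\<exists>\<alpha> \<kappa>. (\<forall>s. admissible l m (\<alpha> s) (\<kappa> s)) \<and> (\<forall>i. poly_curve (\<lambda>s. \<alpha> s i)) \<and>
    (\<forall>i j. poly_curve (\<lambda>s. \<kappa> s i j)) \<and> \<alpha> 0 = a \<and> \<alpha> 1 = a' \<and> \<kappa> 0 = c \<and> \<kappa> 1 = c' \<and>
    (\<forall>s i k. fls_nth (\<alpha> s i) k = (1 - s) * fls_nth (a i) k + s * fls_nth (a' i) k)"
proof -
  define \<alpha> where "\<alpha> = (\<lambda>s i. (1 - fls_const s) * a i + fls_const s * a' i)"
  define \<delta> where "\<delta> = (\<lambda>s i j. fls_const s * (1 - fls_const s) * (fls_X * ((a i - a' i) * (a j - a' j))))"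
  define \<kappa> where "\<kappa> = (\<lambda>s i j. (1 - fls_const s) * c i j + fls_const s * c' i j +
      (if 0 < m i + m j then \<delta> s i j else 0))"
  have s: "fls_const s \<in> tO 0" "1 - fls_const s \<in> tO 0" for s :: complex
    by (simp_all add: tO_diff)
  have nth: "fls_nth (\<alpha> s i) k = (1 - s) * fls_nth (a i) k + s * fls_nth (a' i) k" for s i k
  proof -
    have "1 - fls_const s = fls_const (1 - s)" by (metis fls_const_1 fls_minus_const)
    then show ?thesis by (simp only: \<alpha>_def fls_plus_nth fls_mult_const_nth)
  qed
  have adm: "admissible l m (\<alpha> s) (\<kappa> s)" for s
  proof -
    have \<alpha>: "\<alpha> s i \<in> tO (- l i)" "a i \<in> tO (- l i)" "a' i \<in> tO (- l i)" if "i < 2 * n" for i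
      using ac ac' that unfolding \<alpha>_def
      by (auto simp: admissible_def intro!: tO_add tO_mult0[OF s(1)] tO_mult0[OF s(2)])
    have prod: "fls_X * (x * y) \<in> tO (1 - l i - l j)" if "x \<in> tO (- l i)" "y \<in> tO (- l j)" for x y i j
      unfolding tO_X_mult using tO_mult_add[OF that] by simp
    have main: "\<kappa> s i j = \<kappa> s j i \<and> \<kappa> s i j \<in> tO (1 - m i - m j) \<and> fls_X * \<alpha> s i * \<alpha> s j + \<kappa> s i j \<in> tO 1"
      if ij: "i < 2 * n" "j < 2 * n" for i j
    proof (intro conjI)
      have b: "l i + l j \<le> max 0 (m i + m j)" using bound ij by (simp add: sum_bounded_def)
      have C: "c i j = c j i" "c' i j = c' j i" "c i j \<in> tO (1 - m i - m j)" "c' i j \<in> tO (1 - m i - m j)"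
          "fls_X * a i * a j + c i j \<in> tO 1" "fls_X * a' i * a' j + c' i j \<in> tO 1"
        using ac ac' ij by (auto simp: admissible_def)
      show "\<kappa> s i j = \<kappa> s j i"
        using C(1,2) by (simp add: \<kappa>_def \<delta>_def add.commute mult.commute)
      have lin: "(1 - fls_const s) * c i j + fls_const s * c' i j \<in> tO (1 - m i - m j)"
        using C(3,4) by (intro tO_add tO_mult0[OF s(1)] tO_mult0[OF s(2)])
      have "fls_X * ((a i - a' i) * (a j - a' j)) \<in> tO (1 - l i - l j)"
        using \<alpha> ij by (intro prod tO_diff) auto
      then have "\<delta> s i j \<in> tO (1 - l i - l j)"
        unfolding \<delta>_def by (rule tO_mult0[OF tO_mult[OF s]])
      then have "\<delta> s i j \<in> tO (1 - m i - m j)" if "0 < m i + m j"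
        using b that by (elim tO_mono) simp
      then show "\<kappa> s i j \<in> tO (1 - m i - m j)"
        unfolding \<kappa>_def by (intro tO_add[OF lin]) auto
      show "fls_X * \<alpha> s i * \<alpha> s j + \<kappa> s i j \<in> tO 1"
      proof (cases "0 < m i + m j")
        case True
        have "fls_X * \<alpha> s i * \<alpha> s j + \<kappa> s i j =
            (1 - fls_const s) * (fls_X * a i * a j + c i j) + fls_const s * (fls_X * a' i * a' j + c' i j)"
          using True unfolding \<kappa>_def \<alpha>_def \<delta>_def
          by (simp add: algebra_simps del: fls_const_mult_const)
        then show ?thesis
          using tO_add[OF tO_mult0[OF s(2) C(5)] tO_mult0[OF s(1) C(6)]] by simp
      next
        case False
        \<comment> \<open>Here the bound gives \<open>l i + l j \<le> 0\<close>, so the quadratic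
          term lies in \<open>tO 1\<close> by itself, and so does
          \<open>\<kappa> s i j\<close>.\<close>
        have "fls_X * (\<alpha> s i * \<alpha> s j) \<in> tO 1"
          using prod[OF \<alpha>(1)[OF ij(1)] \<alpha>(1)[OF ij(2)]] b False by (elim tO_mono) simp
        moreover have "\<kappa> s i j \<in> tO 1"
          using lin False by (simp add: \<kappa>_def) (elim tO_mono; simp)
        ultimately show ?thesis using tO_add by (simp add: mult.assoc)
      qed
    qed
    show ?thesis using \<alpha>(1) main by (simp add: admissible_def)
  qed
  have "poly_curve (\<lambda>s. \<alpha> s i)" for i
    unfolding \<alpha>_def by (intro poly_curve_add poly_curve_mult poly_curve_diff poly_curve_const poly_curve_param)
  moreover have "poly_curve (\<lambda>s. \<kappa> s i j)" for i j
    unfolding \<kappa>_def \<delta>_def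
    by (cases "0 < m i + m j")
      (simp_all, (intro poly_curve_add poly_curve_mult poly_curve_diff poly_curve_const poly_curve_param)+)
  moreover have "\<alpha> 0 = a" "\<alpha> 1 = a'" "\<kappa> 0 = c" "\<kappa> 1 = c'"
    by (auto simp: \<alpha>_def \<kappa>_def \<delta>_def fun_eq_iff)
  ultimately show ?thesis
    using adm nth by (intro exI[of _ \<alpha>] exI[of _ \<kappa>]) auto
qed

lemma ex_frame_curve:
  assumes E: "frame E" and E': "frame E'"
  shows "\<exists>F. (\<forall>s. frame (F s)) \<and> (\<forall>i. poly_curve_vec (\<lambda>s. F s i)) \<and> F 0 = E \<and> (\<forall>i<2*n. F 1 i = E' i)"
proof -
  obtain g where g: "joined_to_1 g" "\<forall>i<n. g *v E i = E' i \<and> g *v E (2 * n - 1 - i) = E' (2 * n - 1 - i)"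
    using ex_joined_hyperbolic[OF hyperbolic_frame[OF E] hyperbolic_frame[OF E'], of n] by blast
  obtain k where k: "\<forall>s. k s \<in> Sp_F J \<inter> gl_O" "poly_curve_mat k" "k 0 = mat 1" "k 1 = g"
    using g(1) by (auto simp: joined_to_1_def)
  have "g *v E i = E' i" if "i < 2 * n" for i
  proof (cases "i < n")
    case False
    then have "2 * n - 1 - i < n" "2 * n - 1 - (2 * n - 1 - i) = i" using that by auto
    then show ?thesis using g(2) by metis
  qed (use g(2) in simp)
  then show ?thesis
    using k E by (intro exI[of _ "\<lambda>s i. k s *v E i"]) (auto simp: frame_Sp_O_image)
qed

text \<open>The frame and the coefficients move along separate curves with a common parameter.
  Genericity of the end point is lost at finitely many parameters only, because each leading
  coefficient is affine in \<open>s\<close> and nonzero at \<open>s = 1\<close>.\<close>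

lemma ex_curve_in_stratum:
  assumes bound: "sum_bounded l m"
    and anti: "antisymmetric m" and "q \<in> stratum l m" "q' \<in> stratum l m"
  shows "\<exists>\<gamma> :: complex \<Rightarrow> _. (\<forall>s. \<gamma> s \<in> stratum l m) \<and> \<gamma> 0 = q \<and> \<gamma> 1 = q' \<and>
    (\<forall>A. closedin (mu_zero_topology J) A \<longrightarrow> finite {s. \<gamma> s \<in> A} \<or> (\<forall>s. \<gamma> s \<in> A)) \<and>
    (q' \<in> generic_stratum l m \<longrightarrow> finite {s. \<gamma> s \<notin> generic_stratum l m})"
proof -
  obtain E a c where q: "q = point m E a c" "frame E" "admissible l m a c"
    using assms(3) by (auto simp: stratum_def point_def)
  have "\<exists>E' a' c'. q' = point m E' a' c' \<and> frame E' \<and> admissible l m a' c' \<and>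
      (q' \<in> generic_stratum l m \<longrightarrow> (\<forall>i<2*n. fls_nth (a' i) (- l i) \<noteq> 0))"
    using assms(4) by (cases "q' \<in> generic_stratum l m")
      (auto simp: stratum_def generic_stratum_def point_def, blast+)
  then obtain E' a' c' where q': "q' = point m E' a' c'" "frame E'" "admissible l m a' c'"
      and gen: "q' \<in> generic_stratum l m \<longrightarrow> (\<forall>i<2*n. fls_nth (a' i) (- l i) \<noteq> 0)"
    by blast
  obtain F where F: "\<forall>s. frame (F s)" "\<forall>i. poly_curve_vec (\<lambda>s. F s i)" "F 0 = E" "\<forall>i<2*n. F 1 i = E' i"
    using ex_frame_curve[OF q(2) q'(2)] by blast
  obtain \<alpha> \<kappa> where ak: "\<forall>s. admissible l m (\<alpha> s) (\<kappa> s)" "\<forall>i. poly_curve (\<lambda>s. \<alpha> s i)"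
      "\<forall>i j. poly_curve (\<lambda>s. \<kappa> s i j)" "\<alpha> 0 = a" "\<alpha> 1 = a'" "\<kappa> 0 = c" "\<kappa> 1 = c'"
      "\<forall>s i k. fls_nth (\<alpha> s i) k = (1 - s) * fls_nth (a i) k + s * fls_nth (a' i) k"
    using ex_admissible_curve[OF bound q(3) q'(3)] by blast
  define \<gamma> where "\<gamma> = (\<lambda>s. point m (F s) (\<alpha> s) (\<kappa> s))"
  have \<gamma>: "\<gamma> s \<in> stratum l m" for s
    using F(1) ak(1) unfolding \<gamma>_def point_def stratum_def by blast
  moreover have "\<gamma> 0 = q" "\<gamma> 1 = q'"
    using F(3,4) ak frame_cong[of "F 1" E'] by (simp_all add: \<gamma>_def q q' point_def)
  moreover have "finite {s. \<gamma> s \<in> A} \<or> (\<forall>s. \<gamma> s \<in> A)" if A: "closedin (mu_zero_topology J) A" for A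
  proof -
    obtain S where S: "zariski_closed entries S"
        "\<And>b. b \<in> cover J \<Longrightarrow> cover_proj J b \<in> mu_zero J \<Longrightarrow> cover_proj J b \<in> A \<longleftrightarrow> b \<in> S"
      using closedin_mu_zeroE[OF A] by blast
    let ?b = "\<lambda>s. lift m E (F s) (\<alpha> s) (\<kappa> s)"
    have b: "?b s \<in> cover J" "cover_proj J (?b s) = \<gamma> s" for s
      using lift_in_cover[OF q(2) _ anti, of "F s" l "\<alpha> s" "\<kappa> s"] F(1) ak(1) by (simp_all add: \<gamma>_def)
    have "\<gamma> s \<in> A \<longleftrightarrow> ?b s \<in> S" for s
      using S(2)[OF b(1)[of s]] b(2)[of s] \<gamma>[of s] stratum_subset_mu_zero[OF anti] by auto
    moreover have "finite {s. ?b s \<in> S} \<or> (\<forall>s. ?b s \<in> S)"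
      unfolding lift_def
    proof (rule zariski_closed_curve[OF S(1)])
      show "poly_curve_vec (\<lambda>s. comb (F s) (\<alpha> s))"
        unfolding comb_def using F(2) ak(2) by (intro poly_curve_vec_sum poly_curve_vec_scale) auto
      show "poly_curve_mat (\<lambda>s. transition E m (F s))"
        unfolding transition_def using F(2)
        by (intro poly_curve_mat_sum poly_curve_mat_scal poly_curve_mat_rank_one) auto
      show "poly_curve_mat (\<lambda>s. endo (F s) (\<kappa> s))"
        unfolding endo_def using F(2) ak(3)
        by (intro poly_curve_mat_sum poly_curve_mat_scal poly_curve_mat_rank_one) auto
    qed
    ultimately show ?thesis by simp
  qed
  moreover have "finite {s. \<gamma> s \<notin> generic_stratum l m}" if "q' \<in> generic_stratum l m"
  proof -
    define Q where "Q = (\<lambda>i. [:fls_nth (a i) (- l i), fls_nth (a' i) (- l i) - fls_nth (a i) (- l i):])"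
    have Q: "fls_nth (\<alpha> s i) (- l i) = poly (Q i) s" for s i
      using ak(8) by (simp add: Q_def algebra_simps)
    have "poly (Q i) 1 \<noteq> 0" if "i < 2 * n" for i
      using gen that \<open>q' \<in> generic_stratum l m\<close> by (simp add: Q_def)
    then have "Q i \<noteq> 0" if "i < 2 * n" for i using that by fastforce
    then have "finite (\<Union>i<2*n. {s. poly (Q i) s = 0})"
      using poly_roots_finite by auto
    moreover have "{s. \<gamma> s \<notin> generic_stratum l m} \<subseteq> (\<Union>i<2*n. {s. poly (Q i) s = 0})"
    proof
      fix s assume s: "s \<in> {s. \<gamma> s \<notin> generic_stratum l m}"
      show "s \<in> (\<Union>i<2*n. {s. poly (Q i) s = 0})"
      proof (rule ccontr)
        assume "s \<notin> (\<Union>i<2*n. {s. poly (Q i) s = 0})"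
        then have "\<forall>i<2*n. fls_nth (\<alpha> s i) (- l i) \<noteq> 0" by (simp add: Q)
        then have "\<gamma> s \<in> generic_stratum l m"
          unfolding \<gamma>_def point_def generic_stratum_def using F(1) ak(1) by blast
        then show False using s by simp
      qed
    qed
    ultimately show ?thesis using finite_subset by blast
  qed
  ultimately show ?thesis by (intro exI[of _ \<gamma>]) simp
qed

text \<open>A frame adapted to the self-dual lattice \<open>V_O\<close> itself.\<close>

lemma ex_frame: "\<exists>E. frame E"
proof -
  have "self_dual (tV 0)" using dual_V_O[OF J] by (simp add: self_dual_def V_O_tV)
  then show ?thesis using ex_adapted_frame[of "tV 0" 0] by auto
qed

lemma generic_stratum_nonempty:
  assumes bound: "sum_bounded l m"
  shows "generic_stratum l m \<noteq> {}"
proof -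
  obtain E where E: "frame E" using ex_frame by blast
  define a where "a = (\<lambda>i. tpow (- l i))"
  \<comment> \<open>Where \<open>m i + m j\<close> is positive the entry of \<open>x\<close> cancels
    the quadratic term; elsewhere the bound already puts that term into \<open>tO 1\<close>.\<close>
  define c where "c = (\<lambda>i j. if 0 < m i + m j then - (fls_X * a i * a j) else 0)"
  have a: "fls_X * a i * a j \<in> tO (1 - l i - l j)" for i j
  proof -
    have "a i * a j \<in> tO (- l i + - l j)" unfolding a_def by (intro tO_mult_add tpow_in_tO)
    then show ?thesis unfolding mult.assoc tO_X_mult by simp
  qed
  have "c i j \<in> tO (1 - m i - m j)" "fls_X * a i * a j + c i j \<in> tO 1" if "i < 2 * n" "j < 2 * n" for i j
  proof -
    have "l i + l j \<le> max 0 (m i + m j)" using bound that by (simp add: sum_bounded_def)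
    then show "c i j \<in> tO (1 - m i - m j)" "fls_X * a i * a j + c i j \<in> tO 1"
      using tO_mono[OF a[of i j], of "1 - m i - m j"] tO_mono[OF a[of i j], of 1]
      by (cases "0 < m i + m j"; simp add: c_def)+
  qed
  moreover have "c i j = c j i" for i j by (simp add: c_def add.commute mult_ac)
  moreover have "a i \<in> tO (- l i)" for i unfolding a_def by (rule tpow_in_tO)
  ultimately have "admissible l m a c" by (simp add: admissible_def)
  moreover have "fls_nth (a i) (- l i) \<noteq> 0" for i by (simp add: a_def)
  ultimately show ?thesis using E unfolding generic_stratum_def by blast
qed

lemma stratum_subset_stage:
  assumes anti: "antisymmetric m"
  shows "\<exists>k. stratum l m \<subseteq> stage J k"
proof -
  define M where "M = (\<Sum>i<2*n. \<bar>m i\<bar>) + (\<Sum>i<2*n. \<bar>l i\<bar>)"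
  have sums: "0 \<le> (\<Sum>i<2*n. \<bar>m i\<bar>)" "0 \<le> (\<Sum>i<2*n. \<bar>l i\<bar>)" by (simp_all add: sum_nonneg)
  have M: "m i \<le> M" "l i \<le> M" "0 \<le> M" if "i < 2 * n" for i
    unfolding M_def
    using that sums member_le_sum[of i "{..<2*n}" "\<lambda>i. \<bar>m i\<bar>"] member_le_sum[of i "{..<2*n}" "\<lambda>i. \<bar>l i\<bar>"]
    by auto
  \<comment> \<open>The factor 2 is for the entries of \<open>x\<close>, whose coefficients have
    poles of order at most \<open>m i + m j - 1\<close>.\<close>
  define k where "k = nat (2 * M)"
  have k: "int k = 2 * M" using sums by (simp add: k_def M_def)
  have "q \<in> stage J k" if q_in: "q \<in> stratum l m" for q
  proof -
    obtain E a c where q: "q = point m E a c" and E: "frame E" and ac: "admissible l m a c"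
      using q_in by (auto simp: stratum_def point_def)
    have "a i *s E i \<in> tV (- int k)" if i: "i < 2 * n" for i
    proof -
      have "a i *s E i \<in> tV (- l i + 0)"
        using ac i E by (intro tV_scale frame_in_tV) (auto simp: admissible_def)
      then show ?thesis by (rule tV_mono) (use M[OF i] in \<open>simp add: k\<close>)
    qed
    then have 1: "comb E a \<in> tV (- int k)" unfolding comb_def by (intro tV_sum) auto
    have "lattice E m \<subseteq> tV (- int k)"
    proof
      fix u assume u: "u \<in> lattice E m"
      have "\<langle>dual_frame E i, u\<rangle> *s E i \<in> tV (- int k)" if i: "i < 2 * n" for i
      proof -
        have "\<langle>dual_frame E i, u\<rangle> *s E i \<in> tV (- m i + 0)"
          using u i E by (intro tV_scale frame_in_tV) (auto simp: lattice_def)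
        then show ?thesis by (rule tV_mono) (use M[OF i] in \<open>simp add: k\<close>)
      qed
      then have "comb E (\<lambda>i. \<langle>dual_frame E i, u\<rangle>) \<in> tV (- int k)" unfolding comb_def by (intro tV_sum) auto
      then show "u \<in> tV (- int k)" using frame_expansion[OF E, of u] by simp
    qed
    then have 2: "(*v) (transition E m E) ` V_O \<subseteq> tV (- int k)"
      using transition_V_O[OF E E] by simp
    have 3: "(*v) (endo E c) ` V_O \<subseteq> tV (- int k)"
    proof (rule image_subsetI)
      fix z :: "'m Fvec" assume z: "z \<in> V_O"
      have "(c i j * \<langle>E i, z\<rangle>) *s E j \<in> tV (- int k)" if ij: "i < 2 * n" "j < 2 * n" for i j
      proof -
        have "(c i j * \<langle>E i, z\<rangle>) *s E j \<in> tV (1 - m i - m j + 0 + 0)"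
          using ac z ij
          by (intro tV_scale tO_mult_add form_in_tO0 frame_in_tV[OF E]) (auto simp: admissible_def V_O_tV)
        then show ?thesis by (rule tV_mono) (use M[OF ij(1)] M[OF ij(2)] in \<open>simp add: k\<close>)
      qed
      then show "endo E c *v z \<in> tV (- int k)"
        unfolding endo_apply by (intro tV_sum) auto
    qed
    have "lift m E E a c \<in> bounded_piece entries k"
      using 1 2 3 unfolding lift_def mem_bounded_piece_entries Sp_F_image_in_tV_iff by (simp add: tV_def)
    then show ?thesis
      using lift_in_cover[OF E E anti ac] unfolding stage_def q by (metis IntI image_eqI)
  qed
  then show ?thesis by blast
qed

text \<open>A curve from a point outside \<open>A\<close> to a point outside \<open>B\<close> would
  meet each of them at finitely many parameters, although together they contain the whole
  curve.\<close>

lemma stratum_irreducible: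
  assumes bound: "sum_bounded l m"
    and anti: "antisymmetric m"
  shows "irreducible_set (mu_zero_topology J) (stratum l m)"
  unfolding irreducible_set_def
proof (intro conjI allI impI)
  show "stratum l m \<noteq> {}"
    using generic_stratum_nonempty[OF bound] generic_stratum_subset by blast
  show "stratum l m \<subseteq> topspace (mu_zero_topology J)"
    using stratum_subset_mu_zero[OF anti] by (simp add: topspace_mu_zero)
  fix A B assume AB: "closedin (mu_zero_topology J) A" "closedin (mu_zero_topology J) B" "stratum l m \<subseteq> A \<union> B"
  show "stratum l m \<subseteq> A \<or> stratum l m \<subseteq> B"
  proof (rule ccontr)
    assume "\<not> ?thesis"
    then obtain q q' where q: "q \<in> stratum l m" "q \<notin> A" "q' \<in> stratum l m" "q' \<notin> B" by blast
    obtain \<gamma> where \<gamma>: "\<forall>s. \<gamma> s \<in> stratum l m" "\<gamma> 0 = q" "\<gamma> 1 = q'"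
      "\<forall>A. closedin (mu_zero_topology J) A \<longrightarrow> finite {s. \<gamma> s \<in> A} \<or> (\<forall>s :: complex. \<gamma> s \<in> A)"
      using ex_curve_in_stratum[OF bound anti q(1,3)] by blast
    have "finite {s. \<gamma> s \<in> A}" "finite {s. \<gamma> s \<in> B}" using \<gamma>(2-4) AB(1,2) q(2,4) by metis+
    then have "finite ({s. \<gamma> s \<in> A} \<union> {s. \<gamma> s \<in> B})" by simp
    moreover have "{s. \<gamma> s \<in> A} \<union> {s. \<gamma> s \<in> B} = UNIV" using \<gamma>(1) AB(3) by auto
    ultimately show False by (simp add: infinite_UNIV_char_0)
  qed
qed

text \<open>A curve ending at a generic point is generic at all but finitely many parameters. It
  therefore meets \<open>A\<close> infinitely often and lies in \<open>A\<close>, including its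
  starting point.\<close>

lemma generic_stratum_dense:
  assumes bound: "sum_bounded l m"
    and anti: "antisymmetric m" and A: "closedin (mu_zero_topology J) A" "generic_stratum l m \<subseteq> A"
  shows "stratum l m \<subseteq> A"
proof
  fix q assume q: "q \<in> stratum l m"
  obtain q' where q': "q' \<in> generic_stratum l m" using generic_stratum_nonempty[OF bound] by blast
  then have "q' \<in> stratum l m" using generic_stratum_subset by blast
  then obtain \<gamma> where \<gamma>: "\<gamma> 0 = q" "finite {s :: complex. \<gamma> s \<notin> generic_stratum l m}"
      "finite {s. \<gamma> s \<in> A} \<or> (\<forall>s. \<gamma> s \<in> A)"
    using ex_curve_in_stratum[OF bound anti q] q' A(1) by metis
  have "\<not> finite {s. \<gamma> s \<in> A}"
  proof
    assume "finite {s. \<gamma> s \<in> A}"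
    then have "finite ({s. \<gamma> s \<in> A} \<union> {s. \<gamma> s \<notin> generic_stratum l m})" using \<gamma>(2) by simp
    moreover have "{s. \<gamma> s \<in> A} \<union> {s. \<gamma> s \<notin> generic_stratum l m} = UNIV" using A(2) by auto
    ultimately show False by (simp add: infinite_UNIV_char_0)
  qed
  then show "q \<in> A" using \<gamma>(1,3) by metis
qed

section \<open>Closures of strata and irreducible components\<close>

lemma Lambda_eq_closure_stratum:
  assumes e: "is_basis e" and p: "is_partition n \<theta>" "is_partition n \<zeta>"
  shows "Lambda J e \<theta> \<zeta> = mu_zero_topology J closure_of stratum (sig \<theta>) (\<lambda>i. sig \<theta> i + sig \<zeta> i)"
proof -
  let ?m = "\<lambda>i. sig \<theta> i + sig \<zeta> i" and ?T = "mu_zero_topology J"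
  let ?C = "conormal_fixed_points J e (self_dual_signature \<theta>) (self_dual_signature \<zeta>)"
  have anti: "antisymmetric ?m" by (intro antisymmetric_add sig_antisymmetric p)
  have bound: "sum_bounded (sig \<theta>) ?m" by (rule sum_bounded_bisignature[OF p])
  have C: "?C \<subseteq> stratum (sig \<theta>) ?m" by (rule conormal_subset_stratum[OF e p])
  have "stratum (sig \<theta>) ?m \<subseteq> ?T closure_of ?C"
  proof (rule generic_stratum_dense[OF bound anti])
    have "?C \<subseteq> ?T closure_of ?C"
      using C stratum_subset_mu_zero[OF anti] by (intro closure_of_subset) (auto simp: topspace_mu_zero)
    then show "generic_stratum (sig \<theta>) ?m \<subseteq> ?T closure_of ?C"
      using generic_stratum_subset_conormal[OF e p] by blast
  qed auto
  then have "?T closure_of stratum (sig \<theta>) ?m \<subseteq> ?T closure_of ?C"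
    by (intro closure_of_minimal) auto
  moreover have "?T closure_of ?C \<subseteq> ?T closure_of stratum (sig \<theta>) ?m"
    using C by (rule closure_of_mono)
  ultimately show ?thesis by (simp add: Lambda_def)
qed

text \<open>Stages are closed in the zero fibre, so the closure of a stratum stays in any stage
  containing the stratum; closures also inherit irreducibility.\<close>

lemma Lambda_irreducible_closed_sub:
  assumes e: "is_basis e" and p: "is_partition n \<theta>" "is_partition n \<zeta>"
  shows "irreducible_closed_sub J (Lambda J e \<theta> \<zeta>)"
proof -
  let ?m = "\<lambda>i. sig \<theta> i + sig \<zeta> i" and ?T = "mu_zero_topology J"
  have anti: "antisymmetric ?m" by (intro antisymmetric_add sig_antisymmetric p)
  have bound: "sum_bounded (sig \<theta>) ?m" by (rule sum_bounded_bisignature[OF p])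
  obtain k where "stratum (sig \<theta>) ?m \<subseteq> stage J k" using stratum_subset_stage[OF anti] by blast
  then have "?T closure_of stratum (sig \<theta>) ?m \<subseteq> stage J k \<inter> mu_zero J"
    using stratum_subset_mu_zero[OF anti] closedin_stage by (intro closure_of_minimal) auto
  then show ?thesis
    unfolding irreducible_closed_sub_def Lambda_eq_closure_stratum[OF e p]
    using irreducible_set_closure[OF stratum_irreducible[OF bound anti]] by auto
qed

lemma finite_partitions: "finite {\<theta>. is_partition n \<theta> \<and> set \<theta> \<subseteq> {..k}}"
  by (rule finite_subset[OF _ finite_lists_length_eq[of "{..k}" n]]) (auto simp: is_partition_def)

text \<open>Inside one stage finitely many closed sets \<open>Lambda J e \<theta> \<zeta>\<close>
  cover \<open>Z\<close>. Irreducibility puts \<open>Z\<close> into one of them, and maximality of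
  \<open>Z\<close> turns the inclusion into equality.\<close>

lemma irreducible_component_is_Lambda:
  assumes e: "is_basis e" and Z: "irreducible_component J Z"
  shows "\<exists>\<theta> \<zeta>. is_partition n \<theta> \<and> is_partition n \<zeta> \<and> Z = Lambda J e \<theta> \<zeta>"
proof -
  have irr: "irreducible_set (mu_zero_topology J) Z" and "\<exists>k. Z \<subseteq> stage J k"
    using Z by (auto simp: irreducible_component_def irreducible_closed_sub_def)
  then obtain k where k: "Z \<subseteq> stage J k" by blast
  let ?P = "{\<theta>. is_partition n \<theta> \<and> set \<theta> \<subseteq> {..k}}"
  have cover: "Z \<subseteq> (\<Union>(\<theta>, \<zeta>)\<in>?P \<times> ?P. Lambda J e \<theta> \<zeta>)"
  proof
    fix q assume q: "q \<in> Z"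
    then have "q \<in> mu_zero J" using irr by (auto simp: irreducible_set_def topspace_mu_zero)
    then obtain \<theta> \<zeta> where tz: "is_partition n \<theta>" "is_partition n \<zeta>" "set \<theta> \<subseteq> {..k}" "set \<zeta> \<subseteq> {..k}"
        "q \<in> stratum (sig \<theta>) (\<lambda>i. sig \<theta> i + sig \<zeta> i)"
      using mu_zero_stage_covered q k by blast
    have "stratum (sig \<theta>) (\<lambda>i. sig \<theta> i + sig \<zeta> i) \<subseteq> Lambda J e \<theta> \<zeta>"
      unfolding Lambda_eq_closure_stratum[OF e tz(1,2)]
      by (intro closure_of_subset)
        (simp add: topspace_mu_zero stratum_subset_mu_zero antisymmetric_add sig_antisymmetric tz)
    then show "q \<in> (\<Union>(\<theta>, \<zeta>)\<in>?P \<times> ?P. Lambda J e \<theta> \<zeta>)" using tz by blast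
  qed
  have "\<exists>i\<in>?P \<times> ?P. Z \<subseteq> (case i of (\<theta>, \<zeta>) \<Rightarrow> Lambda J e \<theta> \<zeta>)"
  proof (rule irreducible_set_finite_cover[OF irr _ _ cover])
    show "finite (?P \<times> ?P)" using finite_partitions by blast
  qed (auto simp: Lambda_def)
  then obtain \<theta> \<zeta> where tz: "is_partition n \<theta>" "is_partition n \<zeta>" "Z \<subseteq> Lambda J e \<theta> \<zeta>" by auto
  then have "Lambda J e \<theta> \<zeta> = Z"
    using Z Lambda_irreducible_closed_sub[OF e] unfolding irreducible_component_def by blast
  then show ?thesis using tz by blast
qed

end

theorem proposition2p6p4:
  fixes n :: nat
    and J :: "complex ^ 'm ^ ('m::finite)"
    and e :: "(complex ^ 'm) list"
    and Z :: "('m Fvec \<times> 'm Fmat set \<times> 'm Fmat) set"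
  assumes "CARD('m) = 2 * n"
    and "symplectic_gram J"
    and "is_basis e"
    and "irreducible_component J Z"
  shows "\<exists>\<theta> \<zeta>. is_partition n \<theta> \<and> is_partition n \<zeta> \<and> Z = Lambda J e \<theta> \<zeta>"
proof -
  interpret symplectic_space J n using assms(1,2) by unfold_locales
  show ?thesis using assms(3,4) by (rule irreducible_component_is_Lambda)
qed

end
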